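(* Consider the stochastic $K$-armed bandit problem with arm means $\mu_1,\dots,\mu_K\in[0,1]$ and a time horizon $T>0$ that is known to the algorithm. Let $\mu_*=\max_{i\in[K]}\mu_i$, $\Delta_i=\mu_*-\mu_i$, and $\Delta=\min_{i:\Delta_i>0}\Delta_i$. Then for any $T>0$ there exists an algorithm (which may depend on $T$) that uses $O(1)$ words of space and achieves pseudo-regret \[ \overline{\Psi}_T = O\left(\sum_{i:\Delta_i>0}\frac{1}{\Delta_i}\log(\Delta_i/\Delta)\log T\right). \]
   Context: Stochastic bandit model: there are $K$ arms; arm $i\in[K]$ has a distribution $\mathcal{D}_i$ supported on $[0,1]$ with mean $\mu_i$. At each time step $t=1,2,\dots,T$ the player chooses an arm $I_t\in[K]$ (depending only on past observations and internal randomness) and receives reward $X_{I_t,t}$, where the rewards $X_{i,t}$ are drawn from $\mathcal{D}_i$ independently across $i$ and $t$. The pseudo-regret is $\overline{\Psi}_T=\max_{i\in[K]}\left(\mathbb{E}\left[\sum_{t=1}^T X_{i,t}\right]-\mathbb{E}\left[\sum_{t=1}^T X_{I_t,t}\right]\right)$. Space is measured in words in the word-RAM model: each input value (such as $K$, $T$, a reward) and each variable occupies $O(1)$ words of $O(\log(KT))$ bits. The $O(\cdot)$ hides an absolute constant independent of $K$, $T$ and the arm distributions.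
   Formalization: Both logarithms in the regret bound are read as max(1, ln x), since with plain logarithms the bound is 0 when all suboptimal arms have the same gap or when T = 1, and no algorithm has regret 0 on all such instances. *)

theory Defs
  imports "HOL-Probability.Probability"
begin

section \<open>Bandit instances\<close>

text \<open>Arms are numbered 1 to K; the values of D outside this range are irrelevant.\<close>

definition bandit_instance :: "nat \<Rightarrow> (nat \<Rightarrow> real measure) \<Rightarrow> bool" where
  "bandit_instance K D \<longleftrightarrow>
     (\<forall>i\<in>{1..K}. prob_space (D i) \<and> sets (D i) = sets borel \<and> (AE x in D i. x \<in> {0..1}))"

definition arm_mean :: "(nat \<Rightarrow> real measure) \<Rightarrow> nat \<Rightarrow> real" where
  "arm_mean D i = (\<integral>x. x \<partial>D i)"

definition best_mean :: "nat \<Rightarrow> (nat \<Rightarrow> real measure) \<Rightarrow> real" where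
  "best_mean K D = Max (arm_mean D ` {1..K})"

definition gap :: "nat \<Rightarrow> (nat \<Rightarrow> real measure) \<Rightarrow> nat \<Rightarrow> real" where
  "gap K D i = best_mean K D - arm_mean D i"

definition suboptimal_arms :: "nat \<Rightarrow> (nat \<Rightarrow> real measure) \<Rightarrow> nat set" where
  "suboptimal_arms K D = {i\<in>{1..K}. gap K D i > 0}"

text \<open>Only meaningful if there is a suboptimal arm; the regret bound below uses it only inside
  a sum over the suboptimal arms.\<close>

definition min_gap :: "nat \<Rightarrow> (nat \<Rightarrow> real measure) \<Rightarrow> real" where
  "min_gap K D = Min (gap K D ` suboptimal_arms K D)"

text \<open>An outcome consists of the table of all rewards \<open>X (i, t)\<close> and of the stream of fair coin
  tosses that serves as internal randomness of the player, all mutually independent.\<close>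

type_synonym outcome = "(nat \<times> nat \<Rightarrow> real) \<times> (nat \<Rightarrow> bool)"

definition outcomes :: "nat \<Rightarrow> nat \<Rightarrow> (nat \<Rightarrow> real measure) \<Rightarrow> outcome measure" where
  "outcomes K T D =
     (\<Pi>\<^sub>M (i, t)\<in>{1..K} \<times> {1..T}. D i) \<Otimes>\<^sub>M
     (\<Pi>\<^sub>M n\<in>(UNIV :: nat set). measure_pmf (bernoulli_pmf (1/2)))"

text \<open>\<open>I \<omega> t\<close> is the arm chosen at time t.\<close>

definition pseudo_regret ::
    "nat \<Rightarrow> nat \<Rightarrow> (nat \<Rightarrow> real measure) \<Rightarrow> (outcome \<Rightarrow> nat \<Rightarrow> nat) \<Rightarrow> real" where
  "pseudo_regret K T D I =
     (MAX i\<in>{1..K}.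
        (\<integral>\<omega>. (\<Sum>t=1..T. fst \<omega> (i, t)) \<partial>outcomes K T D) -
        (\<integral>\<omega>. (\<Sum>t=1..T. fst \<omega> (I \<omega> t, t)) \<partial>outcomes K T D))"

text \<open>Logarithms in regret bounds are read as at least 1. With the plain logarithm the bound
  \<open>\<Sum> 1/\<Delta>\<^sub>i * log (\<Delta>\<^sub>i/\<Delta>) * log T\<close> would be 0 if all suboptimal arms have the same gap, or if
  \<open>T = 1\<close>, and no algorithm has regret 0 on all such instances.\<close>

definition log1 :: "real \<Rightarrow> real" where
  "log1 x = max 1 (ln x)"

definition regret_bound :: "nat \<Rightarrow> nat \<Rightarrow> (nat \<Rightarrow> real measure) \<Rightarrow> real" where
  "regret_bound K T D =
     (\<Sum>i\<in>suboptimal_arms K D. 1 / gap K D i * log1 (gap K D i / min_gap K D) * log1 (real T))"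

section \<open>Word-RAM bandit algorithms\<close>

text \<open>The memory of the machine consists of registers that hold words of b bits. All operations
  are modulo \<open>2 ^ b\<close>. There is no indirect addressing: on a constant number of words it can be
  replaced by a case distinction on the address. The operands of instructions are registers,
  except for the word n in \<open>Const r n\<close> and the jump target l in \<open>Jump_less x y l\<close>.\<close>

datatype binop = Add | Sub | Mul | Div | Mod | And | Or | Xor | Shl | Shr

datatype instr =
    Const nat nat         \<comment> \<open>\<open>Const r n\<close>: \<open>r := n\<close>\<close>
  | Op binop nat nat nat  \<comment> \<open>\<open>Op f r x y\<close>: \<open>r := f x y\<close>\<close>
  | Jump_less nat nat nat \<comment> \<open>\<open>Jump_less x y l\<close>: if \<open>x < y\<close> continue with instruction l\<close>
  | Flip nat              \<comment> \<open>\<open>Flip r\<close>: \<open>r :=\<close> next coin toss\<close>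
  | Pull nat nat          \<comment> \<open>\<open>Pull r x\<close>: pull the arm whose number is in x, \<open>r :=\<close> reward\<close>

type_synonym program = "instr list"

fun binop_val :: "nat \<Rightarrow> binop \<Rightarrow> nat \<Rightarrow> nat \<Rightarrow> nat" where
  "binop_val b Add x y = take_bit b (x + y)"
| "binop_val b Sub x y = take_bit b (x + 2 ^ b - y)"
| "binop_val b Mul x y = take_bit b (x * y)"
| "binop_val b Div x y = take_bit b (x div y)"
| "binop_val b Mod x y = take_bit b (x mod y)"
| "binop_val b And x y = take_bit b (semiring_bit_operations_class.and x y)"
| "binop_val b Or x y = take_bit b (semiring_bit_operations_class.or x y)"
| "binop_val b Xor x y = take_bit b (semiring_bit_operations_class.xor x y)"
| "binop_val b Shl x y = take_bit b (push_bit y x)"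
| "binop_val b Shr x y = take_bit b (drop_bit y x)"

text \<open>A reward is handed to the machine as a single word, i.e. as a fixed-point number with b bits.
  The regret refers to the exact reward.\<close>

definition reward_word :: "nat \<Rightarrow> real \<Rightarrow> nat" where
  "reward_word b x = take_bit b (nat \<lfloor>x * (2 ^ b - 1)\<rfloor>)"

text \<open>The fields \<open>pulls\<close> and \<open>coins\<close> count the pulls made and the coins tossed so far. They belong to
  the environment: instructions cannot read them, except that they determine which entry of the
  outcome is revealed next.\<close>

record config =
  pc :: nat
  mem :: "nat \<Rightarrow> nat"
  pulls :: nat
  coins :: nat

definition init :: config where
  "init = \<lparr>pc = 0, mem = (\<lambda>_. 0), pulls = 0, coins = 0\<rparr>"

definition set_reg :: "nat \<Rightarrow> nat \<Rightarrow> config \<Rightarrow> config" where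
  "set_reg r w s = s\<lparr>mem := (mem s)(r := w), pc := Suc (pc s)\<rparr>"

fun exec :: "nat \<Rightarrow> outcome \<Rightarrow> instr \<Rightarrow> config \<Rightarrow> config" where
  "exec b \<omega> (Const r n) s = set_reg r (take_bit b n) s"
| "exec b \<omega> (Op f r x y) s = set_reg r (binop_val b f (mem s x) (mem s y)) s"
| "exec b \<omega> (Jump_less x y l) s = s\<lparr>pc := if mem s x < mem s y then l else Suc (pc s)\<rparr>"
| "exec b \<omega> (Flip r) s =
     (set_reg r (take_bit b (of_bool (snd \<omega> (coins s)))) s)\<lparr>coins := Suc (coins s)\<rparr>"
| "exec b \<omega> (Pull r x) s =
     (set_reg r (reward_word b (fst \<omega> (mem s x, Suc (pulls s)))) s)\<lparr>pulls := Suc (pulls s)\<rparr>"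

definition step :: "nat \<Rightarrow> program \<Rightarrow> outcome \<Rightarrow> config \<Rightarrow> config" where
  "step b P \<omega> s = (if pc s < length P then exec b \<omega> (P ! pc s) s else s)"

definition run :: "nat \<Rightarrow> program \<Rightarrow> outcome \<Rightarrow> nat \<Rightarrow> config" where
  "run b P \<omega> n = (step b P \<omega> ^^ n) init"

text \<open>The t-th pull of the run is a pull of arm i. The run makes at most one t-th pull.\<close>

definition plays :: "nat \<Rightarrow> program \<Rightarrow> outcome \<Rightarrow> nat \<Rightarrow> nat \<Rightarrow> bool" where
  "plays b P \<omega> t i \<longleftrightarrow>
     (\<exists>n r x. let s = run b P \<omega> n in
        pc s < length P \<and> P ! pc s = Pull r x \<and> Suc (pulls s) = t \<and> mem s x = i)"

definition chosen_arm :: "nat \<Rightarrow> program \<Rightarrow> outcome \<Rightarrow> nat \<Rightarrow> nat" where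
  "chosen_arm b P \<omega> t = (THE i. plays b P \<omega> t i)"

text \<open>The machine almost surely chooses some arm at each time step.\<close>

definition valid_player ::
    "nat \<Rightarrow> nat \<Rightarrow> (nat \<Rightarrow> real measure) \<Rightarrow> nat \<Rightarrow> program \<Rightarrow> bool" where
  "valid_player K T D b P \<longleftrightarrow>
     (AE \<omega> in outcomes K T D. \<forall>t\<in>{1..T}. \<exists>i\<in>{1..K}. plays b P \<omega> t i)"

fun registers :: "instr \<Rightarrow> nat set" where
  "registers (Const r n) = {r}"
| "registers (Op f r x y) = {r, x, y}"
| "registers (Jump_less x y l) = {x, y}"
| "registers (Flip r) = {r}"
| "registers (Pull r x) = {r, x}"

text \<open>Space in words. As the program may be chosen depending on K and T, it is charged as
  well: otherwise unbounded information could be kept in the program text and the program counter.\<close>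

definition space_used :: "program \<Rightarrow> nat" where
  "space_used P = card (\<Union> (registers ` set P)) + length P"

text \<open>\<open>c\<close> times the number of binary digits of \<open>K * T\<close>.\<close>

definition word_length :: "nat \<Rightarrow> nat \<Rightarrow> nat \<Rightarrow> nat" where
  "word_length c K T = c * nat \<lceil>log 2 (real (K * T) + 1)\<rceil>"

end

theory Submission
  imports Defs
begin

text \<open>The algorithm proceeds in rounds \<open>s = 0, 1, 2, \<dots>\<close>. At the start of a round the mean of the current
  leader is estimated up to \<open>2\<^sup>-\<^sup>s\<close> with high confidence. Then every arm is compared with the leader,
  by stages that use fresh samples; an arm that survives all stages and is visibly better
  becomes the new leader.

  As the eliminated arms cannot be remembered, every round has to eliminate every suboptimal arm anew.
  If several arms are optimal, there are up to \<open>log T\<close> such rounds, so that an elimination may cost only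
  \<open>log (\<Delta>\<^sub>i/\<Delta>) / \<Delta>\<^sub>i\<^sup>2\<close> pulls on average. Hence the algorithm stores the finest scale J at which
  an elimination was confirmed with high confidence. At the scales \<open>g \<le> J\<close> an arm is rejected by
  tests whose failure probability decreases geometrically in \<open>J - g\<close>: the best arm is wrongly rejected with
  a small constant probability per round, and the probability that this happens in r consecutive rounds decreases
  faster than the cost \<open>4\<^sup>r\<close> of a bad leader. Only arms that pass them are tested with high
  confidence; when such an arm is rejected, J increases, which can happen only a bounded number of
  times for each arm before J exceeds its own scale.

  The expected number of pulls of a suboptimal arm is bounded by a potential function on the
  states at the beginning of the stages, whose expected decrease in a stage is at least the number of
  pulls of that arm.\<close>

section \<open>Sampling and the scanning algorithm\<close>

text \<open>For an arm whose gap has order 2^-G, a test costs about 4^G pulls times the multiplier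
  used, and there are R = O(log T) rounds. With full confidence in every round this would give (log
  T)^2. The two factors of the bound are therefore kept apart: boundedly many full-confidence tests
  cost 4^G * log T each, while the tests of the R rounds use a multiplier proportional to 1 + J - G,
  which is about log2 of the ratio of the gap to the minimal gap. The obstacle is that J is
  trustworthy only while the leader is optimal; under a suboptimal leader it may grow with the
  round. So the potential contains a bound on J that is linear in the probability that a bad leader
  survives.

  Adaptivity is handled without stopping times or conditional expectations: a functional
  \<open>E\<close> with a Hoeffding moment bound and a backward recursion \<open>V\<close> suffice
  for the whole drift argument. Measure theory enters only afterwards, when \<open>V\<close> is
  identified with an expected number of pulls. Failures of full-confidence stages are charged T
  pulls each, at most 1 in total.\<close>

text \<open>\<open>E a f\<close> stands for the expectation of f at the integer reward of a pull of arm a, in units of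
  \<open>1 / M\<close>.\<close>

locale sampling =
  fixes E :: "nat \<Rightarrow> (nat \<Rightarrow> real) \<Rightarrow> real" and M :: real and nu :: "nat \<Rightarrow> real"
  assumes E_add: "E a (\<lambda>y. f y + g y) = E a f + E a g"
    and E_cmult: "E a (\<lambda>y. r * f y) = r * E a f"
    and E_mono: "(\<And>y. f y \<le> g y) \<Longrightarrow> E a f \<le> E a g"
    and E_one: "E a (\<lambda>_. 1) = 1"
    and E_mgf: "E a (\<lambda>y. exp (l * (real y / M - nu a))) \<le> exp (l\<^sup>2 / 8)"
begin

section \<open>Sums of independent rewards and Hoeffding's inequality\<close>

primrec Esum :: "nat \<Rightarrow> nat \<Rightarrow> (nat \<Rightarrow> real) \<Rightarrow> real" where
  "Esum a 0 f = f 0"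
| "Esum a (Suc n) f = E a (\<lambda>y. Esum a n (\<lambda>z. f (y + z)))"

lemma E_const: "E a (\<lambda>_. r) = r"
  using E_cmult[of a r "\<lambda>_. 1"] E_one by simp

lemma E_cmult_right: "E a (\<lambda>y. f y * r) = E a f * r"
  using E_cmult[of a r f] by (simp add: mult.commute)

lemma Esum_add: "Esum a n (\<lambda>y. f y + g y) = Esum a n f + Esum a n g"
  by (induction n arbitrary: f g) (auto simp: E_add)

lemma Esum_cmult: "Esum a n (\<lambda>y. r * f y) = r * Esum a n f"
  by (induction n arbitrary: f) (auto simp: E_cmult)

lemma Esum_mono: "(\<And>y. f y \<le> g y) \<Longrightarrow> Esum a n f \<le> Esum a n g"
  by (induction n arbitrary: f g) (auto intro: E_mono)

lemma Esum_const: "Esum a n (\<lambda>_. r) = r"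
  by (induction n) (auto simp: E_const)

lemma Esum_exp: "Esum a n (\<lambda>z. exp (l * (real z / M - real n * nu a))) \<le> exp (real n * (l\<^sup>2 / 8))"
proof (induction n)
  case (Suc n)
  have "exp (l * (real (y + z) / M - real (Suc n) * nu a))
      = exp (l * (real y / M - nu a)) * exp (l * (real z / M - real n * nu a))" for y z
    by (simp add: exp_add[symmetric] algebra_simps add_divide_distrib)
  then have "Esum a (Suc n) (\<lambda>z. exp (l * (real z / M - real (Suc n) * nu a)))
      = Esum a n (\<lambda>z. exp (l * (real z / M - real n * nu a))) * E a (\<lambda>y. exp (l * (real y / M - nu a)))"
    by (simp only: Esum.simps Esum_cmult E_cmult_right) (simp add: mult.commute)
  also have "\<dots> \<le> exp (real n * (l\<^sup>2 / 8)) * exp (l\<^sup>2 / 8)"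
  proof (rule mult_mono[OF Suc E_mgf])
    have "E a (\<lambda>y. 0) \<le> E a (\<lambda>y. exp (l * (real y / M - nu a)))"
      by (rule E_mono) simp
    then show "0 \<le> E a (\<lambda>y. exp (l * (real y / M - nu a)))" by (simp add: E_const)
  qed simp
  also have "\<dots> = exp (real (Suc n) * (l\<^sup>2 / 8))"
    by (simp add: exp_add[symmetric] algebra_simps add_divide_distrib)
  finally show ?case .
qed simp

text \<open>Markov's inequality for the exponential with parameter \<open>4 * x\<close>, the
  minimiser of l^2/8 - l*x. The event is an arbitrary predicate so that it can later be a branch of
  the algorithm.\<close>

lemma Esum_upper_tail:
  assumes x: "0 \<le> x" and P: "\<And>z. P z \<Longrightarrow> real n * (nu a + x) \<le> real z / M"
  shows "Esum a n (\<lambda>z. of_bool (P z)) \<le> exp (- 2 * real n * x\<^sup>2)"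
proof -
  have "Esum a n (\<lambda>z. of_bool (P z))
      \<le> Esum a n (\<lambda>z. exp (- 4 * real n * x\<^sup>2) * exp (4 * x * (real z / M - real n * nu a)))"
  proof (rule Esum_mono)
    fix z
    show "of_bool (P z) \<le> exp (- 4 * real n * x\<^sup>2) * exp (4 * x * (real z / M - real n * nu a))"
    proof (cases "P z")
      case True
      have "0 \<le> 4 * x * (real z / M - real n * (nu a + x))"
        using P[OF True] x by simp
      then show ?thesis using True by (simp add: exp_add[symmetric] power2_eq_square algebra_simps)
    qed simp
  qed
  also have "\<dots> \<le> exp (- 4 * real n * x\<^sup>2) * exp (real n * ((4 * x)\<^sup>2 / 8))"
    unfolding Esum_cmult by (intro mult_left_mono Esum_exp) simp
  also have "\<dots> = exp (- 2 * real n * x\<^sup>2)"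
    by (simp add: exp_add[symmetric] power2_eq_square algebra_simps)
  finally show ?thesis .
qed

lemma Esum_lower_tail:
  assumes x: "0 \<le> x" and P: "\<And>z. P z \<Longrightarrow> real z / M \<le> real n * (nu a - x)"
  shows "Esum a n (\<lambda>z. of_bool (P z)) \<le> exp (- 2 * real n * x\<^sup>2)"
proof -
  have "Esum a n (\<lambda>z. of_bool (P z))
      \<le> Esum a n (\<lambda>z. exp (- 4 * real n * x\<^sup>2) * exp (- 4 * x * (real z / M - real n * nu a)))"
  proof (rule Esum_mono)
    fix z
    show "of_bool (P z) \<le> exp (- 4 * real n * x\<^sup>2) * exp (- 4 * x * (real z / M - real n * nu a))"
    proof (cases "P z")
      case True
      have "0 \<le> 4 * x * (real n * (nu a - x) - real z / M)"
        using P[OF True] x by simp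
      then show ?thesis using True by (simp add: exp_add[symmetric] power2_eq_square algebra_simps)
    qed simp
  qed
  also have "\<dots> \<le> exp (- 4 * real n * x\<^sup>2) * exp (real n * ((- 4 * x)\<^sup>2 / 8))"
    unfolding Esum_cmult by (intro mult_left_mono Esum_exp) simp
  also have "\<dots> = exp (- 2 * real n * x\<^sup>2)"
    by (simp add: exp_add[symmetric] power2_eq_square algebra_simps)
  finally show ?thesis .
qed

text \<open>As the larger value \<open>A\<close> sits on the event \<open>P\<close>, an upper bound
  \<open>p\<close> may replace the exact probability. The drift estimates use tail bounds only in
  this form.\<close>

lemma Esum_two_point:
  assumes P: "Esum a n (\<lambda>z. of_bool (P z)) \<le> p" and BA: "B \<le> A"
    and f: "\<And>z. P z \<Longrightarrow> f z \<le> A" "\<And>z. \<not> P z \<Longrightarrow> f z \<le> B"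
  shows "Esum a n f \<le> p * A + (1 - p) * B"
proof -
  have "Esum a n f \<le> Esum a n (\<lambda>z. (A - B) * of_bool (P z) + B)"
    using f by (intro Esum_mono) auto
  also have "\<dots> = (A - B) * Esum a n (\<lambda>z. of_bool (P z)) + B"
    by (simp add: Esum_add Esum_cmult Esum_const)
  also have "\<dots> \<le> (A - B) * p + B"
    using P BA by (intro add_right_mono mult_left_mono) auto
  finally show ?thesis by (simp add: algebra_simps)
qed

end

section \<open>The scanning algorithm as a transition system on stages\<close>

datatype phase = Lead | Low nat | Mid nat | High nat

datatype stage =
  Stage (leader: nat) (mval: nat) (top: nat) (rnd: nat) (cur: nat) (phase_of: phase)

instance phase :: countable by countable_datatype
instance stage :: countable by countable_datatype

text \<open>A stage pulls one arm \<open>len q\<close> times. \<^const>\<open>top\<close> is the scale J, and \<^const>\<open>cur\<close> is the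
  arm that is tested, 0 in the leader stage of a round. A test goes through \<^term>\<open>Low g\<close> for
  \<open>g < J\<close>, \<^term>\<open>Mid k\<close> for \<open>k \<le> k0\<close>, and \<^term>\<open>High g\<close> for \<open>J < g \<le> s\<close>. The
  tolerance of \<^term>\<open>Mid k\<close> increases with \<^term>\<open>k\<close> towards \<open>2\<^sup>-\<^sup>J\<close>, by steps that are large compared
  to the standard deviation: with a constant tolerance, an arm whose gap equals this tolerance could
  stay undecided for many phases and then be rejected without an increase of J, in every round.\<close>

locale scan =
  fixes K k0 e :: nat
begin

definition scale :: "stage \<Rightarrow> nat" where
  "scale q = (case phase_of q of Lead \<Rightarrow> rnd q | Low g \<Rightarrow> g | Mid k \<Rightarrow> top q | High g \<Rightarrow> g)"

text \<open>The mean of \<open>4 ^ scale q * lam q\<close> rewards deviates by y * 2^-scale or more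
  with probability at most exp(-2 * lam * y^2) on each side. The factor 128 turns this into exp(-4 *
  16^k0) for y = 1/8 and the full multiplier, and into exp(-16 * (1 + J - g)) for y = 1/4 in
  \<open>Low g\<close>.\<close>

definition lam :: "stage \<Rightarrow> nat" where
  "lam q = (case phase_of q of Low g \<Rightarrow> 128 * (1 + top q - g) | Mid k \<Rightarrow> 128 * 16 ^ k
     | _ \<Rightarrow> 128 * 16 ^ k0)"

definition len :: "stage \<Rightarrow> nat" where
  "len q = 4 ^ scale q * lam q"

definition thr :: "stage \<Rightarrow> nat" where
  "thr q = (case phase_of q of Mid k \<Rightarrow> 2 ^ e div 2 ^ top q - 2 ^ e div 2 ^ (top q + k + 1)
     | _ \<Rightarrow> 2 ^ e div 2 ^ (scale q + 1))"

definition arm :: "stage \<Rightarrow> nat" where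
  "arm q = (if phase_of q = Lead then leader q else cur q)"

definition test_phase :: "nat \<Rightarrow> phase" where
  "test_phase J = (if J = 0 then Mid 0 else Low 0)"

definition next_arm :: "nat \<Rightarrow> nat \<Rightarrow> nat \<Rightarrow> nat \<Rightarrow> nat \<Rightarrow> stage" where
  "next_arm a m J s c =
     (if c < K then Stage a m J s (Suc c) (test_phase J) else Stage a m J (Suc s) 0 Lead)"

definition set_phase :: "stage \<Rightarrow> phase \<Rightarrow> stage" where
  "set_phase q p = Stage (leader q) (mval q) (top q) (rnd q) (cur q) p"

lemma set_phase_sel [simp]:
  "leader (set_phase q p) = leader q" "mval (set_phase q p) = mval q" "top (set_phase q p) = top q"
  "rnd (set_phase q p) = rnd q" "cur (set_phase q p) = cur q" "phase_of (set_phase q p) = p"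
  by (simp_all add: set_phase_def)

definition finish :: "stage \<Rightarrow> nat \<Rightarrow> stage" where
  "finish q v = (if mval q + thr q < v then next_arm (cur q) v (top q) (rnd q) (cur q)
     else next_arm (leader q) (mval q) (top q) (rnd q) (cur q))"

definition pass :: "stage \<Rightarrow> nat \<Rightarrow> stage" where
  "pass q v = (case phase_of q of
       Lead \<Rightarrow> q
     | Low g \<Rightarrow> set_phase q (if Suc g < top q then Low (Suc g) else Mid 0)
     | Mid k \<Rightarrow> (if k < k0 then set_phase q (Mid (Suc k))
         else if top q < rnd q then set_phase q (High (Suc (top q))) else finish q v)
     | High g \<Rightarrow> (if g < rnd q then set_phase q (High (Suc g)) else finish q v))"

text \<open>The maximum changes J only for a rejection in \<open>High g\<close>: in the other test
  phases the scale is at most J, so cheap rejections leave J alone.\<close>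

definition adv :: "stage \<Rightarrow> nat \<Rightarrow> stage" where
  "adv q v = (if phase_of q = Lead then next_arm (leader q) v (top q) (rnd q) 0
     else if v + thr q < mval q
       then next_arm (leader q) (mval q) (max (top q) (scale q)) (rnd q) (cur q)
     else pass q v)"

definition nxt :: "stage \<times> nat \<times> nat \<Rightarrow> nat \<Rightarrow> stage \<times> nat \<times> nat" where
  "nxt x y = (case x of (q, n, u) \<Rightarrow>
     if Suc n < len q then (q, Suc n, u + y) else (adv q ((u + y) div len q), 0, 0))"

definition start :: "stage \<times> nat \<times> nat" where
  "start = (Stage 1 0 0 0 0 Lead, 0, 0)"

end

section \<open>Expected cost as a backward recursion\<close>

locale scan_sampling = scan K k0 e + sampling E "2 ^ e" nu
  for K k0 e :: nat and E nu +
  fixes cost :: "nat \<Rightarrow> real"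
begin

primrec V :: "nat \<Rightarrow> stage \<times> nat \<times> nat \<Rightarrow> real" where
  "V 0 x = 0"
| "V (Suc k) x = cost (arm (fst x)) + E (arm (fst x)) (\<lambda>y. V k (nxt x y))"

lemma V_stage_incomplete:
  "k + n < len q \<Longrightarrow> V k (q, n, u) = real k * cost (arm q)"
proof (induction k arbitrary: n u)
  case (Suc k)
  then have "V k (nxt (q, n, u) y) = real k * cost (arm q)" for y
    by (simp add: nxt_def)
  then show ?case by (simp add: E_const algebra_simps)
qed simp

text \<open>Within a stage the arm is fixed and only the running sum matters, so the recursion over
  pulls collapses to one transition per stage.\<close>

lemma V_stage_complete:
  "n + r = len q \<Longrightarrow> 0 < r \<Longrightarrow> V (r + k) (q, n, u) =
     real r * cost (arm q) + Esum (arm q) r (\<lambda>z. V k (adv q ((u + z) div len q), 0, 0))"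
proof (induction r arbitrary: n u)
  case (Suc r)
  show ?case
  proof (cases "r = 0")
    case True
    then show ?thesis using Suc by (simp add: nxt_def)
  next
    case False
    then have "V (r + k) (nxt (q, n, u) y) = real r * cost (arm q)
        + Esum (arm q) r (\<lambda>z. V k (adv q ((u + (y + z)) div len q), 0, 0))" for y
      using Suc.prems Suc.IH[of "Suc n" "u + y"] by (simp add: nxt_def add.assoc)
    then show ?thesis by (simp add: E_const E_add algebra_simps)
  qed
qed simp

lemma V_stage:
  assumes "len q \<le> k" "0 < len q"
  shows "V k (q, 0, 0) = real (len q) * cost (arm q)
    + Esum (arm q) (len q) (\<lambda>z. V (k - len q) (adv q (z div len q), 0, 0))"
  using V_stage_complete[of 0 "len q" q "k - len q" 0] assms by simp

lemma V_le:
  assumes "\<And>a. cost a \<le> 1" shows "V k x \<le> real k"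
proof (induction k arbitrary: x)
  case (Suc k)
  have "E (arm (fst x)) (\<lambda>y. V k (nxt x y)) \<le> E (arm (fst x)) (\<lambda>y. real k)"
    by (rule E_mono) (rule Suc)
  then show ?case using assms[of "arm (fst x)"] by (simp add: E_const)
qed simp

end

section \<open>The potential function\<close>

abbreviation w :: "nat \<Rightarrow> real" where "w g \<equiv> (1 / 2) ^ g"

lemma w_antimono: "g \<le> h \<Longrightarrow> w h \<le> w g"
  by (simp add: power_decreasing)

lemma w_half: "g < h \<Longrightarrow> 2 * w h \<le> w g"
  using w_antimono[of "Suc g" h] by simp

lemma w_less_imp: "w g < w h \<Longrightarrow> h < g"
  by (metis linorder_not_le w_antimono not_less)

lemma four_w: "4 ^ g * (w g)\<^sup>2 = 1"
  by (simp add: power2_eq_square power_mult_distrib[symmetric])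

lemma geometric_four: "(\<Sum>g<n. (4::real) ^ g) \<le> 4 ^ n / 3"
  by (induction n) auto

lemma weighted_geometric_four: "(\<Sum>g<J. (4::real) ^ g * real (1 + J - g)) \<le> 4 ^ J"
proof (induction J)
  case (Suc J)
  have "(\<Sum>g<J. (4::real) ^ g * real (1 + Suc J - g))
      = (\<Sum>g<J. 4 ^ g * real (1 + J - g)) + (\<Sum>g<J. 4 ^ g)"
    unfolding sum.distrib[symmetric] by (rule sum.cong) (auto simp: of_nat_diff algebra_simps)
  moreover have "(0::real) \<le> 4 ^ J" by simp
  ultimately show ?case using Suc geometric_four[of J] by (simp del: zero_le_power)
qed simp

text \<open>Fourfold growth of the stages beats the linear decay of the multiplier, so all
  \<open>Low\<close> stages below scale G together cost no more than one stage at scale G.\<close>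

lemma weighted_geometric_four':
  assumes "G \<le> J"
  shows "(\<Sum>g<G. (4::real) ^ g * real (1 + J - g)) \<le> 4 ^ G * real (1 + J - G)"
proof -
  have "(\<Sum>g<G. (4::real) ^ g * real (1 + J - g))
      = (\<Sum>g<G. 4 ^ g * real (1 + G - g)) + real (J - G) * (\<Sum>g<G. 4 ^ g)"
    unfolding sum_distrib_left sum.distrib[symmetric]
    using assms by (intro sum.cong) (auto simp: of_nat_diff algebra_simps)
  also have "\<dots> \<le> 4 ^ G + real (J - G) * (4 ^ G / 3)"
    by (intro add_mono weighted_geometric_four mult_left_mono geometric_four) simp
  also have "\<dots> \<le> 4 ^ G * real (1 + J - G)"
    using assms mult_right_mono[of "real G" "real J" "4 ^ G"]
    by (simp add: of_nat_diff field_simps)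
  finally show ?thesis .
qed

locale scan_regret = scan_sampling K k0 e E nu "\<lambda>a. of_bool (a = i)"
  for K k0 e :: nat and E nu and i :: nat +
  fixes T R G D b :: nat and mu :: "nat \<Rightarrow> real" and \<eta> :: real
  assumes rounds: "\<And>s. 4 ^ s \<le> 4 * T \<Longrightarrow> s \<le> R"
    and bits: "R + k0 + 7 \<le> e"
    and nu: "\<And>a. a \<in> {1..K} \<Longrightarrow> \<bar>nu a - mu a\<bar> \<le> \<eta>"
    and eta: "128 * \<eta> \<le> w R"
    and confidence: "2 * (real T)\<^sup>2 * exp (- 4 * 16 ^ k0) \<le> 1"
    and i: "i \<in> {1..K}" and b: "b \<in> {1..K}"
    and best: "\<And>a. a \<in> {1..K} \<Longrightarrow> mu a \<le> mu b"
    and D: "\<And>a. a \<in> {1..K} \<Longrightarrow> mu a < mu b \<Longrightarrow> 8 * w D \<le> mu b - mu a"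
    and G: "8 * w G \<le> mu b - mu i" "mu b - mu i < 16 * w G" "G \<le> D"
begin

text \<open>\<^term>\<open>i\<close> is the suboptimal arm whose pulls are counted, \<^term>\<open>b\<close> is a best arm, \<^term>\<open>G\<close> and
  \<^term>\<open>D\<close> are the scales of the gap of \<^term>\<open>i\<close> and of the minimal gap. As the machine sees rounded
  rewards, \<^term>\<open>nu\<close> differs from the true means \<^term>\<open>mu\<close>.\<close>

abbreviation L :: real where "L \<equiv> 128 * 16 ^ k0"

text \<open>It persists as long as all samples are good. The constant 5/32 exceeds the sampling
  error 1/8 plus the loss of at most 1/128 by rounding the average down. The bound
  \<open>3 * w g\<close> is inherited from the full-multiplier stage just passed at scale g - 1,
  where tolerance and errors add up to less than 3/2 units.\<close>

definition inv :: "stage \<Rightarrow> bool" where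
  "inv q \<longleftrightarrow> leader q \<in> {1..K} \<and> cur q \<le> K \<and> top q \<le> rnd q \<and> rnd q \<le> R \<and>
     (phase_of q = Lead \<longleftrightarrow> cur q = 0) \<and>
     (cur q \<ge> 1 \<longrightarrow> \<bar>real (mval q) / 2 ^ e - nu (leader q)\<bar> \<le> 5 / 32 * w (rnd q)) \<and>
     (case phase_of q of Lead \<Rightarrow> True | Low g \<Rightarrow> g < top q | Mid k \<Rightarrow> k \<le> k0
      | High g \<Rightarrow> top q < g \<and> g \<le> rnd q \<and> nu (leader q) - nu (cur q) \<le> 3 * w g)"

text \<open>Only stages with the full multiplier are constrained: their failures are rare enough for
  a union bound. A failure of a cheaper stage is an ordinary event that the potential has to
  absorb.\<close>

definition good :: "stage \<Rightarrow> nat \<Rightarrow> bool" where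
  "good q z \<longleftrightarrow> (lam q = 128 * 16 ^ k0 \<longrightarrow>
     \<bar>real z / 2 ^ e - real (len q) * nu (arm q)\<bar> \<le> real (len q) * (w (scale q) / 8))"

definition far_leader :: "nat \<Rightarrow> bool" where
  "far_leader a \<longleftrightarrow> mu b - mu i < 2 * (mu b - mu a)"

definition near :: "nat \<Rightarrow> nat \<Rightarrow> bool" where
  "near a s \<longleftrightarrow> s \<le> G \<or> far_leader a"

text \<open>The summands of the potential \<open>pot\<close> account for the following pulls of \<^term>\<open>i\<close>.
  \<^item> \<open>L * 4 ^ G * min (G - J) 6\<close>: the tests of \<^term>\<open>i\<close> with high confidence after round
    \<^term>\<open>G\<close>. Each of them raises J above \<open>G - 6\<close>.
  \<^item> \<open>round_pot\<close>: a test of \<^term>\<open>i\<close> by a good leader, for each remaining round. It is linear in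
    \<open>top_bound\<close>, a bound on the expected final value of J: as long as the leader is optimal, J
    does not exceed \<^term>\<open>D\<close>.
  \<^item> \<open>far_pot\<close>: the pulls before round \<^term>\<open>G\<close>, and later those due to a leader that is not much better
    than \<^term>\<open>i\<close>. This leader survives the round only if the test of \<^term>\<open>b\<close> fails. The factor
    \<open>risk\<close> is the probability of that failure, given how far the round has proceeded.\<close>

definition miss :: "nat \<Rightarrow> phase \<Rightarrow> real" where
  "miss J p = (case p of Low g \<Rightarrow> 4 * (1 / 32) - 2 * (1 / 32) ^ (1 + J - g)
     | Mid k \<Rightarrow> 2 * (1 / 32) ^ Suc k | _ \<Rightarrow> 0)"

definition risk :: "nat \<Rightarrow> nat \<Rightarrow> phase \<Rightarrow> real" where
  "risk J c p = (if c < b then 1 / 8 else if c = b then miss J p else 1)"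

text \<open>The slope 2 in \<open>r\<close> makes the bound survive the end of a round, where
  \<open>s\<close> grows by 1 and \<open>r\<close> falls from 1 to 1/8: (s + 1) + 2/8 <= s + 2, and
  D + 1 + 2/8 <= D + 2 on leaving round D. At \<open>r = 0\<close> the value \<open>s\<close> still
  dominates \<open>max J D\<close> after round D, which permits the change to an optimal
  leader.\<close>

definition top_bound :: "nat \<Rightarrow> nat \<Rightarrow> nat \<Rightarrow> real \<Rightarrow> real" where
  "top_bound a J s r = (if s \<le> D then real D + 2 else if mu a < mu b then real s + 2 * r
     else real (max J D))"

definition round_pot :: "real \<Rightarrow> real" where
  "round_pot x = 512 * 4 ^ G * (2 + x - real G)"

definition far_pot :: "nat \<Rightarrow> nat \<Rightarrow> real \<Rightarrow> real" where
  "far_pot a s r = (if s \<le> G then L * (20 * 4 ^ Suc G + 12 * (4 ^ Suc G - 4 ^ s))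
     else if far_leader a then 20 * L * 4 ^ Suc s * r else 0)"

definition base :: "nat \<Rightarrow> nat \<Rightarrow> nat \<Rightarrow> real \<Rightarrow> real" where
  "base a J s r = L * 4 ^ G * real (min (G - J) 6) + real (R - s) * round_pot (top_bound a J s r) + far_pot a s r"

definition pos_pot :: "nat \<Rightarrow> nat \<Rightarrow> nat \<Rightarrow> nat \<Rightarrow> real \<Rightarrow> real" where
  "pos_pot a J s c r = base a J s r +
     (if c < i then round_pot (top_bound a J s r) + (if near a s then 8 * 4 ^ s * L else 0) else 0)"

definition arm_pot :: "nat \<Rightarrow> nat \<Rightarrow> nat \<Rightarrow> nat \<Rightarrow> real" where
  "arm_pot a J s c = pos_pot a J s c (if c < b then 1 / 8 else 1)"

definition remaining :: "stage \<Rightarrow> real" where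
  "remaining q = (case phase_of q of Lead \<Rightarrow> 0
     | Low g \<Rightarrow> (\<Sum>h\<in>{g..<top q}. 4 ^ h * (128 * real (1 + top q - h)))
         + (\<Sum>k\<in>{0..k0}. 4 ^ top q * (128 * 16 ^ k)) + (\<Sum>h\<in>{top q<..rnd q}. 4 ^ h * L)
     | Mid k \<Rightarrow> (\<Sum>k\<in>{k..k0}. 4 ^ top q * (128 * 16 ^ k)) + (\<Sum>h\<in>{top q<..rnd q}. 4 ^ h * L)
     | High g \<Rightarrow> (\<Sum>h\<in>{g..rnd q}. 4 ^ h * L))"

text \<open>In the phases \<^const>\<open>Mid\<close>, the potential of a test of \<^term>\<open>i\<close> is decreased by the number
  \<open>mid_sum\<close> of pulls already made in these phases: they are paid for in advance by
  the increase of J if the arm reaches the phases \<^const>\<open>High\<close>, so only the case that it is rejected before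
  contributes. If the gap \<^term>\<open>d\<close> is clearly below the tolerance of phase \<^term>\<open>k\<close>, a rejection is
  unlikely from now on.\<close>

definition mid_sum :: "nat \<Rightarrow> nat \<Rightarrow> real" where
  "mid_sum J k = 4 ^ J * 128 * (16 ^ k - 1) / 15"

definition mid_pot :: "nat \<Rightarrow> real \<Rightarrow> nat \<Rightarrow> real" where
  "mid_pot J d k = (if d \<le> w J * (1 - 5 / 4 * w (Suc k)) then 4 ^ J * 128 * w k
     else 3 * mid_sum J (Suc k))"

text \<open>If J has reached G, stages below scale G are prepaid in full; from G on a stage is
  passed with probability at most 1/32, so twice the current length suffices. If J < G, the values
  in \<open>Mid\<close> and \<open>High\<close> may be negative: they are advances against the
  summand of \<open>base\<close> that depends on \<open>min (G - J) 6\<close>.\<close>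

definition test_pot :: "stage \<Rightarrow> real" where
  "test_pot q = (let J = top q; d = real (mval q) / 2 ^ e - nu i in
     if G \<le> J then (case phase_of q of Lead \<Rightarrow> 0
       | Low g \<Rightarrow> (\<Sum>h\<in>{g..<G}. 4 ^ h * (128 * real (1 + J - h)))
           + 2 * 4 ^ max g G * (128 * real (1 + J - max g G))
       | Mid k \<Rightarrow> 2 * 4 ^ J * (128 * 16 ^ k)
       | High g \<Rightarrow> 0)
     else (case phase_of q of Lead \<Rightarrow> 0
       | Low g \<Rightarrow> (\<Sum>h\<in>{g..<J}. 4 ^ h * (128 * real (1 + J - h))) + 384 * 4 ^ J
       | Mid k \<Rightarrow> mid_pot J d k - mid_sum J k
       | High g \<Rightarrow> (\<Sum>h\<in>{g..<G}. 4 ^ h * L) - L * 4 ^ G))"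

definition pot :: "stage \<Rightarrow> real" where
  "pot q = (let a = leader q; J = top q; s = rnd q; c = cur q; r = risk J c (phase_of q) in
     if c < i then pos_pot a J s c r + (if c = 0 \<and> near a s then 4 ^ s * L else 0)
     else base a J s r + (if c = i then (if near a s then remaining q + round_pot (top_bound a J s r)
       else test_pot q) else 0))"

section \<open>Sign and monotonicity of the potential\<close>

lemma eta_le: "s \<le> R \<Longrightarrow> 128 * \<eta> \<le> w s"
  using eta w_antimono[of s R] by linarith

lemma unit_le: assumes "s \<le> R" shows "128 * (1 / 2 ^ e) \<le> w s"
proof -
  have "128 * w e = w (e - 7)"
    using bits power_add[of "1/2::real" "e - 7" 7] by (simp add: power_one_over)
  also have "\<dots> \<le> w s" using bits assms by (intro w_antimono) simp
  finally show ?thesis by (simp add: power_one_over)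
qed

lemma top_bound_ge: "0 \<le> r \<Longrightarrow> real D \<le> top_bound a J s r"
  by (auto simp: top_bound_def)

lemma top_bound_ge_top: "0 \<le> r \<Longrightarrow> J \<le> s \<Longrightarrow> real J \<le> top_bound a J s r"
  by (auto simp: top_bound_def)

lemma round_pot_mono: "x \<le> y \<Longrightarrow> round_pot x \<le> round_pot y"
  by (simp add: round_pot_def mult_left_mono)

lemma round_pot_top_bound_ge: assumes "0 \<le> r" shows "1024 * 4 ^ G \<le> round_pot (top_bound a J s r)"
proof -
  have "round_pot (real G) \<le> round_pot (top_bound a J s r)"
    using G(3) top_bound_ge[OF assms, of a J s] by (intro round_pot_mono) linarith
  then show ?thesis by (simp add: round_pot_def)
qed

lemma round_pot_top_bound_nonneg: "0 \<le> r \<Longrightarrow> 0 \<le> round_pot (top_bound a J s r)"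
  by (rule order_trans[OF _ round_pot_top_bound_ge]) auto

lemma far_pot_nonneg: assumes "0 \<le> r" shows "0 \<le> far_pot a s r"
proof -
  have "(4::real) ^ s \<le> 4 ^ Suc G" if "s \<le> G" using that by (intro power_increasing) auto
  then have "0 \<le> 20 * 4 ^ Suc G + 12 * ((4::real) ^ Suc G - 4 ^ s)" if "s \<le> G"
    using that by (intro add_nonneg_nonneg mult_nonneg_nonneg) auto
  then show ?thesis using assms unfolding far_pot_def
    by (auto simp del: power_Suc intro!: mult_nonneg_nonneg)
qed

lemma base_ge: "0 \<le> r \<Longrightarrow> L * 4 ^ G * real (min (G - J) 6) \<le> base a J s r"
  using far_pot_nonneg round_pot_top_bound_nonneg by (auto simp: base_def)

lemma base_nonneg: "0 \<le> r \<Longrightarrow> 0 \<le> base a J s r"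
  by (rule order_trans[OF _ base_ge]) auto

lemma pos_pot_nonneg: "0 \<le> r \<Longrightarrow> 0 \<le> pos_pot a J s c r"
  using base_nonneg round_pot_top_bound_nonneg by (auto simp: pos_pot_def)

lemma arm_pot_nonneg: "0 \<le> arm_pot a J s c"
  by (simp add: arm_pot_def pos_pot_nonneg)

lemma top_bound_mono: "r \<le> r' \<Longrightarrow> top_bound a J s r \<le> top_bound a J s r'"
  by (auto simp: top_bound_def)

lemma base_mono: "r \<le> r' \<Longrightarrow> base a J s r \<le> base a J s r'"
  unfolding base_def far_pot_def
  by (intro add_mono mult_left_mono round_pot_mono top_bound_mono) auto

lemma pos_pot_mono: "r \<le> r' \<Longrightarrow> pos_pot a J s c r \<le> pos_pot a J s c r'"
  unfolding pos_pot_def by (intro add_mono base_mono) (auto intro: round_pot_mono top_bound_mono)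

text \<open>Because of affinity, averaging the potential over the outcomes of a test of
  \<open>b\<close> amounts to averaging the risk.\<close>

lemma pos_pot_affine: "pos_pot a J s c r = pos_pot a J s c 0 + r * (pos_pot a J s c 1 - pos_pot a J s c 0)"
  by (auto simp: pos_pot_def base_def far_pot_def top_bound_def round_pot_def algebra_simps)

text \<open>A larger J lowers the number of full-confidence tests still owed. It enters
  \<open>top_bound\<close> only for an optimal leader after round D, where the second premise keeps
  it in check.\<close>

lemma pos_pot_top:
  assumes "J \<le> J'" "mu a = mu b \<Longrightarrow> D < s \<Longrightarrow> J' \<le> max J D" "0 \<le> r" "a \<in> {1..K}"
  shows "base a J' s r \<le> base a J s r" "pos_pot a J' s c r \<le> pos_pot a J s c r"
proof -
  have *: "top_bound a J' s r \<le> top_bound a J s r"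
    using assms best[of a] by (auto simp: top_bound_def)
  then show 1: "base a J' s r \<le> base a J s r"
    unfolding base_def using assms(1) by (intro add_mono mult_left_mono round_pot_mono) auto
  show "pos_pot a J' s c r \<le> pos_pot a J s c r"
    unfolding pos_pot_def using 1 * by (intro add_mono) (auto intro: round_pot_mono)
qed

lemma pos_pot_leader:
  assumes "mu a \<le> mu a'" "J \<le> s" "0 \<le> r"
  shows "base a' J s r \<le> base a J s r" "pos_pot a' J s c r \<le> pos_pot a J s c r"
proof -
  have *: "top_bound a' J s r \<le> top_bound a J s r"
    using assms by (auto simp: top_bound_def)
  have 2: "far_leader a' \<Longrightarrow> far_leader a"
    using assms by (auto simp: far_leader_def)
  then have 3: "far_pot a' s r \<le> far_pot a s r"
    using assms by (auto simp: far_pot_def)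
  then show 1: "base a' J s r \<le> base a J s r"
    unfolding base_def using * by (intro add_mono mult_left_mono round_pot_mono) auto
  show "pos_pot a' J s c r \<le> pos_pot a J s c r"
    unfolding pos_pot_def using 1 2 * add_increasing2[OF _ round_pot_mono[OF *], of "8 * 4 ^ s * L"]
    by (intro add_mono) (auto simp: near_def round_pot_mono)
qed

text \<open>For the leader \<open>b\<close> both terms that depend on the risk disappear: it is
  neither suboptimal nor far. Hence its potential at full risk is within that of any leader at risk
  0.\<close>

lemma pos_pot_best: assumes "J \<le> s" shows "pos_pot b J s c 1 \<le> pos_pot a J s c 0"
proof -
  have *: "top_bound b J s 1 \<le> top_bound a J s 0"
    using assms by (auto simp: top_bound_def)
  have 2: "\<not> far_leader b"
    using best[OF i] by (simp add: far_leader_def)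
  then have 3: "far_pot b s 1 \<le> far_pot a s 0"
    by (auto simp: far_pot_def)
  then have 1: "base b J s 1 \<le> base a J s 0"
    unfolding base_def using * by (intro add_mono mult_left_mono round_pot_mono) auto
  show ?thesis
    unfolding pos_pot_def using 1 2 * add_increasing2[OF _ round_pot_mono[OF *], of "8 * 4 ^ s * L"]
    by (intro add_mono) (auto simp: near_def round_pot_mono)
qed

lemma miss_bounds:
  assumes "\<forall>g. p = Low g \<longrightarrow> g \<le> J" shows "0 \<le> miss J p" "miss J p \<le> 1 / 8"
proof -
  have 1: "(1 / 32::real) ^ Suc n \<le> 1 / 32" for n
    using power_decreasing[of 1 "Suc n" "1/32::real"] by simp
  have 2: "1 + J - g = Suc (J - g)" if "g \<le> J" for g using that by simp
  have 3: "0 \<le> (1 / 32::real) ^ n" for n by simp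
  show "0 \<le> miss J p" proof (cases p)
    case (Low g)
    then show ?thesis using 1[of "J - g"] 2[of g] assms by (simp add: miss_def del: power_Suc)
  qed (auto simp: miss_def)
  show "miss J p \<le> 1 / 8"
  proof (cases p)
    case (Low g)
    then show ?thesis using 3[of "1 + J - g"] by (simp add: miss_def)
  next
    case (Mid k)
    then show ?thesis using 1[of k] by (simp add: miss_def)
  qed (auto simp: miss_def)
qed

lemma risk_nonneg: "\<forall>g. p = Low g \<longrightarrow> g \<le> J \<Longrightarrow> 0 \<le> risk J c p"
  using miss_bounds by (auto simp: risk_def)

lemma risk_inv: "inv q \<Longrightarrow> 0 \<le> risk (top q) (cur q) (phase_of q)"
  by (rule risk_nonneg) (auto simp: inv_def)

lemma risk_test_phase: "risk J (Suc c) (test_phase J) \<le> (if c < b then 1 / 8 else 1)"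
  using miss_bounds(2)[of "test_phase J" J] by (auto simp: risk_def test_phase_def)

lemma four_power_le: "J \<le> s \<Longrightarrow> (4::real) ^ J \<le> 4 ^ s"
  by (rule power_increasing) auto

text \<open>In units of \<open>4 ^ s * L\<close>, the phases \<open>Low\<close>, \<open>Mid\<close>
  and \<open>High\<close> cost at most 1, 2 and 4/3.\<close>

lemma remaining_start:
  assumes "J \<le> s" shows "remaining (Stage a m J s c (test_phase J)) \<le> 8 * 4 ^ s * L"
proof -
  have low: "(\<Sum>h\<in>{0..<J}. 4 ^ h * (128 * real (1 + J - h))) \<le> 4 ^ s * L"
  proof -
    have "(\<Sum>h\<in>{0..<J}. 4 ^ h * (128 * real (1 + J - h)))
        = 128 * (\<Sum>h<J. 4 ^ h * real (1 + J - h))"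
      by (simp add: sum_distrib_left atLeast0LessThan mult_ac)
    also have "\<dots> \<le> 128 * 4 ^ s"
      using weighted_geometric_four[of J] four_power_le[OF assms] by linarith
    also have "\<dots> \<le> 4 ^ s * L" by simp
    finally show ?thesis .
  qed
  have "(\<Sum>k\<in>{0..n}. (16::real) ^ k) \<le> 2 * 16 ^ n" for n
  proof (induction n)
    case (Suc n)
    moreover have "(0::real) \<le> 16 ^ n" by simp
    ultimately show ?case by (simp del: zero_le_power)
  qed simp
  then have "(\<Sum>k\<in>{0..k0}. 4 ^ J * (128 * 16 ^ k)) \<le> 4 ^ J * (128 * (2 * (16::real) ^ k0))"
    unfolding sum_distrib_left[symmetric] by (intro mult_left_mono) auto
  also have "\<dots> \<le> 4 ^ s * (128 * (2 * 16 ^ k0))"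
    using four_power_le[OF assms] by (intro mult_right_mono) auto
  finally have mid: "(\<Sum>k\<in>{0..k0}. 4 ^ J * (128 * (16::real) ^ k)) \<le> 2 * (4 ^ s * L)" by simp
  have "(\<Sum>h\<in>{J<..s}. (4::real) ^ h) \<le> (\<Sum>h<Suc s. 4 ^ h)"
    by (rule sum_mono2) auto
  also have "\<dots> \<le> 4 ^ Suc s / 3" by (rule geometric_four)
  finally have "(\<Sum>h\<in>{J<..s}. (4::real) ^ h) * L \<le> (4 ^ Suc s / 3) * L"
    by (rule mult_right_mono) simp
  then have high: "(\<Sum>h\<in>{J<..s}. (4::real) ^ h * L) \<le> 4 / 3 * (4 ^ s * L)"
    by (simp add: sum_distrib_right)
  have pos: "0 \<le> 4 ^ s * L" by simp
  have "remaining (Stage a m J s c (test_phase J))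
      = (\<Sum>h\<in>{0..<J}. 4 ^ h * (128 * real (1 + J - h)))
        + (\<Sum>k\<in>{0..k0}. 4 ^ J * (128 * 16 ^ k)) + (\<Sum>h\<in>{J<..s}. 4 ^ h * L)"
    by (simp add: remaining_def test_phase_def)
  then show ?thesis using low mid high pos by linarith
qed

lemma mid_pot_nonneg: "0 \<le> mid_pot J d k"
  unfolding mid_pot_def mid_sum_def using one_le_power[of "16::real" "Suc k"]
  by (auto simp del: power_Suc intro!: mult_nonneg_nonneg divide_nonneg_nonneg)

lemma mid_pot_0: "mid_pot J d 0 \<le> 384 * 4 ^ J"
  by (simp add: mid_pot_def mid_sum_def)

lemma mid_sum_Suc: "mid_sum J (Suc k) = mid_sum J k + 4 ^ J * (128 * 16 ^ k)"
  by (simp add: mid_sum_def field_simps)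

text \<open>Here the logarithm of the gap ratio enters. If J has reached G, the deciding stage at
  scale G has multiplier 128 * (1 + J - G), and \<open>top_bound\<close> limits J. Otherwise the
  cheap phases cost only O(4^J), since the expensive ones are charged to the increase of J.\<close>

lemma test_pot_start:
  assumes "J \<le> s" "0 \<le> r"
  shows "test_pot (Stage a m J s c (test_phase J)) \<le> round_pot (top_bound a J s r)"
proof (cases "G \<le> J")
  case True
  have "round_pot (real J) \<le> round_pot (top_bound a J s r)" using top_bound_ge_top assms by (intro round_pot_mono) auto
  then have round_pot: "512 * 4 ^ G * (2 + real J - real G) \<le> round_pot (top_bound a J s r)" by (simp add: round_pot_def)
  show ?thesis
  proof (cases "J = 0")
    case True
    have "test_pot (Stage a m J s c (test_phase J)) = 256"
      using \<open>G \<le> J\<close> True unfolding test_pot_def test_phase_def by simp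
    moreover have "(1::real) \<le> 4 ^ G" by simp
    ultimately show ?thesis using round_pot_top_bound_ge[OF assms(2), of a J s] by linarith
  next
    case False
    have "(\<Sum>h\<in>{0..<G}. 4 ^ h * (128 * real (1 + J - h)))
        = 128 * (\<Sum>h<G. 4 ^ h * real (1 + J - h))"
      by (simp add: sum_distrib_left atLeast0LessThan mult_ac)
    also have "\<dots> \<le> 128 * (4 ^ G * real (1 + J - G))"
      using weighted_geometric_four'[OF True] by simp
    finally have "test_pot (Stage a m J s c (test_phase J)) \<le> 384 * (4 ^ G * real (1 + J - G))"
      using False True by (simp add: test_pot_def test_phase_def algebra_simps)
    also have "\<dots> \<le> 512 * (4 ^ G * (2 + real J - real G))"
      using True by (intro mult_mono) auto
    finally show ?thesis using round_pot by simp
  qed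
next
  case False
  then have J4: "(4::real) ^ J \<le> 4 ^ G" by (intro four_power_le) simp
  show ?thesis
  proof (cases "J = 0")
    case True
    then show ?thesis using False round_pot_top_bound_ge[OF assms(2), of a J s] mid_pot_0[of J] J4
      by (simp add: test_pot_def test_phase_def mid_sum_def)
         (smt (verit, ccfv_SIG) power_0 one_le_power)
  next
    case J: False
    have "(\<Sum>h\<in>{0..<J}. 4 ^ h * (128 * real (1 + J - h)))
        = 128 * (\<Sum>h<J. 4 ^ h * real (1 + J - h))"
      by (simp add: sum_distrib_left atLeast0LessThan mult_ac)
    also have "\<dots> \<le> 128 * 4 ^ J" using weighted_geometric_four[of J] by simp
    finally have "test_pot (Stage a m J s c (test_phase J)) \<le> 512 * 4 ^ J"
      using False J by (simp add: test_pot_def test_phase_def)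
    then show ?thesis using round_pot_top_bound_ge[OF assms(2), of a J s] J4 zero_le_power[of "4::real" G]
      by linarith
  qed
qed

text \<open>The risk 1/8 outweighs the fourfold growth of the stages: 20 * 4 / 8 + 9 <= 20, where 9
  stands for one leader stage and one complete test of \<open>i\<close> (at most 8). Before round G
  the difference 12 * (4^(s+1) - 4^s) is exactly 9 * 4^(s+1). One of the \<open>R - s\<close> copies
  of \<open>round_pot\<close> is released for the new round.\<close>

lemma round_end:
  assumes "J \<le> s" "s < R"
  shows "pos_pot a J (Suc s) 0 (1 / 8) + (if near a (Suc s) then 4 ^ Suc s * L else 0)
    \<le> base a J s 1"
proof -
  have 1: "top_bound a J (Suc s) (1 / 8) \<le> top_bound a J s 1"
    using assms by (auto simp: top_bound_def)
  have i0: "0 < i" using i by auto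
  have R: "real (R - s) = real (R - Suc s) + 1" using assms by (simp add: of_nat_diff)
  have "real (R - Suc s) * round_pot (top_bound a J (Suc s) (1 / 8)) + round_pot (top_bound a J (Suc s) (1 / 8))
      \<le> real (R - s) * round_pot (top_bound a J s 1)"
    using round_pot_mono[OF 1] mult_left_mono[OF round_pot_mono[OF 1], of "real (R - s)"]
    by (simp add: R algebra_simps)
  moreover have "far_pot a (Suc s) (1 / 8) + (if near a (Suc s) then 9 * 4 ^ Suc s * L else 0)
      \<le> far_pot a s 1"
  proof -
    consider "s < G" | "s = G" | "G < s" by linarith
    then show ?thesis
    proof cases
      case 1
      then show ?thesis by (simp add: far_pot_def near_def algebra_simps)
    next
      case 2
      then show ?thesis by (simp add: far_pot_def near_def)
    next
      case 3
      then show ?thesis by (simp add: far_pot_def near_def)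
    qed
  qed
  ultimately show ?thesis
    using i0 by (auto simp: pos_pot_def base_def)
qed

lemma pot_next_arm:
  assumes "J \<le> s" "c \<le> K" "c = K \<Longrightarrow> s < R"
  shows "pot (next_arm a m J s c) \<le> arm_pot a J s c"
proof (cases "c < K")
  case True
  define r where "r = risk J (Suc c) (test_phase J)"
  define r' :: real where "r' = (if c < b then 1 / 8 else 1)"
  have r: "0 \<le> r" "r \<le> r'" unfolding r_def r'_def
    using risk_test_phase risk_nonneg[of "test_phase J" J "Suc c"]
    by (auto simp: test_phase_def)
  have arm_pot: "arm_pot a J s c = pos_pot a J s c r'" by (simp add: arm_pot_def r'_def)
  consider "Suc c < i" | "Suc c = i" "near a s" | "Suc c = i" "\<not> near a s" | "i < Suc c"
    by linarith
  then show ?thesis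
  proof cases
    case 1
    then have "pot (next_arm a m J s c) = pos_pot a J s c r"
      using True by (simp add: next_arm_def pot_def Let_def r_def pos_pot_def)
    then show ?thesis using pos_pot_mono[OF r(2)] arm_pot by simp
  next
    case 2
    then have "pot (next_arm a m J s c)
        = base a J s r + (remaining (Stage a m J s (Suc c) (test_phase J)) + round_pot (top_bound a J s r))"
      using True by (simp add: next_arm_def pot_def Let_def r_def)
    also have "\<dots> \<le> pos_pot a J s c r"
      using 2 remaining_start[OF assms(1)] by (simp add: pos_pot_def)
    finally show ?thesis using pos_pot_mono[OF r(2)] arm_pot by (metis order_trans)
  next
    case 3
    then have "pot (next_arm a m J s c)
        = base a J s r + test_pot (Stage a m J s (Suc c) (test_phase J))"
      using True by (simp add: next_arm_def pot_def Let_def r_def)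
    also have "\<dots> \<le> pos_pot a J s c r"
      using 3 test_pot_start[OF assms(1) r(1)] by (simp add: pos_pot_def)
    finally show ?thesis using pos_pot_mono[OF r(2)] arm_pot by (metis order_trans)
  next
    case 4
    then have "pot (next_arm a m J s c) = base a J s r"
      using True by (simp add: next_arm_def pot_def Let_def r_def)
    then show ?thesis using base_mono[OF r(2)] arm_pot 4 by (simp add: pos_pot_def)
  qed
next
  case False
  then have c: "c = K" using assms by simp
  then have "\<not> c < i" "\<not> c < b" using i b by auto
  then have "arm_pot a J s c = base a J s 1" by (simp add: arm_pot_def pos_pot_def)
  moreover have "pot (next_arm a m J s c)
      = pos_pot a J (Suc s) 0 (1 / 8) + (if near a (Suc s) then 4 ^ Suc s * L else 0)"
    using c i b by (auto simp: next_arm_def pot_def Let_def risk_def)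
  ultimately show ?thesis using round_end[OF assms(1), of a] assms(3) c by simp
qed

text \<open>The advances in \<open>test_pot\<close> never exceed \<open>L * 4 ^ G\<close>, and
  \<open>base\<close> holds at least one such unit as long as J < G.\<close>

lemma pot_nonneg:
  assumes q: "inv q" shows "0 \<le> pot q"
proof -
  define a J s c p r where "a = leader q" "J = top q" "s = rnd q" "c = cur q" "p = phase_of q"
    "r = risk (top q) (cur q) (phase_of q)"
  note defs = this
  have r: "0 \<le> r" using risk_inv[OF q] by (simp add: defs)
  consider "c < i" | "i < c" | "c = i" "near a s" | "c = i" "\<not> near a s" by linarith
  then show ?thesis
  proof cases
    case 1
    then show ?thesis using pos_pot_nonneg[OF r] by (simp add: pot_def Let_def defs)
  next
    case 2
    then show ?thesis using base_nonneg[OF r] by (simp add: pot_def Let_def defs)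
  next
    case 3
    have "0 \<le> remaining q"
      by (cases "phase_of q") (auto simp: remaining_def intro!: add_nonneg_nonneg sum_nonneg)
    then show ?thesis using 3 base_nonneg[OF r] round_pot_top_bound_nonneg[OF r] by (simp add: pot_def Let_def defs)
  next
    case 4
    have *: "- (L * 4 ^ G * real (min (G - J) 6)) \<le> test_pot q"
    proof (cases "G \<le> J")
      case True
      then show ?thesis
        by (cases "phase_of q")
           (auto simp: defs test_pot_def Let_def intro!: add_nonneg_nonneg sum_nonneg)
    next
      case False
      have "L * 4 ^ G * 1 \<le> L * 4 ^ G * real (min (G - J) 6)"
        using False by (intro mult_left_mono) auto
      moreover have "- (L * 4 ^ G) \<le> test_pot q"
      proof (cases "phase_of q")
        case Lead
        then show ?thesis using False by (simp add: defs test_pot_def Let_def)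
      next
        case (Low g)
        have "- (L * 4 ^ G) \<le> 0" by simp
        also have "0 \<le> test_pot q" using Low False
          by (auto simp: defs test_pot_def Let_def intro!: add_nonneg_nonneg sum_nonneg)
        finally show ?thesis .
      next
        case (Mid k)
        then have k: "k \<le> k0" using q by (simp add: inv_def)
        have "mid_sum J k \<le> 4 ^ J * 128 * 16 ^ k / 1"
          unfolding mid_sum_def by (intro frac_le mult_left_mono) auto
        also have "\<dots> = (128 * 16 ^ k) * 4 ^ J" by simp
        also have "\<dots> \<le> L * 4 ^ G"
          using k False by (intro mult_mono power_increasing) auto
        finally show ?thesis
          using mid_pot_nonneg[of J "real (mval q) / 2 ^ e - nu i" k] Mid False
          by (simp add: defs test_pot_def Let_def)
      next
        case (High g)
        have "0 \<le> (\<Sum>h\<in>{g..<G}. 4 ^ h * L)" by (intro sum_nonneg) auto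
        then show ?thesis using High False by (simp add: defs test_pot_def Let_def)
      qed
      ultimately show ?thesis by linarith
    qed
    have "pot q = base a J s r + test_pot q"
      using 4 by (simp add: pot_def Let_def defs)
    then show ?thesis using * base_ge[OF r, of J a s] by linarith
  qed
qed

end

section \<open>Drift of the potential\<close>

lemma exp_minus_le_w: "real n \<le> x \<Longrightarrow> exp (- x) \<le> w n" for n :: nat
proof -
  assume x: "real n \<le> x"
  have "(2::real) \<le> exp 1" using exp_ge_add_one_self[of 1] by simp
  then have "(2::real) ^ n \<le> exp 1 ^ n" by (intro power_mono) auto
  also have "\<dots> = exp (real n)" by (simp add: exp_of_nat_mult[symmetric])
  also have "\<dots> \<le> exp x" using x by simp
  finally have "inverse (exp x) \<le> inverse (2 ^ n)" by (intro le_imp_inverse_le) auto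
  then show ?thesis by (simp add: exp_minus power_one_over inverse_eq_divide)
qed

lemma exp_minus_4: "exp (- 4 :: real) \<le> 1 / 32"
proof -
  have "(5 / 4 :: real) \<le> exp (1 / 4)" using exp_ge_add_one_self[of "1/4"] by simp
  then have "(5 / 4 :: real) ^ 16 \<le> exp (1 / 4) ^ 16" by (intro power_mono) auto
  also have "\<dots> = exp 4" by (simp add: exp_of_nat_mult[symmetric])
  finally have "32 \<le> exp (4::real)" by (simp add: power_divide)
  then show ?thesis by (simp add: exp_minus field_simps)
qed

text \<open>The failure probability is doubly exponential in \<open>k\<close> while the credit at
  stake grows only like 16^k; the result is paid by the decrease of \<open>mid_pot\<close> from
  \<open>w k\<close> to \<open>w (Suc k)\<close>.\<close>

lemma exp_4_four_power:
  "exp (- (4 * 4 ^ k)) * ((16::real) ^ Suc k / 15) \<le> w (Suc k)"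
proof -
  have "1 + real k * 3 \<le> (1 + 3) ^ k" by (rule Bernoulli_inequality) simp
  then have "real (4 + 12 * k) \<le> 4 * 4 ^ k" by simp
  then have "exp (- (4 * 4 ^ k)) * ((16::real) ^ Suc k / 15) \<le> w (4 + 12 * k) * (16 ^ Suc k / 15)"
    by (intro mult_right_mono exp_minus_le_w) auto
  also have "\<dots> = w (8 * k) / 15"
  proof -
    have "w (12 * k) * 16 ^ k = w (8 * k)"
      by (simp only: power_mult power_mult_distrib[symmetric]) (simp add: power_divide)
    then show ?thesis by (simp add: power_add power_divide)
  qed
  also have "\<dots> \<le> w k / 15"
    by (intro divide_right_mono w_antimono) auto
  also have "\<dots> \<le> w (Suc k)" by simp
  finally show ?thesis .
qed

context scan_regret
begin

section \<open>Real-valued form of the integer tests, and their error margins\<close>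

definition avg :: "stage \<Rightarrow> nat \<Rightarrow> real" where
  "avg q z = real z / 2 ^ e / real (len q)"

abbreviation ref :: "stage \<Rightarrow> real" where "ref q \<equiv> real (mval q) / 2 ^ e"
abbreviation tol :: "stage \<Rightarrow> real" where "tol q \<equiv> real (thr q) / 2 ^ e"

definition rejects :: "stage \<Rightarrow> nat \<Rightarrow> bool" where
  "rejects q z \<longleftrightarrow> z div len q + thr q < mval q"

definition next_phase :: "stage \<Rightarrow> phase option" where
  "next_phase q = (case phase_of q of
       Lead \<Rightarrow> None
     | Low g \<Rightarrow> Some (if Suc g < top q then Low (Suc g) else Mid 0)
     | Mid k \<Rightarrow> (if k < k0 then Some (Mid (Suc k))
         else if top q < rnd q then Some (High (Suc (top q))) else None)
     | High g \<Rightarrow> (if g < rnd q then Some (High (Suc g)) else None))"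

text \<open>The value 0 takes bad samples out of the drift inequality; their worst-case cost T is
  added back in \<open>V_le_pot\<close>. Rounds beyond \<open>R\<close> are cut off as well, since
  the factor \<open>real (R - s)\<close> in \<open>base\<close> has run out there.\<close>

definition next_pot :: "stage \<Rightarrow> nat \<Rightarrow> real" where
  "next_pot q z = (if good q z \<and> rnd (adv q (z div len q)) \<le> R
     then pot (adv q (z div len q)) else 0)"

lemma adv_rejects:
  "phase_of q \<noteq> Lead \<Longrightarrow> rejects q z \<Longrightarrow> adv q (z div len q)
    = next_arm (leader q) (mval q) (max (top q) (scale q)) (rnd q) (cur q)"
  by (simp add: adv_def rejects_def)

lemma adv_passes:
  "phase_of q \<noteq> Lead \<Longrightarrow> \<not> rejects q z \<Longrightarrow> adv q (z div len q) = (case next_phase q of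
     Some p \<Rightarrow> set_phase q p | None \<Rightarrow> finish q (z div len q))"
  by (cases "phase_of q") (simp_all add: adv_def rejects_def pass_def next_phase_def)

lemma scale_le: "inv q \<Longrightarrow> scale q \<le> rnd q"
  by (cases "phase_of q") (auto simp: inv_def scale_def)

lemma lam_pos: "inv q \<Longrightarrow> 0 < lam q"
  by (cases "phase_of q") (auto simp: inv_def lam_def)

lemma len_pos: "inv q \<Longrightarrow> 0 < len q"
  using lam_pos by (simp add: len_def)

lemma div_power_real: "j \<le> e \<Longrightarrow> real (2 ^ e div 2 ^ j) / 2 ^ e = w j"
  by (simp add: power_diff[symmetric]) (simp add: power_diff power_one_over)

lemma tol_eq:
  assumes "inv q"
  shows "tol q = (case phase_of q of Mid k \<Rightarrow> w (top q) * (1 - w (Suc k)) | _ \<Rightarrow> w (scale q) / 2)"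
proof -
  have s: "scale q + 1 \<le> e" "scale q \<le> R"
    using scale_le[OF assms] assms bits by (auto simp: inv_def)
  show ?thesis
  proof (cases "phase_of q")
    case (Mid k)
    then have k: "top q + k + 1 \<le> e" using assms bits by (auto simp: inv_def)
    have le: "2 ^ e div 2 ^ (top q + k + 1) \<le> (2 ^ e div 2 ^ top q :: nat)"
      by (intro div_le_mono2 power_increasing) auto
    have "tol q = real (2 ^ e div 2 ^ top q) / 2 ^ e - real (2 ^ e div 2 ^ (top q + k + 1)) / 2 ^ e"
      using Mid le by (simp add: thr_def of_nat_diff diff_divide_distrib)
    also have "\<dots> = w (top q) - w (top q + k + 1)"
      using k by (subst (1 2) div_power_real) auto
    finally show ?thesis using Mid by (simp add: power_add algebra_simps)
  qed (use s div_power_real[of "scale q + 1"] in \<open>simp_all add: thr_def\<close>)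
qed

lemma tol_ge: assumes "inv q" shows "w (scale q) / 2 \<le> tol q"
proof (cases "phase_of q")
  case (Mid k)
  have "w (Suc k) \<le> 1 / 2" using w_antimono[of 1 "Suc k"] by simp
  then have "w (top q) * (1 / 2) \<le> w (top q) * (1 - w (Suc k))" by (intro mult_left_mono) auto
  then show ?thesis using Mid tol_eq[OF assms] by (simp add: scale_def)
qed (use tol_eq[OF assms] in auto)

lemma tol_le: assumes "inv q" shows "tol q \<le> w (scale q)"
proof (cases "phase_of q")
  case (Mid k)
  have "w (top q) * (1 - w (Suc k)) \<le> w (top q) * 1" by (intro mult_left_mono) auto
  then show ?thesis using Mid tol_eq[OF assms] by (simp add: scale_def)
qed (use tol_eq[OF assms] zero_le_power[of "1/2::real" "scale q"] in \<open>simp_all del: zero_le_power\<close>)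

text \<open>Rounding the average down is harmless here, because it is compared strictly with an
  integer.\<close>

lemma rejects_iff:
  assumes "inv q" shows "rejects q z \<longleftrightarrow> avg q z < ref q - tol q"
proof -
  have n: "0 < len q" using assms by (rule len_pos)
  have "rejects q z \<longleftrightarrow> z div len q < mval q - thr q" by (auto simp: rejects_def)
  also have "\<dots> \<longleftrightarrow> z < (mval q - thr q) * len q"
    using n by (rule div_less_iff_less_mult)
  also have "\<dots> \<longleftrightarrow> real z < (real (mval q) - real (thr q)) * real (len q)"
  proof (cases "thr q \<le> mval q")
    case True
    then have "(real (mval q) - real (thr q)) * real (len q) = real ((mval q - thr q) * len q)"
      by (simp add: of_nat_diff)
    then show ?thesis by (simp only: of_nat_less_iff)
  next
    case False
    then have "(real (mval q) - real (thr q)) * real (len q) \<le> 0"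
      by (intro mult_nonpos_nonneg) auto
    then show ?thesis using False by (simp add: not_less)
  qed
  also have "\<dots> \<longleftrightarrow> avg q z < ref q - tol q"
    using n by (simp add: avg_def field_simps)
  finally show ?thesis .
qed

lemma div_bounds:
  assumes "inv q"
  shows "real (z div len q) / 2 ^ e \<le> avg q z" "avg q z < real (z div len q) / 2 ^ e + 1 / 2 ^ e"
proof -
  have n: "0 < len q" using assms by (rule len_pos)
  have "real (z div len q) * real (len q) \<le> real z"
    by (metis of_nat_mult of_nat_le_iff div_times_less_eq_dividend)
  then show "real (z div len q) / 2 ^ e \<le> avg q z"
    using n by (simp add: avg_def field_simps)
  have "z < Suc (z div len q) * len q" using n by (simp add: dividend_less_div_times)
  then have "real z < real (Suc (z div len q)) * real (len q)"
    by (metis of_nat_mult of_nat_less_iff)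
  then show "avg q z < real (z div len q) / 2 ^ e + 1 / 2 ^ e"
    using n by (simp add: avg_def field_simps)
qed

lemma good_avg:
  assumes "inv q" "good q z" "lam q = 128 * 16 ^ k0"
  shows "\<bar>avg q z - nu (arm q)\<bar> \<le> w (scale q) / 8"
proof -
  have n: "0 < real (len q)" using len_pos[OF assms(1)] by simp
  have "avg q z - nu (arm q) = (real z / 2 ^ e - real (len q) * nu (arm q)) / real (len q)"
    using n by (simp add: avg_def field_simps)
  then have "\<bar>avg q z - nu (arm q)\<bar> = \<bar>real z / 2 ^ e - real (len q) * nu (arm q)\<bar> / real (len q)"
    using n by (simp add: abs_divide)
  also have "\<dots> \<le> w (scale q) / 8"
    using n assms by (simp add: good_def divide_le_eq mult.commute)
  finally show ?thesis .
qed

lemma len_w: "real (len q) * (y * w (scale q))\<^sup>2 = real (lam q) * y\<^sup>2"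
  using four_w[of "scale q"] by (simp add: len_def power_mult_distrib mult_ac)

lemma upper_tail:
  assumes "inv q" "0 \<le> y" "\<And>z. P z \<Longrightarrow> nu (arm q) + y * w (scale q) \<le> avg q z"
  shows "Esum (arm q) (len q) (\<lambda>z. of_bool (P z)) \<le> exp (- 2 * (real (lam q) * y\<^sup>2))"
proof -
  have n: "0 < real (len q)" using len_pos[OF assms(1)] by simp
  have "Esum (arm q) (len q) (\<lambda>z. of_bool (P z)) \<le> exp (- 2 * real (len q) * (y * w (scale q))\<^sup>2)"
  proof (rule Esum_upper_tail)
    fix z assume "P z"
    from assms(3)[OF this] show "real (len q) * (nu (arm q) + y * w (scale q)) \<le> real z / 2 ^ e"
      using n unfolding avg_def by (subst (asm) pos_le_divide_eq) (auto simp: mult.commute)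
  qed (use assms in auto)
  then show ?thesis by (simp only: mult.assoc len_w)
qed

lemma lower_tail:
  assumes "inv q" "0 \<le> y" "\<And>z. P z \<Longrightarrow> avg q z \<le> nu (arm q) - y * w (scale q)"
  shows "Esum (arm q) (len q) (\<lambda>z. of_bool (P z)) \<le> exp (- 2 * (real (lam q) * y\<^sup>2))"
proof -
  have n: "0 < real (len q)" using len_pos[OF assms(1)] by simp
  have "Esum (arm q) (len q) (\<lambda>z. of_bool (P z)) \<le> exp (- 2 * real (len q) * (y * w (scale q))\<^sup>2)"
  proof (rule Esum_lower_tail)
    fix z assume "P z"
    from assms(3)[OF this] show "real z / 2 ^ e \<le> real (len q) * (nu (arm q) - y * w (scale q))"
      using n unfolding avg_def by (subst (asm) pos_divide_le_eq) (auto simp: mult.commute)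
  qed (use assms in auto)
  then show ?thesis by (simp only: mult.assoc len_w)
qed

lemma not_good_prob:
  assumes "inv q"
  shows "Esum (arm q) (len q) (\<lambda>z. of_bool (\<not> good q z)) \<le> 2 * exp (- 4 * 16 ^ k0)"
proof (cases "lam q = 128 * 16 ^ k0")
  case False
  then show ?thesis by (simp add: good_def Esum_const)
next
  case True
  have n: "0 < real (len q)" using len_pos[OF assms(1)] by simp
  define U where "U z \<longleftrightarrow> nu (arm q) + 1 / 8 * w (scale q) \<le> avg q z" for z
  define V where "V z \<longleftrightarrow> avg q z \<le> nu (arm q) - 1 / 8 * w (scale q)" for z
  have avg: "real z / 2 ^ e = real (len q) * avg q z" for z
    using n by (simp add: avg_def)
  have "Esum (arm q) (len q) (\<lambda>z. of_bool (\<not> good q z))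
      \<le> Esum (arm q) (len q) (\<lambda>z. of_bool (U z) + of_bool (V z))"
  proof (rule Esum_mono)
    fix z
    have "\<bar>real z / 2 ^ e - real (len q) * nu (arm q)\<bar> = real (len q) * \<bar>avg q z - nu (arm q)\<bar>"
      using n by (simp add: avg abs_mult flip: right_diff_distrib)
    moreover have "\<bar>avg q z - nu (arm q)\<bar> \<le> w (scale q) / 8" if "\<not> U z" "\<not> V z"
      using that unfolding U_def V_def abs_le_iff by linarith
    ultimately have "good q z" if "\<not> U z" "\<not> V z"
      using that n unfolding good_def by (metis mult_left_mono less_imp_le)
    then show "of_bool (\<not> good q z) \<le> of_bool (U z) + (of_bool (V z) :: real)" by auto
  qed
  also have "\<dots> \<le> exp (- 2 * (real (lam q) * (1 / 8)\<^sup>2)) + exp (- 2 * (real (lam q) * (1 / 8)\<^sup>2))"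
    unfolding Esum_add
    by (intro add_mono upper_tail lower_tail assms) (auto simp: U_def V_def)
  also have "\<dots> = 2 * exp (- 4 * 16 ^ k0)"
    using True by (simp add: power2_eq_square)
  finally show ?thesis .
qed

lemma next_phase_None:
  assumes "inv q" "phase_of q \<noteq> Lead" "next_phase q = None"
  shows "lam q = 128 * 16 ^ k0" "scale q = rnd q"
  using assms by (auto simp: inv_def next_phase_def lam_def scale_def split: phase.splits if_splits)

lemma inv_ref:
  assumes "inv q" "phase_of q \<noteq> Lead"
  shows "\<bar>ref q - nu (leader q)\<bar> \<le> 5 / 32 * w (rnd q)" "cur q \<in> {1..K}" "leader q \<in> {1..K}"
    "top q \<le> rnd q" "rnd q \<le> R" "arm q = cur q"
  using assms by (auto simp: inv_def arm_def)

lemma inv_next_arm: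
  assumes "a \<in> {1..K}" "J \<le> s" "c \<le> K" "\<bar>real m / 2 ^ e - nu a\<bar> \<le> 5 / 32 * w s" "s \<le> R"
    "rnd (next_arm a m J s c) \<le> R"
  shows "inv (next_arm a m J s c)"
  using assms by (auto simp: inv_def next_arm_def test_phase_def)

text \<open>The last stage has scale \<open>rnd q\<close>, and its tolerance of at least half a unit
  exceeds the errors 1/8 (sample), 5/32 (reference) and 2/128 (rounded means). So leaders never get
  worse.\<close>

lemma finish_better:
  assumes q: "inv q" "phase_of q \<noteq> Lead" "next_phase q = None" "good q z"
    and "mval q + thr q < z div len q"
  shows "mu (leader q) \<le> mu (cur q)"
    "\<bar>real (z div len q) / 2 ^ e - nu (cur q)\<bar> \<le> 5 / 32 * w (rnd q)"
proof -
  note np = next_phase_None[OF q(1-3)] and r = inv_ref[OF q(1,2)]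
  note ga = good_avg[OF q(1,4) np(1), unfolded np(2) r(6)] and db = div_bounds[OF q(1), of z]
  have "real (mval q) + real (thr q) \<le> real (z div len q)" using assms(5) by linarith
  then have "ref q + tol q \<le> real (z div len q) / 2 ^ e"
    unfolding add_divide_distrib[symmetric] by (rule divide_right_mono) simp
  moreover have "w (rnd q) / 2 \<le> tol q" using tol_ge[OF q(1)] np by simp
  moreover have "0 < w (rnd q)" by simp
  ultimately show "mu (leader q) \<le> mu (cur q)"
    using ga db r(1) nu[OF r(2)] nu[OF r(3)] eta_le[OF r(5)] unfolding abs_le_iff by linarith
  show "\<bar>real (z div len q) / 2 ^ e - nu (cur q)\<bar> \<le> 5 / 32 * w (rnd q)"
    using ga db unit_le[OF r(5)] unfolding abs_le_iff by linarith
qed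

lemma reject_high:
  assumes q: "inv q" "phase_of q = High g" "good q z" "rejects q z"
  shows "3 / 8 * w g \<le> ref q - nu (cur q)" "7 / 32 * w g \<le> nu (leader q) - nu (cur q)"
proof -
  have ph: "phase_of q \<noteq> Lead" using q by simp
  have sc: "scale q = g" "lam q = 128 * 16 ^ k0" "g \<le> rnd q"
    using q by (auto simp: scale_def lam_def inv_def)
  note r = inv_ref[OF q(1) ph]
  have "avg q z < ref q - w g / 2"
    using q rejects_iff[OF q(1)] tol_eq[OF q(1)] sc by simp
  then show 1: "3 / 8 * w g \<le> ref q - nu (cur q)"
    using good_avg[OF q(1,3) sc(2), unfolded sc(1) r(6)] unfolding abs_le_iff by linarith
  show "7 / 32 * w g \<le> nu (leader q) - nu (cur q)"
    using 1 r(1) w_antimono[OF sc(3)] unfolding abs_le_iff by linarith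
qed

text \<open>A good rejection in \<open>High g\<close> proves a positive gap, hence one of at least
  \<open>8 * w D\<close>, whereas the invariant of that phase bounds it by about
  \<open>3 * w g\<close>. Thus g < D under an optimal leader.\<close>

lemma reject_top:
  assumes q: "inv q" "phase_of q \<noteq> Lead" "good q z" "rejects q z"
  shows "max (top q) (scale q) \<le> rnd q"
    "mu (leader q) = mu b \<Longrightarrow> max (top q) (scale q) \<le> max (top q) D"
proof -
  note r = inv_ref[OF q(1,2)]
  show "max (top q) (scale q) \<le> rnd q" using scale_le[OF q(1)] r by simp
  assume opt: "mu (leader q) = mu b"
  show "max (top q) (scale q) \<le> max (top q) D"
  proof (cases "phase_of q")
    case (High g)
    have g: "g \<le> rnd q" "nu (leader q) - nu (cur q) \<le> 3 * w g" "scale q = g"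
      using q High by (auto simp: inv_def scale_def)
    have eta: "128 * \<eta> \<le> w g" using eta_le[OF r(5)] w_antimono[OF g(1)] by linarith
    have *: "7 / 32 * w g \<le> nu (leader q) - nu (cur q)"
      using reject_high(2)[OF q(1) High q(3,4)] .
    have "0 < w g" by simp
    then have "mu (cur q) < mu b"
      using * nu[OF r(2)] nu[OF r(3)] eta opt unfolding abs_le_iff by linarith
    from D[OF r(2) this] have "8 * w D \<le> mu (leader q) - mu (cur q)" using opt by simp
    then have "w D < w g"
      using g(2) nu[OF r(2)] nu[OF r(3)] eta \<open>0 < w g\<close> unfolding abs_le_iff by linarith
    then show ?thesis using w_less_imp g(3) by fastforce
  qed (use q in \<open>auto simp: scale_def inv_def\<close>)
qed

lemma next_pot_reject:
  assumes q: "inv q" "phase_of q \<noteq> Lead" "rejects q z"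
  shows "next_pot q z \<le> arm_pot (leader q) (top q) (rnd q) (cur q)"
    "phase_of q = High g \<Longrightarrow> good q z \<Longrightarrow> next_pot q z \<le> arm_pot (leader q) g (rnd q) (cur q)"
proof -
  note r = inv_ref[OF q(1,2)]
  define J' where "J' = max (top q) (scale q)"
  have *: "next_pot q z \<le> arm_pot (leader q) J' (rnd q) (cur q)" if "good q z"
  proof (cases "rnd (adv q (z div len q)) \<le> R")
    case True
    then have "pot (next_arm (leader q) (mval q) J' (rnd q) (cur q)) \<le> arm_pot (leader q) J' (rnd q) (cur q)"
      using reject_top[OF q(1,2) that q(3)] r adv_rejects[OF q(2,3)]
      by (intro pot_next_arm) (auto simp: J'_def next_arm_def)
    then show ?thesis using True that adv_rejects[OF q(2,3)] by (simp add: next_pot_def J'_def)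
  qed (simp add: next_pot_def arm_pot_nonneg)
  show "next_pot q z \<le> arm_pot (leader q) (top q) (rnd q) (cur q)"
  proof (cases "good q z")
    case True
    have "arm_pot (leader q) J' (rnd q) (cur q) \<le> arm_pot (leader q) (top q) (rnd q) (cur q)"
      unfolding arm_pot_def using reject_top[OF q(1,2) True q(3)] r
      by (intro pos_pot_top) (auto simp: J'_def)
    then show ?thesis using *[OF True] by simp
  qed (simp add: next_pot_def arm_pot_nonneg)
  assume "phase_of q = High g" "good q z"
  then show "next_pot q z \<le> arm_pot (leader q) g (rnd q) (cur q)"
    using * q(1) by (simp add: J'_def scale_def inv_def max_absorb2)
qed

lemma next_pot_pass_Some:
  assumes "inv q" "phase_of q \<noteq> Lead" "\<not> rejects q z" "next_phase q = Some p"
  shows "next_pot q z = (if good q z then pot (set_phase q p) else 0)"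
  using assms adv_passes[OF assms(2,3)] inv_ref(5)[OF assms(1,2)] by (simp add: next_pot_def)

lemma next_pot_finish_leader:
  assumes q: "inv q" "phase_of q \<noteq> Lead" "\<not> rejects q z" "next_phase q = None" "good q z"
    and "mval q + thr q < z div len q"
  shows "next_pot q z \<le> arm_pot (cur q) (top q) (rnd q) (cur q)"
proof (cases "rnd (adv q (z div len q)) \<le> R")
  case True
  note r = inv_ref[OF q(1,2)]
  have adv: "adv q (z div len q) = next_arm (cur q) (z div len q) (top q) (rnd q) (cur q)"
    using adv_passes[OF q(2,3)] q(4) assms(6) by (simp add: finish_def)
  have "rnd q < R" if "cur q = K" using True[unfolded adv] that by (simp add: next_arm_def)
  then have "pot (adv q (z div len q)) \<le> arm_pot (cur q) (top q) (rnd q) (cur q)"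
    unfolding adv using r(2,4) by (intro pot_next_arm) auto
  then show ?thesis using True q by (simp add: next_pot_def)
qed (simp add: next_pot_def arm_pot_nonneg)

lemma next_pot_finish_same:
  assumes q: "inv q" "phase_of q \<noteq> Lead" "\<not> rejects q z" "next_phase q = None"
    and "\<not> mval q + thr q < z div len q"
  shows "next_pot q z \<le> arm_pot (leader q) (top q) (rnd q) (cur q)"
proof (cases "rnd (adv q (z div len q)) \<le> R")
  case True
  note r = inv_ref[OF q(1,2)]
  have adv: "adv q (z div len q) = next_arm (leader q) (mval q) (top q) (rnd q) (cur q)"
    using adv_passes[OF q(2,3)] q(4) assms(5) by (simp add: finish_def)
  have "rnd q < R" if "cur q = K" using True[unfolded adv] that by (simp add: next_arm_def)
  then have "pot (adv q (z div len q)) \<le> arm_pot (leader q) (top q) (rnd q) (cur q)"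
    unfolding adv using r(2,4) by (intro pot_next_arm) auto
  then show ?thesis using True arm_pot_nonneg by (simp add: next_pot_def)
qed (simp add: next_pot_def arm_pot_nonneg)

lemma next_pot_finish:
  assumes q: "inv q" "phase_of q \<noteq> Lead" "\<not> rejects q z" "next_phase q = None"
  shows "next_pot q z \<le> arm_pot (leader q) (top q) (rnd q) (cur q)"
proof (cases "mval q + thr q < z div len q \<and> good q z")
  case True
  then have "next_pot q z \<le> arm_pot (cur q) (top q) (rnd q) (cur q)"
    by (intro next_pot_finish_leader q) auto
  also have "\<dots> \<le> arm_pot (leader q) (top q) (rnd q) (cur q)"
    unfolding arm_pot_def using finish_better(1)[OF q(1,2,4)] True inv_ref[OF q(1,2)]
    by (intro pos_pot_leader) auto
  finally show ?thesis .
next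
  case False
  then show ?thesis using next_pot_finish_same[OF q] by (cases "good q z") (auto simp: next_pot_def arm_pot_nonneg)
qed

lemma inv_adv:
  assumes q: "inv q" and g: "good q z" and R: "rnd (adv q (z div len q)) \<le> R"
  shows "inv (adv q (z div len q))"
proof (cases "phase_of q = Lead")
  case True
  have *: "lam q = 128 * 16 ^ k0" "scale q = rnd q" "arm q = leader q"
    using True by (simp_all add: lam_def scale_def arm_def)
  have inv: "leader q \<in> {1..K}" "top q \<le> rnd q" "rnd q \<le> R" using q by (auto simp: inv_def)
  have "\<bar>real (z div len q) / 2 ^ e - nu (leader q)\<bar> \<le> 5 / 32 * w (rnd q)"
    using good_avg[OF q g *(1), unfolded *(2,3)] div_bounds[OF q, of z] unit_le[OF inv(3)]
    unfolding abs_le_iff by linarith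
  then show ?thesis using True R inv by (auto simp: adv_def intro!: inv_next_arm)
next
  case ph: False
  note r = inv_ref[OF q ph]
  show ?thesis
  proof (cases "rejects q z")
    case True
    show ?thesis
      using adv_rejects[OF ph True] R r reject_top(1)[OF q ph g True]
      by (auto intro!: inv_next_arm)
  next
    case rej: False
    show ?thesis
    proof (cases "next_phase q")
      case None
      show ?thesis
      proof (cases "mval q + thr q < z div len q")
        case True
        then show ?thesis
          using adv_passes[OF ph rej] None r R finish_better(2)[OF q ph None g True]
          by (auto simp: finish_def intro!: inv_next_arm)
      next
        case False
        then show ?thesis
          using adv_passes[OF ph rej] None r R by (auto simp: finish_def intro!: inv_next_arm)
      qed
    next
      case (Some p)
      have high: "nu (leader q) - nu (cur q) \<le> 3 / 2 * w (scale q)" if "lam q = 128 * 16 ^ k0"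
      proof -
        have "ref q - tol q \<le> avg q z" using rej rejects_iff[OF q, of z] by simp
        then show ?thesis
          using good_avg[OF q g that] tol_le[OF q] r(1,6) w_antimono[OF scale_le[OF q]]
            zero_le_power[of "1/2::real" "scale q"]
          unfolding abs_le_iff r(6) by linarith
      qed
      have "inv (set_phase q p)"
      proof (cases "phase_of q")
        case (Mid k)
        then have "k \<le> k0" using q by (simp add: inv_def)
        then have "lam q = 128 * 16 ^ k0" if "\<not> k < k0"
          using that Mid by (simp add: lam_def)
        then show ?thesis
          using Some Mid q high by (auto simp: inv_def next_phase_def scale_def split: if_splits)
      next
        case (High g)
        then have "lam q = 128 * 16 ^ k0" by (simp add: lam_def)
        then show ?thesis
          using Some High q high by (auto simp: inv_def next_phase_def scale_def split: if_splits)
      qed (use Some q ph in \<open>auto simp: inv_def next_phase_def split: if_splits\<close>)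
      then show ?thesis using adv_passes[OF ph rej] Some by simp
    qed
  qed
qed

section \<open>Expected decrease of the potential, by the arm pulled\<close>

lemma Esum_le_const: "(\<And>z. f z \<le> r) \<Longrightarrow> Esum a n f \<le> r"
  using Esum_mono[of f "\<lambda>_. r" a n] by (simp add: Esum_const)

lemma gap_pos: "mu i < mu b"
  using G(1) zero_less_power[of "1/2::real" G] by linarith

text \<open>A leader stage pulls \<open>i\<close> only if \<open>i\<close> itself leads; such a
  leader is far because its gap is positive, so \<open>pot\<close> contains the length of the
  stage.\<close>

lemma drift_lead:
  assumes q: "inv q" "phase_of q = Lead"
  shows "real (len q) * of_bool (arm q = i) + Esum (arm q) (len q) (next_pot q) \<le> pot q"
proof -
  define a J s where "a = leader q" "J = top q" "s = rnd q"
  note defs = this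
  have c: "cur q = 0" "J \<le> s" "0 < i" "0 < b" using q i b by (auto simp: inv_def defs)
  have PG: "next_pot q z \<le> arm_pot a J s 0" for z
  proof (cases "good q z \<and> rnd (adv q (z div len q)) \<le> R")
    case True
    have "K \<noteq> 0" using b by auto
    then have "pot (adv q (z div len q)) \<le> arm_pot a J s 0"
      unfolding adv_def using q(2) c(2) by (auto simp: defs intro!: pot_next_arm)
    then show ?thesis using True by (simp add: next_pot_def)
  next
    case False
    then show ?thesis by (auto simp: next_pot_def arm_pot_nonneg)
  qed
  have "real (len q) = 4 ^ s * L" using q by (simp add: len_def lam_def scale_def defs)
  moreover have "near a s" if "arm q = i"
    using that q gap_pos by (auto simp: arm_def defs near_def far_leader_def)
  moreover have "pot q = arm_pot a J s 0 + (if near a s then 4 ^ s * L else 0)"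
    using c q by (simp add: pot_def Let_def defs arm_pot_def risk_def)
  moreover have "0 \<le> 4 ^ s * L" by simp
  ultimately have "real (len q) * of_bool (arm q = i) \<le> pot q - arm_pot a J s 0"
    by (cases "arm q = i") auto
  then show ?thesis using Esum_le_const[of "next_pot q", OF PG, of "arm q" "len q"] by linarith
qed

lemma pot_eq_pos_pot:
  assumes "cur q \<noteq> 0" "cur q \<noteq> i"
  shows "pot q = pos_pot (leader q) (top q) (rnd q) (cur q) (risk (top q) (cur q) (phase_of q))"
  using assms by (auto simp: pot_def Let_def pos_pot_def)

lemma drift_other:
  assumes q: "inv q" "phase_of q \<noteq> Lead" "cur q \<noteq> i" "cur q \<noteq> b"
  shows "real (len q) * of_bool (arm q = i) + Esum (arm q) (len q) (next_pot q) \<le> pot q"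
proof -
  have c: "cur q \<noteq> 0" "arm q \<noteq> i" using inv_ref[OF q(1,2)] q by auto
  have P: "pot (set_phase q p) = arm_pot (leader q) (top q) (rnd q) (cur q)" for p
    using c q by (subst pot_eq_pos_pot) (auto simp: arm_pot_def risk_def)
  have P': "pot q = arm_pot (leader q) (top q) (rnd q) (cur q)"
    using c q by (subst pot_eq_pos_pot) (auto simp: arm_pot_def risk_def)
  have "next_pot q z \<le> pot q" for z
  proof (cases "rejects q z")
    case True
    then show ?thesis using next_pot_reject(1)[OF q(1,2)] P' by simp
  next
    case False
    then show ?thesis
      using next_pot_finish[OF q(1,2) False] next_pot_pass_Some[OF q(1,2) False] P P' arm_pot_nonneg
      by (cases "next_phase q") auto
  qed
  then show ?thesis using c Esum_le_const[of "next_pot q" "pot q"] by simp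
qed

text \<open>Rejecting \<open>b\<close> requires a deviation by 1/4 of a unit, which explains the
  exponential. \<open>miss\<close> is a closed form that dominates the sum of these probabilities
  over the remaining \<open>Low\<close> and \<open>Mid\<close> phases; \<open>High\<close>
  contributes nothing, as \<open>good\<close> excludes such rejections.\<close>

lemma miss_step:
  assumes q: "inv q" "phase_of q \<noteq> Lead" "\<forall>g. phase_of q \<noteq> High g"
  shows "exp (- (real (lam q) / 8))
      + (case next_phase q of Some p \<Rightarrow> miss (top q) p | None \<Rightarrow> 0) \<le> miss (top q) (phase_of q)"
proof -
  have e: "exp (- (16 * real n)) \<le> (1 / 32) ^ n" for n
  proof -
    have "exp (- (16 * real n)) \<le> w (5 * n)" by (rule exp_minus_le_w) simp
    then show ?thesis by (simp add: power_mult power_one_over)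
  qed
  show ?thesis
  proof (cases "phase_of q")
    case (Low g)
    then have g: "g < top q" using q by (simp add: inv_def)
    define n where "n = top q - Suc g"
    have n: "1 + top q - g = Suc (Suc n)" "1 + top q - Suc g = Suc n" using g by (auto simp: n_def)
    define x where "x = (1 / 32::real) ^ n"
    have "exp (- (real (lam q) / 8)) \<le> (1 / 32) ^ Suc (Suc n)"
      using e[of "Suc (Suc n)"] Low n by (simp add: lam_def add_divide_distrib)
    moreover have "0 \<le> x" by (simp add: x_def)
    moreover have "n = 0" if "\<not> Suc g < top q" using that by (simp add: n_def)
    ultimately show ?thesis
      using Low n by (cases "Suc g < top q") (auto simp: next_phase_def miss_def x_def[symmetric])
  next
    case (Mid k)
    have "exp (- (real (lam q) / 8)) \<le> (1 / 32) ^ (16 ^ k)"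
      using e[of "16 ^ k"] Mid by (simp add: lam_def)
    also have "\<dots> \<le> (1 / 32) ^ Suc k"
    proof (rule power_decreasing)
      have "k < 2 ^ k" by (rule less_exp)
      also have "\<dots> \<le> (16::nat) ^ k" by (intro power_mono) auto
      finally show "Suc k \<le> 16 ^ k" by simp
    qed auto
    finally have *: "exp (- (real (lam q) / 8)) \<le> (1 / 32) ^ Suc k" .
    define x where "x = (1 / 32::real) ^ k"
    have "0 \<le> x" by (simp add: x_def)
    then show ?thesis using Mid * by (auto simp: next_phase_def miss_def x_def[symmetric])
  qed (use q in auto)
qed

text \<open>If \<open>b\<close> survives all stages and is still not clearly better, the leader is
  within \<open>2 * w s\<close> of it. After round D such a leader is optimal, after round G it is
  not far, so the potential no longer depends on the risk.\<close>

lemma finish_same: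
  assumes q: "inv q" "phase_of q \<noteq> Lead" "next_phase q = None" "good q z" "cur q = b"
    and "\<not> mval q + thr q < z div len q"
  shows "pos_pot (leader q) (top q) (rnd q) c 1 = pos_pot (leader q) (top q) (rnd q) c 0"
proof -
  define a s where "a = leader q" "s = rnd q"
  note defs = this
  note np = next_phase_None[OF q(1-3)] and r = inv_ref[OF q(1,2)]
  note ga = good_avg[OF q(1,4) np(1), unfolded np(2) r(6)] and db = div_bounds[OF q(1), of z]
  have "real (z div len q) \<le> real (mval q) + real (thr q)" using assms(6) by linarith
  then have "real (z div len q) / 2 ^ e \<le> ref q + tol q"
    unfolding add_divide_distrib[symmetric] by (rule divide_right_mono) simp
  moreover have "tol q \<le> w s" using tol_le[OF q(1)] np by (simp add: defs)
  moreover have ws: "0 < w s" by simp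
  ultimately have *: "mu b - mu a < 2 * w s"
    using ga db r(1) nu[OF r(2)] nu[OF r(3)] eta_le[OF r(5)] unit_le[OF r(5)]
    unfolding abs_le_iff defs q(5) by linarith
  have "\<not> mu a < mu b" if "D < s"
    using D[of a] r(3) w_half[OF that] * ws by (auto simp: defs)
  moreover have "\<not> far_leader a" if "G < s"
  proof -
    have "2 * x \<le> y" if "x < 2 * u" "2 * u \<le> v" "0 < u" "8 * v \<le> y" for x u v y :: real
      using that by linarith
    from this[OF * w_half[OF that] ws G(1)] show ?thesis by (simp add: far_leader_def not_less)
  qed
  ultimately show ?thesis
    by (auto simp: pos_pot_def base_def top_bound_def far_pot_def defs not_le)
qed

text \<open>During this test the potential is X + risk * Y. A rejection sets the risk to 1 and a
  pass lowers it to \<open>m'\<close>, so everything reduces to \<open>miss_step\<close>.\<close>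

lemma drift_best:
  assumes q: "inv q" "phase_of q \<noteq> Lead" "cur q = b"
  shows "real (len q) * of_bool (arm q = i) + Esum (arm q) (len q) (next_pot q) \<le> pot q"
proof -
  note r = inv_ref[OF q(1,2)]
  define a J s where "a = leader q" "J = top q" "s = rnd q"
  note defs = this
  define X where "X = pos_pot a J s b 0"
  define Y where "Y = pos_pot a J s b 1 - X"
  have bi: "b \<noteq> i" using gap_pos by auto
  have c: "cur q \<noteq> 0" "arm q \<noteq> i" using r q bi by auto
  have c3: "arm q = b" using r q by simp
  have X: "0 \<le> X" by (simp add: X_def pos_pot_nonneg)
  have Y: "0 \<le> Y" using pos_pot_mono[of 0 1] by (simp add: X_def Y_def)
  have aff: "pos_pot a J s b t = X + t * Y" for t
    unfolding X_def Y_def by (rule pos_pot_affine)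
  have P: "pot (set_phase q p) = X + miss J p * Y" for p
    using pot_eq_pos_pot[of "set_phase q p"] c q(3) bi by (simp add: aff[unfolded defs] risk_def defs)
  have P': "pot q = X + miss J (phase_of q) * Y"
    using pot_eq_pos_pot[of q] c q(3) bi by (simp add: aff[unfolded defs] risk_def defs)
  have Qa: "arm_pot a J s b = X + Y" by (simp add: arm_pot_def aff)
  define m' where "m' = (case next_phase q of Some p \<Rightarrow> miss J p | None \<Rightarrow> 0)"
  have m': "0 \<le> m'" "m' \<le> 1"
  proof -
    have "\<forall>g. p = Low g \<longrightarrow> g \<le> J" if "next_phase q = Some p" for p
      using that q by (cases "phase_of q") (auto simp: next_phase_def defs split: if_splits)
    then have "0 \<le> miss J p \<and> miss J p \<le> 1 / 8" if "next_phase q = Some p" for p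
      using miss_bounds[of p J] that by auto
    then show "0 \<le> m'" "m' \<le> 1"
      unfolding m'_def by (cases "next_phase q"; fastforce)+
  qed
  have pass: "next_pot q z \<le> X + m' * Y" if rej: "\<not> rejects q z" for z
  proof (cases "good q z")
    case False
    then show ?thesis using X Y m' by (simp add: next_pot_def)
  next
    case good: True
    show ?thesis
    proof (cases "next_phase q")
      case (Some p)
      then show ?thesis using next_pot_pass_Some[OF q(1,2) rej Some] good P by (simp add: m'_def)
    next
      case None
      show ?thesis
      proof (cases "mval q + thr q < z div len q")
        case True
        have "next_pot q z \<le> arm_pot b J s b"
          using next_pot_finish_leader[OF q(1,2) rej None good True] q(3) by (simp add: defs)
        also have "\<dots> \<le> X"
          using pos_pot_best[of J s b a] r by (simp add: arm_pot_def X_def defs)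
        finally show ?thesis using None by (simp add: m'_def)
      next
        case False
        then have "next_pot q z \<le> pos_pot a J s b 1"
          using next_pot_finish_same[OF q(1,2) rej None False] q(3) by (simp add: arm_pot_def defs)
        then show ?thesis
          using finish_same[OF q(1,2) None good q(3) False, of b] None by (simp add: m'_def X_def defs)
      qed
    qed
  qed
  \<comment> \<open>The tolerance 1/2, less 5/32 for the reference and 2/128 for the two rounded
    means, still exceeds 1/4.\<close>
  have low: "avg q z \<le> nu (arm q) - 1 / 4 * w (scale q)" if "rejects q z" for z
  proof -
    have "avg q z < ref q - tol q" using that rejects_iff[OF q(1)] by simp
    then show ?thesis
      using r(1) tol_ge[OF q(1)] w_antimono[OF scale_le[OF q(1)]] eta_le[OF r(5)]
        best[OF r(3)] nu[OF r(2)] nu[OF r(3)] zero_le_power[of "1/2::real" "scale q"]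
      unfolding abs_le_iff q(3) c3 by linarith
  qed
  have "Esum (arm q) (len q) (next_pot q) \<le> X + miss J (phase_of q) * Y"
  proof (cases "\<exists>g. phase_of q = High g")
    case True
    then obtain g where g: "phase_of q = High g" by blast
    have lam: "lam q = 128 * 16 ^ k0" using g by (simp add: lam_def)
    have "next_pot q z \<le> X" for z
    proof (cases "rejects q z")
      case True
      \<comment> \<open>The deviation 1/4 is twice what \<open>good\<close> allows for a
        full-multiplier stage.\<close>
      have "\<not> good q z"
      proof
        assume "good q z"
        from good_avg[OF q(1) this lam] low[OF True] have "w (scale q) \<le> 0"
          unfolding abs_le_iff by linarith
        moreover have "0 < w (scale q)" by simp
        ultimately show False by linarith
      qed
      then show ?thesis using X by (simp add: next_pot_def)
    next
      case False
      have "m' = 0" using g by (auto simp: m'_def next_phase_def miss_def)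
      then show ?thesis using pass[OF False] by simp
    qed
    then show ?thesis using g by (simp add: Esum_le_const miss_def)
  next
    case False
    define p where "p = exp (- (real (lam q) / 8))"
    have "Esum (arm q) (len q) (next_pot q) \<le> p * (X + Y) + (1 - p) * (X + m' * Y)"
    proof (rule Esum_two_point)
      show "Esum (arm q) (len q) (\<lambda>z. of_bool (rejects q z)) \<le> p"
        using lower_tail[OF q(1) _ low, of "rejects q"] by (simp add: p_def power2_eq_square)
      show "X + m' * Y \<le> X + Y" using m' Y mult_right_mono[of m' 1 Y] by simp
      show "next_pot q z \<le> X + Y" if "rejects q z" for z
        using next_pot_reject(1)[OF q(1,2) that] Qa q(3) by (simp add: defs)
    qed (rule pass)
    also have "\<dots> \<le> X + (p + m') * Y"
    proof -
      have "0 \<le> p * (m' * Y)" using m' Y by (simp add: p_def)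
      then show ?thesis by (simp add: algebra_simps)
    qed
    also have "\<dots> \<le> X + miss J (phase_of q) * Y"
    proof -
      have "p + m' \<le> miss J (phase_of q)"
        using miss_step[OF q(1,2)] False unfolding p_def m'_def defs by simp
      then show ?thesis using Y by (intro add_left_mono mult_right_mono)
    qed
    finally show ?thesis .
  qed
  then show ?thesis using P' c by simp
qed

lemma remaining_step:
  assumes q: "inv q" "phase_of q \<noteq> Lead"
  shows "next_phase q = Some p \<Longrightarrow> remaining q = real (len q) + remaining (set_phase q p)"
    "next_phase q = None \<Longrightarrow> real (len q) \<le> remaining q"
    "real (len q) \<le> remaining q"
proof -
  have split: "(\<Sum>h\<in>{m..<n}. f h) = f m + (\<Sum>h\<in>{Suc m..<n}. f h)" if "m < n" for m n and f :: "nat \<Rightarrow> real"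
    using that by (rule sum.atLeast_Suc_lessThan)
  have split': "(\<Sum>h\<in>{m..n}. f h) = f m + (\<Sum>h\<in>{Suc m..n}. f h)" if "m \<le> n" for m n and f :: "nat \<Rightarrow> real"
    using that by (rule sum.atLeast_Suc_atMost)
  have *: "{m<..n} = {Suc m..n}" for m n :: nat by auto
  show 1: "remaining q = real (len q) + remaining (set_phase q p)" if "next_phase q = Some p" for p
  proof (cases "phase_of q")
    case (Low g)
    then have "g < top q" using q by (simp add: inv_def)
    then show ?thesis using Low that
      by (auto simp: remaining_def next_phase_def len_def lam_def scale_def split[of g])
  next
    case (Mid k)
    then have "k \<le> k0" using q by (simp add: inv_def)
    then show ?thesis using Mid that
      by (auto simp: remaining_def next_phase_def len_def lam_def scale_def split'[of k] *
          split: if_splits)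
  next
    case (High g)
    then have "g \<le> rnd q" using q by (simp add: inv_def)
    then show ?thesis using High that
      by (auto simp: remaining_def next_phase_def len_def lam_def scale_def split'[of g]
          split: if_splits)
  qed (use q in simp)
  show 2: "real (len q) \<le> remaining q" if "next_phase q = None"
  proof (cases "phase_of q")
    case (Mid k)
    then have "k \<le> k0" using q by (simp add: inv_def)
    then show ?thesis using Mid
      by (auto simp: remaining_def len_def lam_def scale_def split'[of k]
          intro!: add_nonneg_nonneg sum_nonneg)
  next
    case (High g)
    then have "g \<le> rnd q" using q by (simp add: inv_def)
    then show ?thesis using High
      by (auto simp: remaining_def len_def lam_def scale_def split'[of g] intro!: sum_nonneg)
  qed (use q that in \<open>auto simp: next_phase_def\<close>)
  have "0 \<le> remaining (set_phase q p)" for p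
    by (cases p) (auto simp: remaining_def intro!: add_nonneg_nonneg sum_nonneg)
  then show "real (len q) \<le> remaining q"
    using 1 2 by (cases "next_phase q") (simp_all add: add_increasing2)
qed

text \<open>No probability is involved: \<open>remaining\<close> prepays every stage of the test,
  whatever its outcome.\<close>

lemma drift_near:
  assumes q: "inv q" "phase_of q \<noteq> Lead" "cur q = i" "near (leader q) (rnd q)"
  shows "real (len q) * of_bool (arm q = i) + Esum (arm q) (len q) (next_pot q) \<le> pot q"
proof -
  note r = inv_ref[OF q(1,2)]
  define a J s where "a = leader q" "J = top q" "s = rnd q"
  note defs = this
  have bi: "b \<noteq> i" using gap_pos by auto
  define t :: real where "t = (if i < b then 1 / 8 else 1)"
  have t: "0 \<le> t" by (simp add: t_def)
  have P: "pot (set_phase q p) = base a J s t + (remaining (set_phase q p) + round_pot (top_bound a J s t))" for p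
    using q bi by (auto simp: pot_def Let_def defs risk_def t_def)
  have P': "pot q = base a J s t + (remaining q + round_pot (top_bound a J s t))"
    using q bi by (auto simp: pot_def Let_def defs risk_def t_def)
  have Qa: "arm_pot a J s i = base a J s t" by (simp add: arm_pot_def pos_pot_def t_def)
  have round_pot: "0 \<le> round_pot (top_bound a J s t)" using t by (rule round_pot_top_bound_nonneg)
  have B: "0 \<le> base a J s t" using t by (rule base_nonneg)
  note rem = remaining_step[OF q(1,2)]
  have "next_pot q z \<le> pot q - real (len q)" for z
  proof (cases "rejects q z")
    case True
    then show ?thesis
      using next_pot_reject(1)[OF q(1,2) True] Qa P' round_pot rem(3) q(3) by (simp add: defs)
  next
    case False
    show ?thesis
    proof (cases "next_phase q")
      case None
      then show ?thesis
        using next_pot_finish[OF q(1,2) False None] Qa P' round_pot rem(3) q(3) by (simp add: defs)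
    next
      case (Some p)
      show ?thesis
        using next_pot_pass_Some[OF q(1,2) False Some] P P' rem(1)[OF Some] rem(3) round_pot B by auto
    qed
  qed
  from Esum_le_const[of "next_pot q", OF this, of "arm q" "len q"] show ?thesis using r q by simp
qed

text \<open>After round G a leader that is not far recovers at least half of the gap of
  \<open>i\<close>, that is \<open>4 * w G\<close>. The shift of the scales by three bits,
  \<open>8 * w G\<close> for the whole gap, is what makes this exceed the tolerances at scale G and
  the bound \<open>3 * w g\<close> of \<open>High g\<close> for g >= G.\<close>

lemma far_gap:
  assumes q: "inv q" "phase_of q \<noteq> Lead" "cur q = i" "\<not> near (leader q) (rnd q)"
  shows "3 * w G \<le> ref q - nu i" "ref q - nu i \<le> 17 * w G" "4 * w G - 2 * \<eta> \<le> nu (leader q) - nu i"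
    "128 * \<eta> \<le> w G"
proof -
  note r = inv_ref[OF q(1,2)]
  have s: "G < rnd q" "mu b - mu i \<ge> 2 * (mu b - mu (leader q))"
    using q(4) by (auto simp: near_def far_leader_def)
  show "128 * \<eta> \<le> w G"
    using eta_le[OF r(5)] w_antimono[of G "rnd q"] s by linarith
  have "4 * w G \<le> mu (leader q) - mu i"
    using s(2) G(1) by argo
  then show 1: "4 * w G - 2 * \<eta> \<le> nu (leader q) - nu i"
    using nu[OF r(3)] nu[OF i] unfolding abs_le_iff by linarith
  show "3 * w G \<le> ref q - nu i"
    using 1 r(1) w_half[OF s(1)] eta_le[OF r(5)] zero_le_power[of "1/2::real" "rnd q"]
    unfolding abs_le_iff by linarith
  show "ref q - nu i \<le> 17 * w G"
    using best[OF r(3)] G(2) nu[OF r(3)] nu[OF i] r(1) w_half[OF s(1)] eta_le[OF r(5)]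
      zero_le_power[of "1/2::real" "rnd q"]
    unfolding abs_le_iff by linarith
qed

lemma sum_from:
  fixes f :: "nat \<Rightarrow> real"
  shows "m < n \<Longrightarrow> (\<Sum>h\<in>{m..<n}. f h) = f m + (\<Sum>h\<in>{Suc m..<n}. f h)"
  by (rule sum.atLeast_Suc_lessThan)

lemma len_real:
  "phase_of q = Low g \<Longrightarrow> real (len q) = 4 ^ g * (128 * real (1 + top q - g))"
  "phase_of q = Mid k \<Longrightarrow> real (len q) = 4 ^ top q * (128 * 16 ^ k)"
  "phase_of q = High g \<Longrightarrow> real (len q) = 4 ^ g * L"
  by (simp_all add: len_def lam_def scale_def)

lemma mid_sum_pos: "0 \<le> mid_sum J k"
  by (simp add: mid_sum_def)

lemma test_pot_nonneg: "G \<le> top q \<Longrightarrow> 0 \<le> test_pot q"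
  by (cases "phase_of q")
     (auto simp: test_pot_def Let_def intro!: add_nonneg_nonneg sum_nonneg)

text \<open>Around the tolerance of phase \<open>k\<close> lies a window of half-width w(k+1)/4, in
  units of 2^-J. Below it a rejection is unlikely, above it a pass is unlikely, and inside it
  nothing is known, but this happens in one phase at most.\<close>

lemma mid_pot_rejecting:
  assumes q: "inv q" "phase_of q = Mid k" "cur q = i" "leader q = a"
    and f: "\<And>z. rejects q z \<Longrightarrow> f z \<le> c"
      "\<And>z. \<not> rejects q z \<Longrightarrow> f z \<le> c + (mid_pot (top q) (ref q - nu i) (Suc k) - mid_sum (top q) (Suc k))"
  shows "real (len q) + Esum (arm q) (len q) f
    \<le> c + (mid_pot (top q) (ref q - nu i) k - mid_sum (top q) k)"
proof -
  have ph: "phase_of q \<noteq> Lead" using q by simp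
  note r = inv_ref[OF q(1) ph]
  define J d where "J = top q" and "d = ref q - nu i"
  define S where "S = mid_sum J (Suc k)"
  define p where "p = mid_pot J d k"
  define p' where "p' = mid_pot J d (Suc k)"
  have S: "S = mid_sum J k + real (len q)" "0 \<le> S"
    using len_real(2)[OF q(2)] mid_sum_pos by (auto simp: S_def mid_sum_Suc J_def)
  have p': "0 \<le> p'" by (simp add: p'_def mid_pot_nonneg)
  have wJ: "0 < w J" by simp
  have sc: "scale q = J" "lam q = 128 * 16 ^ k" "arm q = i"
    using q r by (auto simp: scale_def lam_def J_def)
  have tol: "tol q = w J * (1 - w (Suc k))" using tol_eq[OF q(1)] q by (simp add: J_def)
  have f1: "f z \<le> c" if "rejects q z" for z using f(1) that .
  have f2: "f z \<le> c + (p' - S)" if "\<not> rejects q z" for z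
    using f(2)[OF that] by (simp add: p'_def S_def J_def d_def)
  define t :: real where "t = exp (- (4 * 4 ^ k))"
  have t: "0 \<le> t" "t \<le> 1 / 32"
  proof -
    have "(1::real) \<le> 4 ^ k" by simp
    then have "exp (- (4 * 4 ^ k)) \<le> exp (- 4 :: real)" by (subst exp_le_cancel_iff) linarith
    then show "t \<le> 1 / 32" unfolding t_def using exp_minus_4 by linarith
  qed (simp add: t_def)
  have tail: "exp (- 2 * (real (lam q) * (w (Suc k) / 4)\<^sup>2)) = t"
  proof -
    have "16 ^ k * (w (Suc k))\<^sup>2 = (4::real) ^ k / 4"
      by (simp add: power2_eq_square power_mult_distrib[symmetric] field_simps)
    then show ?thesis by (simp add: sc t_def power_divide algebra_simps)
  qed
  have expand: "w J * (1 - 5 / 4 * w (Suc k)) = tol q - w (Suc k) / 4 * w J"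
    by (simp add: tol algebra_simps)
  have nui: "nu i = ref q - d" by (simp add: d_def)
  consider "d \<le> w J * (1 - 5 / 4 * w (Suc k))"
    | "w J * (1 - 3 / 4 * w (Suc k)) \<le> d"
    | "w J * (1 - 5 / 4 * w (Suc k)) < d" "d < w J * (1 - 3 / 4 * w (Suc k))"
    by linarith
  then have "Esum (arm q) (len q) f \<le> c + p - S"
  proof cases
    case 1
    have "w (Suc k) / 4 * w J \<ge> 0" by simp
    have ws: "w J * (1 - 5 / 4 * w (Suc k)) \<le> w J * (1 - 5 / 4 * w (Suc (Suc k)))"
      by (intro mult_left_mono) auto
    have pp: "p = 4 ^ J * 128 * w k" "p' = 4 ^ J * 128 * w (Suc k)"
      using 1 order_trans[OF 1 ws] by (simp_all add: p_def p'_def mid_pot_def del: power_Suc)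
    have "Esum (arm q) (len q) (\<lambda>z. of_bool (rejects q z)) \<le> t"
      unfolding tail[symmetric]
    proof (rule lower_tail[OF q(1)])
      fix z assume "rejects q z"
      then have "avg q z < ref q - tol q" using rejects_iff[OF q(1)] by simp
      then show "avg q z \<le> nu (arm q) - w (Suc k) / 4 * w (scale q)"
        using 1 unfolding expand nui sc by linarith
    qed simp
    then have "Esum (arm q) (len q) f \<le> t * (c + p') + (1 - t) * (c + (p' - S))"
      using f1 f2 S(2) p' by (intro Esum_two_point) (force, simp, fastforce, blast)
    also have "\<dots> = c + p' - S + t * S" by (simp add: algebra_simps)
    \<comment> \<open>A rejection below the window forfeits the credit \<open>S\<close>; it has
      probability at most \<open>t\<close>.\<close>
    also have "t * S \<le> p - p'"
    proof -
      have "t * S \<le> t * (4 ^ J * 128 * (16 ^ Suc k / 15))"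
        using t by (intro mult_left_mono) (auto simp: S_def mid_sum_def)
      also have "\<dots> = 4 ^ J * 128 * (t * (16 ^ Suc k / 15))" by (simp only: mult_ac)
      also have "\<dots> \<le> 4 ^ J * 128 * w (Suc k)"
        unfolding t_def by (intro mult_left_mono exp_4_four_power) simp
      also have "\<dots> = p - p'" by (simp add: pp)
      finally show ?thesis .
    qed
    finally show ?thesis by simp
  next
    case 2
    have d': "d > w J * (1 - 5 / 4 * w (Suc k))"
    proof -
      have "0 < w J * w (Suc k)" by simp
      moreover have eq: "w J * (1 - x * w (Suc k)) = w J - x * (w J * w (Suc k))" for x
        by (simp add: algebra_simps)
      ultimately show ?thesis using 2 unfolding eq by linarith
    qed
    then have pp: "p = 3 * S" by (simp add: p_def mid_pot_def S_def)
    \<comment> \<open>51 = 3 * 16 + 3. Since \<open>t\<close> is at most 1/32, the expected cost of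
      a pass then stays below 2 * S, the part of 3 * S left after paying for the pulls.\<close>
    have p'S: "p' \<le> 51 * S"
    proof -
      have J4: "0 < (4::real) ^ J" by simp
      have S1: "4 ^ J * 128 \<le> S"
        unfolding S_def mid_sum_def by (simp add: field_simps)
      have "w (Suc k) \<le> 1" by (rule power_le_one) auto
      then have "4 ^ J * 128 * w (Suc k) \<le> 4 ^ J * 128 * 1" by (intro mult_left_mono) auto
      then have "4 ^ J * 128 * w (Suc k) \<le> S" using S1 by linarith
      moreover have "mid_sum J (Suc (Suc k)) = 16 * S + 4 ^ J * 128"
        by (simp add: S_def mid_sum_def field_simps)
      ultimately show ?thesis using S1 S(2) by (auto simp: p'_def mid_pot_def)
    qed
    have "Esum (arm q) (len q) (\<lambda>z. of_bool (\<not> rejects q z)) \<le> t"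
      unfolding tail[symmetric]
    proof (rule upper_tail[OF q(1)])
      fix z assume "\<not> rejects q z"
      then have "ref q - tol q \<le> avg q z" using rejects_iff[OF q(1)] by simp
      moreover have "w J * (1 - 3 / 4 * w (Suc k)) = tol q + w (Suc k) / 4 * w J"
        by (simp add: tol algebra_simps)
      ultimately show "nu (arm q) + w (Suc k) / 4 * w (scale q) \<le> avg q z"
        using 2 unfolding nui sc by linarith
    qed simp
    then have "Esum (arm q) (len q) f \<le> t * (c + p') + (1 - t) * c"
      using f1 f2 S(2) p' by (intro Esum_two_point) (force, simp, fastforce, blast)
    also have "\<dots> = c + t * p'" by (simp add: algebra_simps)
    also have "t * p' \<le> 1 / 32 * (51 * S)" using t p'S p' by (intro mult_mono) auto
    finally show ?thesis using pp S(2) by simp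
  next
    case 3
    have "p = 3 * S" using 3 by (simp add: p_def mid_pot_def S_def)
    moreover have "p' \<le> S"
    proof -
      \<comment> \<open>The windows are disjoint: 5/4 * w(k+2) is only 5/8 * w(k+1). So the next
        phase falls under the first case.\<close>
      have "w J * (1 - 3 / 4 * w (Suc k)) \<le> w J * (1 - 5 / 4 * w (Suc (Suc k)))"
        by (intro mult_left_mono) auto
      then have "d \<le> w J * (1 - 5 / 4 * w (Suc (Suc k)))" using 3(2) by linarith
      then have "p' = 4 ^ J * 128 * w (Suc k)"
        by (simp add: p'_def mid_pot_def del: power_Suc)
      also have "\<dots> \<le> 4 ^ J * 128 * 1" by (intro mult_left_mono power_le_one) auto
      also have "\<dots> \<le> S" unfolding S_def mid_sum_def by (simp add: field_simps)
      finally show ?thesis .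
    qed
    moreover have "f z \<le> c + p'" for z
      using f1[of z] f2[of z] p' S(2) by (cases "rejects q z") auto
    then have "Esum (arm q) (len q) f \<le> c + p'" by (rule Esum_le_const)
    ultimately show ?thesis using S(2) by simp
  qed
  then show ?thesis using S(1) by (simp add: p_def J_def d_def)
qed

lemma drift_far:
  assumes q: "inv q" "phase_of q \<noteq> Lead" "cur q = i" "\<not> near (leader q) (rnd q)"
  shows "real (len q) * of_bool (arm q = i) + Esum (arm q) (len q) (next_pot q) \<le> pot q"
proof -
  note r = inv_ref[OF q(1,2)] and fg = far_gap[OF q]
  define a J s where "a = leader q" "J = top q" "s = rnd q"
  note defs = this
  have bi: "b \<noteq> i" using gap_pos by auto
  have s: "G < s" using q(4) by (auto simp: near_def defs)
  have wG: "0 < w G" by simp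
  define t :: real where "t = (if i < b then 1 / 8 else 1)"
  have t: "0 \<le> t" by (simp add: t_def)
  define c where "c = base a J s t"
  have c: "0 \<le> c" using base_nonneg[OF t] by (simp add: c_def)
  have P: "pot (set_phase q p) = c + test_pot (set_phase q p)" for p
    using q bi by (auto simp: pot_def Let_def defs risk_def t_def c_def)
  have P': "pot q = c + test_pot q"
    using q bi by (auto simp: pot_def Let_def defs risk_def t_def c_def)
  have Qb: "arm_pot a J' s i = base a J' s t" for J' by (simp add: arm_pot_def pos_pot_def t_def)
  have rej: "next_pot q z \<le> c" if "rejects q z" for z
    using next_pot_reject(1)[OF q(1,2) that] Qb[of J] q(3) by (simp add: defs c_def)
  have arm: "arm q = i" "of_bool (arm q = i) = (1::real)" using r q by auto
  have nuarm: "nu (arm q) = nu i" using arm by simp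
  have low: "real (len q) + Esum (arm q) (len q) (next_pot q) \<le> c + test_pot q"
    if det: "\<And>z. next_pot q z \<le> c + test_pot q - real (len q)"
    using Esum_le_const[of "next_pot q", OF det, of "arm q" "len q"] by simp
  \<comment> \<open>From scale G on, \<open>i\<close> trails the reference by 3 units and the
    tolerance is at most 1, so passing needs a deviation by 2. The factor 32 allows for twice the
    16-fold growth of the multiplier in \<open>Mid\<close>; the pass probability 1/32 cancels
    it.\<close>
  have decay: "real (len q) + Esum (arm q) (len q) (next_pot q) \<le> c + test_pot q"
    if A: "\<And>z. \<not> rejects q z \<Longrightarrow> next_pot q z \<le> c + A" and pot: "test_pot q = 2 * real (len q)"
      and A0: "0 \<le> A" "A \<le> 32 * real (len q)" and sc: "G \<le> scale q" and tolw: "tol q \<le> w (scale q)" for A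
  proof -
    have l: "1 \<le> real (lam q)" using lam_pos[OF q(1)] by linarith
    have "real (lam q) \<ge> 128"
      using q(1,2) by (cases "phase_of q") (auto simp: lam_def inv_def)
    then have "exp (- 2 * (real (lam q) * 2\<^sup>2)) \<le> w 5"
      by (intro order_trans[OF _ exp_minus_le_w[of 5 "2 * (real (lam q) * 2\<^sup>2)"]]) auto
    have "Esum (arm q) (len q) (\<lambda>z. of_bool (\<not> rejects q z)) \<le> exp (- 2 * (real (lam q) * 2\<^sup>2))"
    proof (rule upper_tail[OF q(1)])
      fix z assume "\<not> rejects q z"
      then have "ref q - tol q \<le> avg q z" using rejects_iff[OF q(1)] by simp
      then show "nu (arm q) + 2 * w (scale q) \<le> avg q z"
        using fg(1) w_antimono[OF sc] tolw unfolding nuarm by linarith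
    qed simp
    also have "\<dots> \<le> 1 / 32" using \<open>exp (- 2 * (real (lam q) * 2\<^sup>2)) \<le> w 5\<close> by (simp add: power_one_over)
    finally have "Esum (arm q) (len q) (next_pot q) \<le> 1 / 32 * (c + A) + (1 - 1 / 32) * c"
      using A A0 rej by (intro Esum_two_point[where P = "\<lambda>z. \<not> rejects q z"]) auto
    also have "\<dots> = c + 1 / 32 * A" by (simp add: field_simps)
    finally show ?thesis using A0 pot by simp
  qed
  have "real (len q) + Esum (arm q) (len q) (next_pot q) \<le> c + test_pot q"
  proof (cases "phase_of q")
    case Lead
    then show ?thesis using q by simp
  next
    case (Low g)
    then have g: "g < J" using q by (simp add: inv_def defs)
    define p where "p = (if Suc g < J then Low (Suc g) else Mid 0)"
    have np: "next_phase q = Some p" using Low by (simp add: next_phase_def p_def defs)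
    have pass: "next_pot q z \<le> c + A" if "\<not> rejects q z" "test_pot (set_phase q p) \<le> A" "0 \<le> A" for z A
      using next_pot_pass_Some[OF q(1,2) that(1) np] P[of p] c that by auto
    note len = len_real(1)[OF Low]
    show ?thesis
    proof (cases "G \<le> J")
      case False
      have nonneg: "0 \<le> test_pot (set_phase q p)"
        using False g mid_pot_nonneg by (auto simp: test_pot_def Let_def p_def defs mid_sum_def
            intro!: add_nonneg_nonneg sum_nonneg)
      have "test_pot (set_phase q p) \<le> test_pot q - real (len q)"
      proof (cases "Suc g < J")
        case True
        then show ?thesis using False g Low len
          by (simp add: test_pot_def Let_def p_def defs sum_from[of g])
      next
        case *: False
        then have "Suc g = J" using g by simp
        then show ?thesis using False g Low len mid_pot_0[of J "ref q - nu i"]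
          by (simp add: test_pot_def Let_def p_def defs sum_from[of g] mid_sum_def)
      qed
      then have "next_pot q z \<le> c + test_pot q - real (len q)" for z
        using rej[of z] pass[of z "test_pot (set_phase q p)"] nonneg by (cases "rejects q z") auto
      then show ?thesis by (rule low)
    next
      case GJ: True
      show ?thesis
      proof (cases "g < G")
        case True
        have nonneg: "0 \<le> test_pot (set_phase q p)"
          using GJ by (intro test_pot_nonneg) (simp add: defs)
        have "test_pot (set_phase q p) \<le> test_pot q - real (len q)"
        proof (cases "Suc g < J")
          case *: True
          have "max g G = max (Suc g) G" using True by simp
          then show ?thesis using GJ True * g Low len
            by (simp add: test_pot_def Let_def p_def defs sum_from[of g])
        next
          case False
          then have "Suc g = J" "G = J" using g GJ True by auto
          then show ?thesis using g Low len
            unfolding test_pot_def Let_def p_def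
            by (simp add: defs[symmetric] sum_from[of g] max_def)
        qed
        then have "next_pot q z \<le> c + test_pot q - real (len q)" for z
          using rej[of z] pass[of z "test_pot (set_phase q p)"] nonneg by (cases "rejects q z") auto
        then show ?thesis by (rule low)
      next
        case False
        have pot: "test_pot q = 2 * real (len q)"
          using False GJ Low len by (simp add: test_pot_def Let_def defs max_absorb1)
        define A where "A = test_pot (set_phase q p)"
        have A: "0 \<le> A" "A \<le> 32 * real (len q)"
        proof -
          have "A \<le> 8 * real (len q)"
          proof (cases "Suc g < J")
            case True
            then show ?thesis using False GJ g len
              by (simp add: A_def p_def test_pot_def Let_def defs max_absorb1 of_nat_diff)
          next
            case *: False
            then have "J = Suc g" using g by simp
            then show ?thesis using GJ len
              by (simp add: A_def p_def test_pot_def Let_def defs)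
          qed
          moreover show "0 \<le> A"
            unfolding A_def using GJ by (intro test_pot_nonneg) (simp add: defs)
          ultimately show "A \<le> 32 * real (len q)" by simp
        qed
        show ?thesis
        proof (rule decay[OF _ pot A])
          show "next_pot q z \<le> c + A" if "\<not> rejects q z" for z
            using pass[OF that, of A] A by (simp add: A_def)
          show "G \<le> scale q" using False Low by (simp add: scale_def)
          show "tol q \<le> w (scale q)" by (rule tol_le[OF q(1)])
        qed
      qed
    qed
  next
    case (Mid k)
    then have k: "k \<le> k0" using q by (simp add: inv_def)
    note len = len_real(2)[OF Mid]
    show ?thesis
    proof (cases "G \<le> J")
      case GJ: True
      have pot: "test_pot q = 2 * real (len q)"
        using GJ Mid len by (simp add: test_pot_def Let_def defs)
      show ?thesis
      proof (rule decay[OF _ pot])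
        show "next_pot q z \<le> c + 32 * real (len q)" if nrej: "\<not> rejects q z" for z
        proof (cases "k < k0")
          case True
          then have np: "next_phase q = Some (Mid (Suc k))" using Mid by (simp add: next_phase_def)
          have "test_pot (set_phase q (Mid (Suc k))) = 32 * real (len q)"
            using GJ len by (simp add: test_pot_def Let_def defs)
          then show ?thesis
            using next_pot_pass_Some[OF q(1,2) nrej np] P[of "Mid (Suc k)"] c by auto
        next
          case False
          then have lam: "lam q = 128 * 16 ^ k0" using Mid k by (simp add: lam_def)
          have sc: "scale q = J" using Mid by (simp add: scale_def defs)
          \<comment> \<open>A pass with a good sample would mean a deficit of at most 9/8 * w J,
            against at least \<open>3 * w G\<close>.\<close>
          have "\<not> good q z"
          proof
            assume "good q z"
            from good_avg[OF q(1) this lam]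
            have "avg q z - nu i \<le> w J / 8" unfolding abs_le_iff nuarm sc by linarith
            moreover have "ref q - tol q \<le> avg q z" using nrej rejects_iff[OF q(1)] by simp
            moreover have "tol q \<le> w J" using tol_le[OF q(1)] sc by simp
            ultimately show False using fg(1) w_antimono[OF GJ] wG by linarith
          qed
          then show ?thesis using c by (simp add: next_pot_def)
        qed
        show "G \<le> scale q" using GJ Mid by (simp add: scale_def defs)
        show "tol q \<le> w (scale q)" by (rule tol_le[OF q(1)])
      qed auto
    next
      case False
      have "next_pot q z \<le> c + (mid_pot (top q) (ref q - nu i) (Suc k) - mid_sum (top q) (Suc k))"
        if nrej: "\<not> rejects q z" for z
      proof (cases "k < k0")
        case True
        then have np: "next_phase q = Some (Mid (Suc k))" using Mid by (simp add: next_phase_def)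
        have tp: "test_pot (set_phase q (Mid (Suc k)))
            = mid_pot (top q) (ref q - nu i) (Suc k) - mid_sum (top q) (Suc k)"
          using False by (simp add: test_pot_def Let_def defs)
        show ?thesis
        proof (cases "good q z")
          case True
          then show ?thesis
            using next_pot_pass_Some[OF q(1,2) nrej np] P[of "Mid (Suc k)"] tp by simp
        next
          case bad: False
          have "good q z" using True Mid by (simp add: good_def lam_def)
          then show ?thesis using bad by simp
        qed
      next
        case k': False
        then have kk: "k = k0" using k by simp
        have Js: "J < s" using False s by simp
        then have np: "next_phase q = Some (High (Suc J))"
          using Mid k' by (simp add: next_phase_def defs)
        have "mid_sum J (Suc k) \<le> 4 ^ J * 128 * 16 ^ Suc k / 15"
          unfolding mid_sum_def by (intro divide_right_mono mult_left_mono) auto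
        also have "\<dots> \<le> L * 4 ^ J * 2" by (simp add: kk)
        finally have S: "mid_sum J (Suc k) \<le> L * 4 ^ J * 2" .
        have J4: "4 * (4::real) ^ J \<le> 4 ^ G"
          using power_increasing[of "Suc J" G "4::real"] False by simp
        have "(\<Sum>h\<in>{Suc J..<G}. 4 ^ h * L) \<le> L * (4 ^ G / 3)"
        proof -
          have "(\<Sum>h\<in>{Suc J..<G}. (4::real) ^ h) \<le> (\<Sum>h<G. 4 ^ h)" by (rule sum_mono2) auto
          then have "(\<Sum>h\<in>{Suc J..<G}. (4::real) ^ h) \<le> 4 ^ G / 3"
            using geometric_four[of G] by linarith
          then show ?thesis by (simp add: sum_distrib_right[symmetric])
        qed
        moreover have "L * (4 * 4 ^ J) \<le> L * 4 ^ G" using J4 by (intro mult_left_mono) auto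
        moreover have "0 \<le> L * 4 ^ G" by simp
        \<comment> \<open>In units of \<open>L * 4 ^ G\<close>: the \<open>High\<close> stages up to
          G cost at most 1/3 and \<open>mid_sum\<close> is at most 2/4, together less than
          1.\<close>
        ultimately have neg: "(\<Sum>h\<in>{Suc J..<G}. 4 ^ h * L) - L * 4 ^ G \<le> - mid_sum J (Suc k)"
          using S by linarith
        have tp: "test_pot (set_phase q (High (Suc J)))
            = (\<Sum>h\<in>{Suc J..<G}. 4 ^ h * L) - L * 4 ^ G"
          using False by (simp add: test_pot_def Let_def defs)
        have cL: "L * 4 ^ G \<le> c"
        proof -
          have "L * 4 ^ G * 1 \<le> L * 4 ^ G * real (min (G - J) 6)"
            using False by (intro mult_left_mono) auto
          then show ?thesis using base_ge[OF t, of J a s] unfolding c_def mult_1_right by linarith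
        qed
        show ?thesis
        proof (cases "good q z")
          case True
          then show ?thesis
            using next_pot_pass_Some[OF q(1,2) nrej np] P[of "High (Suc J)"] tp neg
              mid_pot_nonneg[of J "ref q - nu i" "Suc k"] by (simp flip: defs)
        next
          case False
          have "mid_sum J (Suc k) \<le> L * 4 ^ G"
            using neg sum_nonneg[of "{Suc J..<G}" "\<lambda>h. 4 ^ h * L"] by auto
          then show ?thesis using False cL mid_pot_nonneg[of J "ref q - nu i" "Suc k"]
            by (simp add: next_pot_def flip: defs)
        qed
      qed
      from mid_pot_rejecting[OF q(1) Mid q(3) refl rej this] False Mid
      show ?thesis by (simp add: test_pot_def Let_def defs)
    qed
  next
    case (High g)
    then have g: "J < g" "g \<le> s" "nu a - nu i \<le> 3 * w g" using q by (auto simp: inv_def defs)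
    note len = len_real(3)[OF High]
    \<comment> \<open>The arm cannot have reached \<open>High g\<close> for g >= G, as the gap there
      is at most \<open>3 * w g\<close>.\<close>
    have "w G < w g" using fg(3,4) g(3) wG unfolding defs by linarith
    then have gG: "g < G" by (rule w_less_imp)
    have pot: "test_pot q = (\<Sum>h\<in>{g..<G}. 4 ^ h * L) - L * 4 ^ G"
      using g gG High by (simp add: test_pot_def Let_def defs)
    have cL: "L * 4 ^ G \<le> c"
    proof -
      have "L * 4 ^ G * 1 \<le> L * 4 ^ G * real (min (G - J) 6)"
        using g gG by (intro mult_left_mono) auto
      then show ?thesis using base_ge[OF t, of J a s] unfolding c_def mult_1_right by linarith
    qed
    have nonneg: "0 \<le> (\<Sum>h\<in>{Suc g..<G}. 4 ^ h * L)" by (intro sum_nonneg) auto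
    have pot': "test_pot q = real (len q) + (\<Sum>h\<in>{Suc g..<G}. 4 ^ h * L) - L * 4 ^ G"
      using pot len sum_from[OF gG] by simp
    have "next_pot q z \<le> c + test_pot q - real (len q)" for z
    proof (cases "good q z")
      case False
      then show ?thesis using cL nonneg pot' by (simp add: next_pot_def)
    next
      case good: True
      show ?thesis
      proof (cases "rejects q z")
        case True
        \<comment> \<open>The gap is at most about 16 * w G, so a good rejection happens within 6
          scales of G. J then rises to g, which lowers \<open>min (G - J) 6\<close> by at least 1
          and repays the advance \<open>L * 4 ^ G\<close>.\<close>
        have "3 / 8 * w g \<le> 17 * w G"
          using reject_high(1)[OF q(1) High good True] fg(2) unfolding q(3) by linarith
        then have *: "w g < w G * 64" using wG by linarith
        have "G - g < 6"
        proof (rule ccontr)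
          assume "\<not> G - g < 6"
          then have "6 \<le> G" "g \<le> G - 6" by auto
          then have "w G * 64 \<le> w g"
            using power_add[of "1/2::real" "G - 6" 6] w_antimono[of g "G - 6"]
            by (simp add: power_one_over)
          then show False using * by linarith
        qed
        then have "real (min (G - g) 6) + 1 \<le> real (min (G - J) 6)" using g(1) gG by auto
        then have "L * 4 ^ G * (real (min (G - g) 6) + 1) \<le> L * 4 ^ G * real (min (G - J) 6)"
          by (intro mult_left_mono) auto
        moreover have "top_bound a g s t \<le> top_bound a J s t"
          using reject_top(2)[OF q(1,2) good True] best[OF r(3)] High g(1)
          by (auto simp: top_bound_def scale_def simp flip: defs)
        then have "real (R - s) * round_pot (top_bound a g s t) \<le> real (R - s) * round_pot (top_bound a J s t)"
          by (intro mult_left_mono round_pot_mono) auto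
        ultimately have "base a g s t \<le> c - L * 4 ^ G"
          unfolding c_def base_def by (simp add: distrib_left)
        then show ?thesis
          using next_pot_reject(2)[OF q(1,2) True High good] Qb[of g] q(3) pot' nonneg
          by (simp add: defs)
      next
        case False
        have np: "next_phase q = Some (High (Suc g))"
          using High gG s by (simp add: next_phase_def defs)
        have "test_pot (set_phase q (High (Suc g))) = (\<Sum>h\<in>{Suc g..<G}. 4 ^ h * L) - L * 4 ^ G"
          using g gG by (simp add: test_pot_def Let_def defs)
        then show ?thesis
          using next_pot_pass_Some[OF q(1,2) False np] P[of "High (Suc g)"] good pot' by simp
      qed
    qed
    then show ?thesis by (rule low)
  qed
  then show ?thesis using P' arm by simp
qed

lemma drift:
  assumes "inv q"
  shows "real (len q) * of_bool (arm q = i) + Esum (arm q) (len q) (next_pot q) \<le> pot q"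
  using drift_lead drift_other drift_best drift_near drift_far assms by metis

section \<open>From the drift to the expected number of pulls\<close>

lemma next_pot_nonneg: "inv q \<Longrightarrow> 0 \<le> next_pot q z"
  using inv_adv pot_nonneg by (simp add: next_pot_def)

text \<open>Round \<^term>\<open>s\<close> starts only after the previous leader stage, which lasts \<^term>\<open>4 ^ (s - 1)\<close>
  pulls or more; hence no round beyond \<^term>\<open>R\<close> is reached while \<^term>\<open>k\<close> pulls remain.\<close>

definition in_time :: "stage \<Rightarrow> nat \<Rightarrow> bool" where
  "in_time q k \<longleftrightarrow> k \<le> T \<and> (if phase_of q = Lead then rnd q > 0 \<longrightarrow> 4 ^ (rnd q - 1) + k \<le> T
     else 4 ^ rnd q + k \<le> T)"

lemma in_time_le: "in_time q k \<Longrightarrow> k \<le> T"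
  unfolding in_time_def by blast

lemma in_time_rnd: assumes "in_time q k" shows "rnd q \<le> R"
proof (cases "rnd q")
  case (Suc s)
  have "(4::nat) ^ s \<le> 4 ^ rnd q" using Suc by simp
  then have "4 ^ s \<le> T" using assms Suc by (auto simp: in_time_def split: if_splits)
  then show ?thesis using rounds[of "rnd q"] Suc by simp
qed simp

lemma in_time_next_arm: "4 ^ s + k \<le> T \<Longrightarrow> in_time (next_arm a m J s c) k"
  by (auto simp: in_time_def next_arm_def test_phase_def)

lemma in_time_adv:
  assumes t: "in_time q k" and k: "len q \<le> k" and q: "inv q"
  shows "in_time (adv q (z div len q)) (k - len q)"
proof (cases "phase_of q = Lead")
  case True
  have "4 ^ rnd q \<le> len q" using True by (simp add: len_def scale_def lam_def)
  then have "4 ^ rnd q + (k - len q) \<le> T" using in_time_le[OF t] k by simp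
  then show ?thesis using True by (simp add: adv_def in_time_next_arm)
next
  case False
  then have "4 ^ rnd q + k \<le> T" using t by (auto simp: in_time_def)
  then have *: "4 ^ rnd q + (k - len q) \<le> T" by linarith
  show ?thesis
  proof (cases "rejects q z")
    case True
    then show ?thesis using adv_rejects[OF False True] * in_time_next_arm by simp
  next
    case rej: False
    show ?thesis
    proof (cases "next_phase q")
      case None
      then show ?thesis
        using adv_passes[OF False rej] * in_time_next_arm by (simp add: finish_def)
    next
      case (Some p)
      then have "p \<noteq> Lead" using False
        by (cases "phase_of q") (auto simp: next_phase_def split: if_splits)
      then show ?thesis using adv_passes[OF False rej] Some * by (simp add: in_time_def)
    qed
  qed
qed

text \<open>Every stage is charged \<open>T\<close> times the probability of a bad sample. As each
  stage uses at least one pull, there are at most \<open>k\<close> charges. An unfinished last stage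
  is covered by the drift of the complete one.\<close>

lemma V_le_pot:
  assumes "inv q" "in_time q k"
  shows "V k (q, 0, 0) \<le> pot q + real k * (real T * (2 * exp (- 4 * 16 ^ k0)))"
  using assms
proof (induction k arbitrary: q rule: less_induct)
  case (less k)
  define \<delta> where "\<delta> = real T * (2 * exp (- 4 * 16 ^ k0))"
  have \<delta>: "0 \<le> \<delta>" by (simp add: \<delta>_def)
  note q = less.prems(1)
  have n: "0 < len q" using len_pos[OF q] .
  have E0: "0 \<le> Esum (arm q) (len q) (next_pot q)"
    using Esum_mono[of "\<lambda>_. 0" "next_pot q" "arm q" "len q"] next_pot_nonneg[OF q] by (simp add: Esum_const)
  show ?case
  proof (cases "len q \<le> k")
    case False
    then have "V k (q, 0, 0) = real k * of_bool (arm q = i)"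
      by (intro V_stage_incomplete) simp
    also have "\<dots> \<le> real (len q) * of_bool (arm q = i)"
      using False by (intro mult_right_mono) auto
    also have "\<dots> \<le> pot q" using drift[OF q] E0 by linarith
    finally show ?thesis using \<delta> unfolding \<delta>_def[symmetric]
      by (simp add: add_increasing2)
  next
    case True
    let ?k = "k - len q"
    have k: "real ?k + 1 \<le> real k" using True n by (simp add: of_nat_diff)
    have "V ?k (adv q (z div len q), 0, 0)
        \<le> next_pot q z + (real ?k * \<delta> + real T * of_bool (\<not> good q z))" for z
    proof (cases "good q z")
      case good: True
      have t: "in_time (adv q (z div len q)) ?k" using in_time_adv less.prems True by simp
      have R: "rnd (adv q (z div len q)) \<le> R" using in_time_rnd[OF t] .
      have "V ?k (adv q (z div len q), 0, 0) \<le> pot (adv q (z div len q)) + real ?k * \<delta>"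
        unfolding \<delta>_def using n True by (intro less.IH inv_adv q good R t) simp
      then show ?thesis using good R by (simp add: next_pot_def)
    next
      case False
      have "V ?k (adv q (z div len q), 0, 0) \<le> real ?k" by (rule V_le) simp
      also have "\<dots> \<le> real T" using in_time_le[OF less.prems(2)] by simp
      finally show ?thesis using False next_pot_nonneg[OF q, of z] \<delta> by (simp add: add_increasing)
    qed
    then have "Esum (arm q) (len q) (\<lambda>z. V ?k (adv q (z div len q), 0, 0))
        \<le> Esum (arm q) (len q) (\<lambda>z. next_pot q z + (real ?k * \<delta> + real T * of_bool (\<not> good q z)))"
      by (rule Esum_mono)
    also have "\<dots> = Esum (arm q) (len q) (next_pot q) + (real ?k * \<delta>
        + real T * Esum (arm q) (len q) (\<lambda>z. of_bool (\<not> good q z)))"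
      by (simp only: Esum_add Esum_cmult Esum_const)
    also have "real T * Esum (arm q) (len q) (\<lambda>z. of_bool (\<not> good q z)) \<le> \<delta>"
      unfolding \<delta>_def by (intro mult_left_mono not_good_prob q) simp
    finally have "V k (q, 0, 0) \<le> pot q + (real ?k * \<delta> + \<delta>)"
      using V_stage[OF True n] drift[OF q] by simp
    also have "real ?k * \<delta> + \<delta> \<le> real k * \<delta>"
      using mult_right_mono[OF k \<delta>] by (simp add: algebra_simps)
    finally show ?thesis by (simp add: \<delta>_def)
  qed
qed

lemma V_start_le:
  "V T start \<le> 4 ^ G * (144 * L + 512 * (real R + 1) * (4 + real D - real G))"
proof -
  define q where "q = Stage 1 0 0 0 0 Lead"
  have "inv q" using i by (auto simp: inv_def q_def)
  moreover have "in_time q T" by (simp add: in_time_def q_def)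
  ultimately have "V T (q, 0, 0) \<le> pot q + real T * (real T * (2 * exp (- 4 * 16 ^ k0)))"
    by (rule V_le_pot)
  also have "real T * (real T * (2 * exp (- 4 * 16 ^ k0))) \<le> 1"
    using confidence by (simp add: power2_eq_square mult_ac)
  finally have 1: "V T start \<le> pot q + 1" by (simp add: start_def q_def)
  have G4: "1 \<le> (4::real) ^ G" by simp
  have L1: "1 \<le> L" using one_le_power[of "16::real" k0] by linarith
  have round_pot: "round_pot (top_bound a 0 0 (1 / 8)) = 512 * 4 ^ G * (4 + real D - real G)" for a
    by (simp add: round_pot_def top_bound_def)
  have "pot q = L * 4 ^ G * real (min G 6) + (real R + 1) * round_pot (top_bound 1 0 0 (1 / 8))
      + L * (20 * 4 ^ Suc G + 12 * (4 ^ Suc G - 1)) + 9 * L"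
    using i b by (simp add: pot_def Let_def q_def pos_pot_def base_def far_pot_def near_def risk_def
        algebra_simps)
  also have "\<dots> \<le> L * 4 ^ G * 6 + (real R + 1) * round_pot (top_bound 1 0 0 (1 / 8))
      + L * (20 * 4 ^ Suc G + 12 * (4 ^ Suc G - 1)) + 9 * L"
    by (intro add_mono mult_left_mono) auto
  \<comment> \<open>6 + 20 * 4 + 12 * 4 = 134, and the remaining 9 * L - 12 * L is negative. The
    later 144 also covers the 1 for bad samples.\<close>
  also have "\<dots> \<le> 134 * (L * 4 ^ G) + 512 * 4 ^ G * (real R + 1) * (4 + real D - real G)"
    using L1 by (simp add: round_pot algebra_simps)
  finally have "pot q \<le> 134 * (L * 4 ^ G) + 512 * 4 ^ G * (real R + 1) * (4 + real D - real G)" .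
  moreover have "1 * 1 \<le> L * 4 ^ G" using L1 G4 by (intro mult_mono) auto
  ultimately have "V T start
      \<le> 144 * (L * 4 ^ G) + 512 * 4 ^ G * (real R + 1) * (4 + real D - real G)"
    using 1 by linarith
  then show ?thesis by (simp add: algebra_simps)
qed

end

section \<open>Expectations over the reward table\<close>

locale bandit =
  fixes K T :: nat and D :: "nat \<Rightarrow> real measure"
  assumes inst: "bandit_instance K D" and K_pos: "0 < K" and T_pos: "0 < T"
begin

text \<open>\<open>D\<close> is arbitrary outside the arms, but the product locales want a
  probability space at every index; a point mass fills the gap.\<close>

definition DD :: "nat \<Rightarrow> real measure" where
  "DD a = (if a \<in> {1..K} then D a else return borel 0)"

lemma prob_DD: "prob_space (DD a)"
  using inst by (auto simp: DD_def bandit_instance_def intro!: prob_space_return)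

lemma sets_DD [measurable_cong, simp]: "sets (DD a) = sets borel"
  using inst by (auto simp: DD_def bandit_instance_def)

lemma space_DD [simp]: "space (DD a) = UNIV"
  using sets_eq_imp_space_eq[OF sets_DD] by simp

lemma AE_DD: "a \<in> {1..K} \<Longrightarrow> AE x in DD a. x \<in> {0..1}"
  using inst unfolding DD_def bandit_instance_def by simp

definition table :: "(nat \<times> nat \<Rightarrow> real) measure" where
  "table = (\<Pi>\<^sub>M (i, t)\<in>{1..K} \<times> {1..T}. DD i)"

lemma outcomes_eq: "outcomes K T D = table \<Otimes>\<^sub>M (\<Pi>\<^sub>M n\<in>(UNIV :: nat set). measure_pmf (bernoulli_pmf (1/2)))"
proof -
  have "(\<Pi>\<^sub>M (i, t)\<in>{1..K} \<times> {1..T}. D i) = table"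
    unfolding table_def by (rule PiM_cong) (auto simp: DD_def)
  then show ?thesis by (simp add: outcomes_def)
qed

sublocale P: product_prob_space "\<lambda>(i, t). DD i" I for I :: "(nat \<times> nat) set"
  using prob_DD
  by (auto simp: product_prob_space_def product_prob_space_axioms_def product_sigma_finite_def
      split: prod.splits intro: prob_space_imp_sigma_finite)

lemma prob_table: "prob_space table"
  unfolding table_def by (rule prob_space_PiM) (auto simp: prob_DD split: prod.splits)

lemma distr_fst_outcomes: "distr (outcomes K T D) table fst = table"
proof -
  have "prob_space (\<Pi>\<^sub>M n\<in>(UNIV :: nat set). measure_pmf (bernoulli_pmf (1/2)))"
    by (rule prob_space_PiM) (rule prob_space_measure_pmf)
  then show ?thesis
    unfolding outcomes_eq by (rule prob_space.distr_pair_fst)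
qed

lemma measurable_fst_outcomes: "fst \<in> outcomes K T D \<rightarrow>\<^sub>M table"
  unfolding outcomes_eq by (rule measurable_fst)

lemma integral_outcomes:
  fixes f :: "(nat \<times> nat \<Rightarrow> real) \<Rightarrow> real"
  assumes "f \<in> borel_measurable table"
  shows "(\<integral>\<omega>. f (fst \<omega>) \<partial>outcomes K T D) = (\<integral>X. f X \<partial>table)"
  using integral_distr[OF measurable_fst_outcomes assms] distr_fst_outcomes by simp

lemma measurable_component:
  assumes "i \<in> {1..K}" "t \<in> {1..T}" shows "(\<lambda>X. X (i, t)) \<in> borel_measurable table"
proof -
  have "(\<lambda>X. X (i, t)) \<in> table \<rightarrow>\<^sub>M DD i"
    unfolding table_def using measurable_component_singleton[of "(i, t)" _ "\<lambda>(i, t). DD i"] assms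
    by auto
  then show ?thesis by (simp cong: measurable_cong_sets)
qed

lemma integral_component:
  fixes J :: "(nat \<times> nat) set"
  assumes "j \<in> J" and g: "g \<in> borel_measurable borel"
  shows "(\<integral>y. g (y j) \<partial>(\<Pi>\<^sub>M (i, t)\<in>J. DD i)) = (\<integral>x. (g x :: real) \<partial>DD (fst j))"
proof -
  have "distr (\<Pi>\<^sub>M (i, t)\<in>J. DD i) (DD (fst j)) (\<lambda>y. y j) = DD (fst j)"
    using P.PiM_component[OF assms(1)] by (simp add: case_prod_beta)
  moreover have "(\<lambda>y. y j) \<in> (\<Pi>\<^sub>M (i, t)\<in>J. DD i) \<rightarrow>\<^sub>M DD (fst j)"
    using measurable_component_singleton[OF assms(1), of "\<lambda>(i, t). DD i"] by (simp add: case_prod_beta)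
  moreover have "g \<in> borel_measurable (DD (fst j))" using g by (simp cong: measurable_cong_sets)
  ultimately show ?thesis
    using integral_distr[of "\<lambda>y. y j" "(\<Pi>\<^sub>M (i, t)\<in>J. DD i)" "DD (fst j)" g] by simp
qed

text \<open>Adaptedness is stated pointwise on the revealed columns instead of through a filtration.
  Countability of the states reduces measurability to each state separately.\<close>

definition adapted :: "nat \<Rightarrow> ((nat \<times> nat \<Rightarrow> real) \<Rightarrow> 's :: countable) \<Rightarrow> bool" where
  "adapted t S \<longleftrightarrow> S \<in> table \<rightarrow>\<^sub>M count_space UNIV \<and>
     (\<forall>X X'. (\<forall>i\<in>{1..K}. \<forall>s\<in>{1..t}. X (i, s) = X' (i, s)) \<longrightarrow> S X = S X')"

lemma measurable_adaptive:
  fixes S :: "(nat \<times> nat \<Rightarrow> real) \<Rightarrow> 's :: countable"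
  assumes S: "S \<in> table \<rightarrow>\<^sub>M count_space UNIV" and t: "t \<in> {1..T}"
    and arm: "\<And>X. arm (S X) \<in> {1..K}"
    and h: "\<And>s. h s \<in> borel \<rightarrow>\<^sub>M N"
  shows "(\<lambda>X. h (S X) (X (arm (S X), t))) \<in> table \<rightarrow>\<^sub>M N"
proof -
  \<comment> \<open>The default 0 keeps \<open>f s\<close> measurable for states \<open>s\<close>
    whose arm is no valid index; such states never occur.\<close>
  define f where "f s X = h s (if arm s \<in> {1..K} then X (arm s, t) else 0)" for s and X :: "nat \<times> nat \<Rightarrow> real"
  have "f s \<in> table \<rightarrow>\<^sub>M N" for s
  proof (cases "arm s \<in> {1..K}")
    case True
    then have "f s = (\<lambda>X. h s (X (arm s, t)))" by (auto simp: f_def fun_eq_iff)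
    then show ?thesis using measurable_compose[OF measurable_component[OF True t] h] by simp
  next
    case False
    then have "f s = (\<lambda>X. h s 0)" by (auto simp: f_def fun_eq_iff)
    then show ?thesis using measurable_space[OF h, of 0 s] by simp
  qed
  then have "(\<lambda>X. f (S X) X) \<in> table \<rightarrow>\<^sub>M N"
    using S by (rule measurable_compose_countable)
  moreover have "f (S X) X = h (S X) (X (arm (S X), t))" for X
    using arm by (simp add: f_def)
  ultimately show ?thesis by simp
qed

lemma integrable_table_bounded:
  fixes f :: "(nat \<times> nat \<Rightarrow> real) \<Rightarrow> real"
  assumes "f \<in> borel_measurable table" "\<And>X. \<bar>f X\<bar> \<le> B"
  shows "integrable table f"
proof -
  interpret prob_space table by (rule prob_table)
  show ?thesis using assms by (intro integrable_const_bound[of _ B]) auto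
qed

text \<open>Splitting the product measure at time t makes the new reward independent of the arm, although the
  latter is chosen adaptively.\<close>

lemma adaptive_integral:
  fixes S :: "(nat \<times> nat \<Rightarrow> real) \<Rightarrow> 's :: countable" and h :: "'s \<Rightarrow> real \<Rightarrow> real"
  assumes S: "adapted t S" and t: "t < T"
    and arm: "\<And>X. arm (S X) \<in> {1..K}"
    and h: "\<And>s. h s \<in> borel_measurable borel" and B: "\<And>s x. \<bar>h s x\<bar> \<le> B"
  shows "(\<integral>X. h (S X) (X (arm (S X), Suc t)) \<partial>table)
    = (\<integral>X. (\<integral>x. h (S X) x \<partial>DD (arm (S X))) \<partial>table)"
proof -
  define I where "I = {1..K} \<times> {1..t}"
  define J where "J = {1..K} \<times> {Suc t..T}"
  have IJ: "I \<inter> J = {}" "finite I" "finite J" by (auto simp: I_def J_def)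
  have "I \<union> J = {1..K} \<times> {1..T}" using t by (auto simp: I_def J_def)
  then have table: "table = (\<Pi>\<^sub>M (i, t)\<in>(I \<union> J). DD i)" by (simp add: table_def)
  define H where "H s = (\<integral>x. h s x \<partial>DD (arm s))" for s
  have S': "S \<in> table \<rightarrow>\<^sub>M count_space UNIV" using S by (simp add: adapted_def)
  have merge: "S (merge I J (x, y)) = S x" for x y
    using S unfolding adapted_def by (auto simp: I_def merge_def)
  have new: "merge I J (x, y) (arm (S x), Suc t) = y (arm (S x), Suc t)" for x y
    using arm[of x] t by (auto simp: I_def J_def merge_def)
  have inJ: "(arm (S x), Suc t) \<in> J" for x using arm[of x] t by (auto simp: J_def)
  have HB: "\<bar>H s\<bar> \<le> B" for s
  proof -
    interpret prob_space "DD (arm s)" by (rule prob_DD)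
    have "integrable (DD (arm s)) (h s)"
      using h B by (intro integrable_const_bound[of _ B]) (auto cong: measurable_cong_sets)
    then have "(\<integral>x. \<bar>h s x\<bar> \<partial>DD (arm s)) \<le> (\<integral>x. B \<partial>DD (arm s))"
      using B by (intro integral_mono) auto
    also have "\<dots> = B" using prob_space by simp
    finally show ?thesis
      unfolding H_def using integral_abs_bound[of "DD (arm s)" "h s"] by linarith
  qed
  have 1: "integrable table (\<lambda>X. h (S X) (X (arm (S X), Suc t)))"
  proof (rule integrable_table_bounded[where B = B])
    show "(\<lambda>X. h (S X) (X (arm (S X), Suc t))) \<in> borel_measurable table"
      using measurable_adaptive[of S "Suc t" arm h borel, OF S' _ arm h] t by simp
  qed (rule B)
  have 2: "integrable table (\<lambda>X. H (S X))"
    by (rule integrable_table_bounded[where B = B, OF measurable_compose[OF S', of H] HB]) simp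
  have "(\<integral>X. h (S X) (X (arm (S X), Suc t)) \<partial>table)
      = (\<integral>x. (\<integral>y. h (S x) (y (arm (S x), Suc t)) \<partial>(\<Pi>\<^sub>M (i, t)\<in>J. DD i)) \<partial>(\<Pi>\<^sub>M (i, t)\<in>I. DD i))"
    using P.product_integral_fold[OF IJ 1[unfolded table]] unfolding table merge new .
  also have "\<dots> = (\<integral>x. H (S x) \<partial>(\<Pi>\<^sub>M (i, t)\<in>I. DD i))"
    using integral_component[OF inJ h] by (simp add: H_def)
  \<comment> \<open>A trivial integral over the later rewards is inserted, so that the same folding
    leads back to the whole table.\<close>
  also have "\<dots> = (\<integral>x. (\<integral>y. H (S x) \<partial>(\<Pi>\<^sub>M (i, t)\<in>J. DD i)) \<partial>(\<Pi>\<^sub>M (i, t)\<in>I. DD i))"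
    by (simp add: P.P.prob_space)
  also have "\<dots> = (\<integral>X. H (S X) \<partial>table)"
    using P.product_integral_fold[OF IJ 2[unfolded table]] unfolding table merge by simp
  finally show ?thesis by (simp add: H_def)
qed

end

section \<open>Sure invariants of the trajectory\<close>

context scan
begin

text \<open>Unlike \<open>inv\<close>, this holds for every reward table, good or not. It keeps the
  pulled arm legal and bounds the contents of the registers.\<close>

definition wf :: "stage \<Rightarrow> bool" where
  "wf q \<longleftrightarrow> leader q \<in> {1..K} \<and> cur q \<le> K \<and> top q \<le> rnd q \<and> mval q < 2 ^ e \<and>
     (phase_of q = Lead \<longleftrightarrow> cur q = 0) \<and>
     (case phase_of q of Lead \<Rightarrow> True | Low g \<Rightarrow> g < top q | Mid k \<Rightarrow> k \<le> k0
      | High g \<Rightarrow> top q < g \<and> g \<le> rnd q)"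

definition on_time :: "stage \<Rightarrow> nat \<Rightarrow> bool" where
  "on_time q t \<longleftrightarrow> (if phase_of q = Lead then rnd q > 0 \<longrightarrow> 4 ^ (rnd q - 1) \<le> t else 4 ^ rnd q \<le> t)"

lemma wf_len_pos: "wf q \<Longrightarrow> 0 < len q"
  by (cases "phase_of q") (auto simp: wf_def len_def lam_def)

lemma wf_scale_le: "wf q \<Longrightarrow> scale q \<le> rnd q"
  by (cases "phase_of q") (auto simp: wf_def scale_def)

lemma wf_arm: "wf q \<Longrightarrow> arm q \<in> {1..K}"
  by (cases "phase_of q") (auto simp: wf_def arm_def)

lemma wf_next_arm:
  assumes "a \<in> {1..K}" "m < 2 ^ e" "J \<le> s" "c \<le> K" "4 ^ s \<le> t"
  shows "wf (next_arm a m J s c) \<and> on_time (next_arm a m J s c) t"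
  using assms by (auto simp: wf_def on_time_def next_arm_def test_phase_def)

lemma wf_adv:
  assumes q: "wf q" and v: "v < 2 ^ e" and t: "on_time q t" "t \<le> t'" "len q \<le> t'"
  shows "wf (adv q v) \<and> on_time (adv q v) t'"
proof (cases "phase_of q = Lead")
  case True
  have "4 ^ rnd q \<le> len q" using True by (simp add: len_def scale_def lam_def)
  then have "4 ^ rnd q \<le> t'" using t by simp
  then show ?thesis
    using q v True wf_next_arm[of "leader q" v "top q" "rnd q" 0 t'] by (simp add: adv_def wf_def)
next
  case False
  then have t4: "4 ^ rnd q \<le> t'" using t by (simp add: on_time_def)
  have "leader q \<in> {1..K}" "cur q \<in> {1..K}" "mval q < 2 ^ e" "top q \<le> rnd q" "scale q \<le> rnd q"
    using q False wf_scale_le[OF q] by (auto simp: wf_def)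
  note na = this(1-4) wf_next_arm[OF _ _ _ _ t4]
  have fin: "wf (finish q v) \<and> on_time (finish q v) t'"
    using na v by (auto simp: finish_def)
  have sp: "wf (set_phase q p) \<and> on_time (set_phase q p) t'" if "p \<noteq> Lead"
    "case p of Lead \<Rightarrow> True | Low g \<Rightarrow> g < top q | Mid k \<Rightarrow> k \<le> k0 | High g \<Rightarrow> top q < g \<and> g \<le> rnd q" for p
    using that q False t4 by (cases p) (auto simp: wf_def on_time_def)
  note sp = sp[THEN conjunct1] sp[THEN conjunct2]
  have qp: "case phase_of q of Lead \<Rightarrow> True | Low g \<Rightarrow> g < top q | Mid k \<Rightarrow> k \<le> k0
      | High g \<Rightarrow> top q < g \<and> g \<le> rnd q"
    using q by (simp add: wf_def)
  have "wf (pass q v) \<and> on_time (pass q v) t'"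
  proof (cases "phase_of q")
    case (Low g)
    then show ?thesis using qp by (auto simp: pass_def intro!: sp)
  next
    case (Mid k)
    then show ?thesis using qp fin by (auto simp: pass_def intro!: sp)
  next
    case (High g)
    then show ?thesis using qp fin by (auto simp: pass_def intro!: sp)
  qed (use False in simp)
  moreover have "wf (next_arm (leader q) (mval q) (max (top q) (scale q)) (rnd q) (cur q))
      \<and> on_time (next_arm (leader q) (mval q) (max (top q) (scale q)) (rnd q) (cur q)) t'"
    using na \<open>scale q \<le> rnd q\<close> by auto
  ultimately show ?thesis using False by (simp add: adv_def)
qed

primrec traj :: "(real \<Rightarrow> nat) \<Rightarrow> (nat \<times> nat \<Rightarrow> real) \<Rightarrow> nat \<Rightarrow> stage \<times> nat \<times> nat" where
  "traj y X 0 = start"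
| "traj y X (Suc t) = nxt (traj y X t) (y (X (arm (fst (traj y X t)), Suc t)))"

text \<open>The last conjunct records that each reward is at most 2^e - 1, so the average of a
  complete stage is below 2^e and may serve as an estimate.\<close>

lemma traj_wf:
  assumes "0 < K" and y: "\<And>x. y x < 2 ^ e" and "traj y X t = (q, n, u)"
  shows "wf q \<and> on_time q t \<and> n < len q \<and> n \<le> t \<and> u + n \<le> n * 2 ^ e"
  using assms(3)
proof (induction t arbitrary: q n u)
  case 0
  then show ?case using assms(1)
    by (auto simp: start_def wf_def on_time_def len_def lam_def scale_def)
next
  case (Suc t)
  obtain q' n' u' where tr: "traj y X t = (q', n', u')" by (cases "traj y X t")
  note IH = Suc.IH[OF tr]
  define z where "z = y (X (arm q', Suc t))"
  have z: "z < 2 ^ e" using y by (simp add: z_def)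
  have eq: "(q, n, u) = nxt (q', n', u') z" using Suc.prems tr by (simp add: z_def)
  show ?case
  proof (cases "Suc n' < len q'")
    case True
    then have "q = q'" "n = Suc n'" "u = u' + z" using eq by (auto simp: nxt_def)
    then show ?thesis using IH z True by (auto simp: on_time_def split: if_splits)
  next
    case False
    then have len: "len q' = Suc n'" using IH by simp
    have "u' + z < Suc n' * 2 ^ e" using IH z by simp
    then have "(u' + z) div len q' < 2 ^ e"
      unfolding len by (subst div_less_iff_less_mult) (auto simp: mult.commute)
    then have "wf (adv q' ((u' + z) div len q')) \<and> on_time (adv q' ((u' + z) div len q')) (Suc t)"
      using IH len by (intro wf_adv[where t = t]) auto
    then show ?thesis using eq False wf_len_pos by (auto simp: nxt_def)
  qed
qed

end

section \<open>The recursion as an expectation, and the regret decomposition\<close>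

lemma (in prob_space) mgf_unit_interval:
  fixes f :: "'a \<Rightarrow> real"
  assumes f: "f \<in> borel_measurable M" "\<And>x. f x \<in> {A..A + 1}" and l: "0 < l"
  shows "expectation (\<lambda>x. exp (l * (f x - expectation f))) \<le> exp (l\<^sup>2 / 8)"
proof -
  interpret interval_bounded_random_variable M f A "A + 1"
    using f by unfold_locales auto
  have "expectation (\<lambda>x. exp (l * (f x - expectation f)))
      = enn2real (\<integral>\<^sup>+x. ennreal (exp (l * (f x - expectation f))) \<partial>M)"
    using f by (intro integral_eq_nn_integral) auto
  also have "\<dots> \<le> exp (l\<^sup>2 / 8)"
    using Hoeffdings_lemma_nn_integral[OF l] by (intro enn2real_leI) auto
  finally show ?thesis .
qed

locale bandit_scan = bandit K T D + scan K k0 e for K T D k0 e +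
  fixes y :: "real \<Rightarrow> nat" and \<eta> :: real
  assumes y_measurable: "y \<in> borel \<rightarrow>\<^sub>M count_space UNIV"
    and y_less: "\<And>x. y x < 2 ^ e"
    and y_approx: "\<And>x. x \<in> {0..1} \<Longrightarrow> \<bar>real (y x) / 2 ^ e - x\<bar> \<le> \<eta>"
begin

definition E :: "nat \<Rightarrow> (nat \<Rightarrow> real) \<Rightarrow> real" where
  "E a f = (\<integral>x. f (y x) \<partial>DD a)"

definition nu :: "nat \<Rightarrow> real" where
  "nu a = E a (\<lambda>n. real n / 2 ^ e)"

lemma measurable_y: "(\<lambda>x. f (y x)) \<in> borel_measurable borel" for f :: "nat \<Rightarrow> real"
  by (rule measurable_compose[OF y_measurable]) simp

lemma bounded_y: "\<exists>B. \<forall>x. \<bar>f (y x)\<bar> \<le> B" for f :: "nat \<Rightarrow> real"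
proof -
  have "\<bar>f (y x)\<bar> \<le> (\<Sum>n<2 ^ e. \<bar>f n\<bar>)" for x
    using y_less[of x] by (intro member_le_sum[of "y x" "{..<2 ^ e}" "\<lambda>n. \<bar>f n\<bar>"]) auto
  then show ?thesis by blast
qed

lemma integrable_y: "integrable (DD a) (\<lambda>x. f (y x))" for f :: "nat \<Rightarrow> real"
proof -
  interpret prob_space "DD a" by (rule prob_DD)
  obtain B where "\<forall>x. \<bar>f (y x)\<bar> \<le> B" using bounded_y by blast
  then show ?thesis using measurable_y
    by (intro integrable_const_bound[of _ B]) (auto cong: measurable_cong_sets)
qed

lemma sampling_E: "sampling E (2 ^ e) nu"
proof
  fix a :: nat and f g :: "nat \<Rightarrow> real" and r l :: real
  interpret prob_space "DD a" by (rule prob_DD)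
  show "E a (\<lambda>y. f y + g y) = E a f + E a g"
    unfolding E_def by (intro Bochner_Integration.integral_add integrable_y)
  show "E a (\<lambda>y. r * f y) = r * E a f"
    unfolding E_def by simp
  show "E a (\<lambda>_. 1) = 1"
    unfolding E_def using prob_space by simp
  show "E a f \<le> E a g" if "\<And>y. f y \<le> g y"
    unfolding E_def using that by (intro integral_mono integrable_y)
  show "E a (\<lambda>y. exp (l * (real y / 2 ^ e - nu a))) \<le> exp (l\<^sup>2 / 8)"
  proof -
    have y01: "0 \<le> real (y x) / 2 ^ e" "real (y x) / 2 ^ e \<le> 1" for x
    proof -
      have "real (y x) \<le> real (2 ^ e)" using y_less[of x] by (intro of_nat_mono) simp
      then show "0 \<le> real (y x) / 2 ^ e" "real (y x) / 2 ^ e \<le> 1" by simp_all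
    qed
    have meas: "(\<lambda>x. f (y x)) \<in> borel_measurable (DD a)" for f :: "nat \<Rightarrow> real"
      using measurable_y by (simp cong: measurable_cong_sets)
    consider "0 < l" | "l < 0" | "l = 0" by linarith
    then show ?thesis
    proof cases
      case 1
      then show ?thesis
        using mgf_unit_interval[of "\<lambda>x. real (y x) / 2 ^ e" 0 l] y01 meas
        by (simp add: E_def nu_def)
    next
      \<comment> \<open>Hoeffding's lemma is available for positive parameters, hence the negated
        variable, with range in [-1, 0].\<close>
      case 2
      then show ?thesis
        using mgf_unit_interval[of "\<lambda>x. - (real (y x) / 2 ^ e)" "- 1" "- l"] y01
          meas[of "\<lambda>n. - (real n / 2 ^ e)"]
        by (simp add: E_def nu_def algebra_simps)
    next
      case 3
      then show ?thesis using prob_space by (simp add: E_def)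
    qed
  qed
qed

lemma E_bounds: "(\<And>n. f n \<le> B) \<Longrightarrow> E a f \<le> B" "(\<And>n. B \<le> f n) \<Longrightarrow> B \<le> E a f"
proof -
  interpret sampling E "2 ^ e" nu by (rule sampling_E)
  show "(\<And>n. f n \<le> B) \<Longrightarrow> E a f \<le> B" "(\<And>n. B \<le> f n) \<Longrightarrow> B \<le> E a f"
    using E_mono[of f "\<lambda>_. B" a] E_mono[of "\<lambda>_. B" f a] by (auto simp: E_const)
qed

lemma nu_approx:
  assumes a: "a \<in> {1..K}" shows "\<bar>nu a - arm_mean D a\<bar> \<le> \<eta>"
proof -
  interpret prob_space "DD a" by (rule prob_DD)
  have id: "integrable (DD a) (\<lambda>x. x)"
    using AE_DD[OF a] by (intro integrable_const_bound[of _ 1]) (auto cong: measurable_cong_sets)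
  have D: "DD a = D a" using a by (simp add: DD_def)
  have "nu a - arm_mean D a = (\<integral>x. real (y x) / 2 ^ e - x \<partial>DD a)"
    unfolding nu_def E_def arm_mean_def D[symmetric]
    by (rule Bochner_Integration.integral_diff[symmetric, OF integrable_y[of _ "\<lambda>n. real n / 2 ^ e"] id])
  also have "\<bar>\<dots>\<bar> \<le> (\<integral>x. \<bar>real (y x) / 2 ^ e - x\<bar> \<partial>DD a)"
    by (rule integral_abs_bound)
  also have "\<dots> \<le> (\<integral>x. \<eta> \<partial>DD a)"
  proof (rule integral_mono_AE)
    show "integrable (DD a) (\<lambda>x. \<bar>real (y x) / 2 ^ e - x\<bar>)"
      using integrable_y[of _ "\<lambda>n. real n / 2 ^ e"] id by simp
    show "AE x in DD a. \<bar>real (y x) / 2 ^ e - x\<bar> \<le> \<eta>"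
      using AE_DD[OF a] by eventually_elim (rule y_approx)
  qed simp
  also have "\<dots> = \<eta>" using prob_space by simp
  finally show ?thesis .
qed

sublocale S: scan_sampling K k0 e E nu cost for cost
  using sampling_E by (simp add: scan_sampling_def)

lemma traj_arm: "arm (fst (traj y X t)) \<in> {1..K}"
  using traj_wf[of y X t, OF K_pos y_less] wf_arm by (cases "traj y X t") auto

lemma traj_adapted: "t \<le> T \<Longrightarrow> adapted t (\<lambda>X. traj y X t)"
proof (induction t)
  case 0
  show ?case by (simp add: adapted_def)
next
  case (Suc t)
  then have IH: "(\<lambda>X. traj y X t) \<in> table \<rightarrow>\<^sub>M count_space UNIV"
    "(\<forall>i\<in>{1..K}. \<forall>s\<in>{1..t}. X (i, s) = X' (i, s)) \<Longrightarrow> traj y X t = traj y X' t" for X X'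
    unfolding adapted_def by auto
  have "(\<lambda>X. nxt (traj y X t) (y (X (arm (fst (traj y X t)), Suc t)))) \<in> table \<rightarrow>\<^sub>M count_space UNIV"
    using measurable_adaptive[of "\<lambda>X. traj y X t" "Suc t" "\<lambda>\<sigma>. arm (fst \<sigma>)" "\<lambda>\<sigma> x. nxt \<sigma> (y x)"
        "count_space UNIV", OF IH(1) _ traj_arm measurable_compose[OF y_measurable]] Suc.prems
    by simp
  moreover have "traj y X (Suc t) = traj y X' (Suc t)"
    if X: "\<forall>i\<in>{1..K}. \<forall>s\<in>{1..Suc t}. X (i, s) = X' (i, s)" for X X'
  proof -
    have "traj y X t = traj y X' t" using X by (intro IH(2)) auto
    moreover have "X (arm (fst (traj y X t)), Suc t) = X' (arm (fst (traj y X t)), Suc t)"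
      using X traj_arm by auto
    ultimately show ?thesis by simp
  qed
  ultimately show ?case by (simp add: adapted_def)
qed

lemma traj_measurable: "t \<le> T \<Longrightarrow> (\<lambda>X. traj y X t) \<in> table \<rightarrow>\<^sub>M count_space UNIV"
  using traj_adapted by (simp add: adapted_def)

text \<open>By \<open>adaptive_integral\<close>, one step of the recursion and one more column of
  the table have the same expectation; the induction strings these steps together.\<close>

lemma expected_cost:
  assumes "\<And>a. 0 \<le> cost a" "\<And>a. cost a \<le> 1" and "t + k = T"
  shows "(\<integral>X. S.V cost k (traj y X t) \<partial>table)
    = (\<Sum>s\<in>{t..<T}. \<integral>X. cost (arm (fst (traj y X s))) \<partial>table)"
  using assms(3)
proof (induction k arbitrary: t)
  case 0
  then show ?case by simp
next
  case (Suc k)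
  have V0: "0 \<le> S.V cost k \<sigma>" for k \<sigma>
  proof (induction k arbitrary: \<sigma>)
    case (Suc k)
    then show ?case unfolding S.V.simps by (intro add_nonneg_nonneg assms(1) E_bounds(2))
  qed simp
  have VB: "\<bar>S.V cost k \<sigma>\<bar> \<le> real k" for \<sigma>
    using V0 S.V_le[OF assms(2)] by simp
  have meas: "(\<lambda>X. f (traj y X t)) \<in> borel_measurable table" for f :: "_ \<Rightarrow> real"
    using Suc.prems by (intro measurable_compose[OF traj_measurable]) auto
  have EB: "\<bar>E a (\<lambda>n. S.V cost k (nxt \<sigma> n))\<bar> \<le> real k" for a \<sigma>
    using E_bounds[where f = "\<lambda>n. S.V cost k (nxt \<sigma> n)"] V0 S.V_le[OF assms(2)] by (simp add: abs_of_nonneg)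
  have "(\<integral>X. S.V cost (Suc k) (traj y X t) \<partial>table)
      = (\<integral>X. cost (arm (fst (traj y X t))) + E (arm (fst (traj y X t)))
          (\<lambda>n. S.V cost k (nxt (traj y X t) n)) \<partial>table)"
    by simp
  also have "\<dots> = (\<integral>X. cost (arm (fst (traj y X t))) \<partial>table)
      + (\<integral>X. E (arm (fst (traj y X t))) (\<lambda>n. S.V cost k (nxt (traj y X t) n)) \<partial>table)"
  proof (rule Bochner_Integration.integral_add)
    show "integrable table (\<lambda>X. cost (arm (fst (traj y X t))))"
      using assms(1,2) meas[of "\<lambda>\<sigma>. cost (arm (fst \<sigma>))"]
      by (intro integrable_table_bounded[where B = 1]) (auto simp: abs_le_iff intro: order_trans[of _ 0])
    show "integrable table (\<lambda>X. E (arm (fst (traj y X t))) (\<lambda>n. S.V cost k (nxt (traj y X t) n)))"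
      using EB meas[of "\<lambda>\<sigma>. E (arm (fst \<sigma>)) (\<lambda>n. S.V cost k (nxt \<sigma> n))"]
      by (intro integrable_table_bounded[where B = "real k"]) auto
  qed
  also have "(\<integral>X. E (arm (fst (traj y X t))) (\<lambda>n. S.V cost k (nxt (traj y X t) n)) \<partial>table)
      = (\<integral>X. S.V cost k (traj y X (Suc t)) \<partial>table)"
    using adaptive_integral[of t "\<lambda>X. traj y X t" "\<lambda>\<sigma>. arm (fst \<sigma>)"
        "\<lambda>\<sigma> x. S.V cost k (nxt \<sigma> (y x))" "real k"] traj_adapted[of t] traj_arm Suc.prems VB
      measurable_y
    by (simp add: E_def)
  also have "\<dots> = (\<Sum>s\<in>{Suc t..<T}. \<integral>X. cost (arm (fst (traj y X s))) \<partial>table)"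
    using Suc.prems by (intro Suc.IH) simp
  finally show ?case using Suc.prems by (simp add: sum.atLeast_Suc_lessThan)
qed

lemma AE_table: "i \<in> {1..K} \<Longrightarrow> t \<in> {1..T} \<Longrightarrow> AE X in table. X (i, t) \<in> {0..1}"
  unfolding table_def
  using AE_PiM_component[of "{1..K} \<times> {1..T}" "\<lambda>(i, t). DD i" "(i, t)" "\<lambda>x. x \<in> {0..1}"]
    prob_DD AE_DD by auto

text \<open>Rewards lie in [0,1] only almost surely, whereas \<open>adaptive_integral\<close> wants
  a function that is bounded everywhere.\<close>

definition clamp :: "real \<Rightarrow> real" where
  "clamp x = max 0 (min 1 x)"

lemma integral_clamp:
  assumes "i \<in> {1..K}" shows "(\<integral>x. clamp x \<partial>DD i) = arm_mean D i"
proof -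
  have D: "DD i = D i" using assms by (simp add: DD_def)
  show ?thesis unfolding arm_mean_def D[symmetric]
  proof (rule integral_cong_AE)
    show "AE x in DD i. clamp x = x"
      using AE_DD[OF assms] by eventually_elim (simp add: clamp_def)
  qed (auto simp: clamp_def cong: measurable_cong_sets)
qed

lemma reward_at:
  assumes S: "adapted t S" and t: "t < T" and arm: "\<And>X. a (S X) \<in> {1..K}"
  shows "(\<integral>X. X (a (S X), Suc t) \<partial>table) = (\<integral>X. arm_mean D (a (S X)) \<partial>table)"
    "integrable table (\<lambda>X. X (a (S X), Suc t))"
proof -
  have S': "S \<in> table \<rightarrow>\<^sub>M count_space UNIV" using S by (simp add: adapted_def)
  have m1: "(\<lambda>X. X (a (S X), Suc t)) \<in> borel_measurable table"
    using measurable_adaptive[of S "Suc t" a "\<lambda>_ x. x" borel, OF S' _ arm] t by simp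
  have cm: "clamp \<in> borel_measurable borel" by (simp add: clamp_def[abs_def])
  have m2: "(\<lambda>X. clamp (X (a (S X), Suc t))) \<in> borel_measurable table"
    by (rule measurable_compose[OF m1 cm])
  have "AE X in table. \<forall>i\<in>{1..K}. X (i, Suc t) \<in> {0..1}"
    using AE_table t by (subst AE_ball_countable) auto
  then have ae: "AE X in table. clamp (X (a (S X), Suc t)) = X (a (S X), Suc t)"
    by eventually_elim (use arm in \<open>auto simp: clamp_def\<close>)
  have "(\<integral>X. X (a (S X), Suc t) \<partial>table) = (\<integral>X. clamp (X (a (S X), Suc t)) \<partial>table)"
    using ae by (intro integral_cong_AE m1 m2) auto
  also have "\<dots> = (\<integral>X. (\<integral>x. clamp x \<partial>DD (a (S X))) \<partial>table)"
    by (rule adaptive_integral[of t S a "\<lambda>_. clamp" 1, OF S t arm cm]) (auto simp: clamp_def)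
  also have "\<dots> = (\<integral>X. arm_mean D (a (S X)) \<partial>table)"
    using integral_clamp[OF arm] by simp
  finally show "(\<integral>X. X (a (S X), Suc t) \<partial>table) = (\<integral>X. arm_mean D (a (S X)) \<partial>table)" .
  have "integrable table (\<lambda>X. clamp (X (a (S X), Suc t)))"
    by (rule integrable_table_bounded[where B = 1, OF m2]) (auto simp: clamp_def)
  then show "integrable table (\<lambda>X. X (a (S X), Suc t))"
    using integrable_cong_AE[OF m1 m2] ae by (auto simp: eq_commute)
qed

text \<open>The reward of the player does not depend on the competing arm, so the maximum passes to
  the means; then the expected gap of the arm played is split by arms. The coin tosses integrate
  out.\<close>

lemma pseudo_regret_eq:
  assumes I: "\<And>\<omega> t. t \<in> {1..T} \<Longrightarrow> I \<omega> t = arm (fst (traj y (fst \<omega>) (t - 1)))"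
  shows "pseudo_regret K T D I
    = (\<Sum>i\<in>suboptimal_arms K D. gap K D i * S.V (\<lambda>a. of_bool (a = i)) T start)"
proof -
  interpret tab: prob_space table by (rule prob_table)
  define N where "N i = S.V (\<lambda>a. of_bool (a = i)) T start" for i
  have cost: "N i = (\<Sum>t<T. \<integral>X. of_bool (arm (fst (traj y X t)) = i) \<partial>table)" for i
    using expected_cost[of "\<lambda>a. of_bool (a = i)" 0 T] tab.prob_space
    by (simp add: N_def atLeast0LessThan)
  have shift: "(\<Sum>t=1..T. f t) = (\<Sum>t<T. f (Suc t))" for f :: "nat \<Rightarrow> real"
    by (simp add: sum.atLeast1_atMost_eq)
  have fixed: "(\<integral>\<omega>. (\<Sum>t=1..T. fst \<omega> (i, t)) \<partial>outcomes K T D) = real T * arm_mean D i"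
    if i: "i \<in> {1..K}" for i
  proof -
    have ad: "adapted t (\<lambda>X. i)" for t by (simp add: adapted_def)
    have m: "(\<lambda>X. \<Sum>t=1..T. X (i, t)) \<in> borel_measurable table"
      using measurable_component[OF i] by (intro borel_measurable_sum) auto
    have "(\<integral>\<omega>. (\<Sum>t=1..T. fst \<omega> (i, t)) \<partial>outcomes K T D) = (\<integral>X. (\<Sum>t=1..T. X (i, t)) \<partial>table)"
      using integral_outcomes[OF m] by simp
    also have "\<dots> = (\<Sum>t<T. \<integral>X. X (i, Suc t) \<partial>table)"
      unfolding shift using reward_at(2)[OF ad, of _ "\<lambda>x. x"] i
      by (intro Bochner_Integration.integral_sum) auto
    also have "\<dots> = (\<Sum>t<T. arm_mean D i)"
      using reward_at(1)[OF ad, of _ "\<lambda>x. x"] i tab.prob_space by (intro sum.cong) auto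
    finally show ?thesis by simp
  qed
  have played: "(\<integral>\<omega>. (\<Sum>t=1..T. fst \<omega> (I \<omega> t, t)) \<partial>outcomes K T D)
      = (\<Sum>t<T. \<integral>X. arm_mean D (arm (fst (traj y X t))) \<partial>table)"
  proof -
    have r: "integrable table (\<lambda>X. X (arm (fst (traj y X t)), Suc t))"
      "(\<integral>X. X (arm (fst (traj y X t)), Suc t) \<partial>table)
        = (\<integral>X. arm_mean D (arm (fst (traj y X t))) \<partial>table)" if "t < T" for t
      using reward_at[OF traj_adapted[of t] that, of "\<lambda>\<sigma>. arm (fst \<sigma>)"] traj_arm that by auto
    have "(\<integral>\<omega>. (\<Sum>t=1..T. fst \<omega> (I \<omega> t, t)) \<partial>outcomes K T D)
        = (\<integral>\<omega>. (\<Sum>t<T. fst \<omega> (arm (fst (traj y (fst \<omega>) t)), Suc t)) \<partial>outcomes K T D)"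
      unfolding shift using I by (intro Bochner_Integration.integral_cong sum.cong) auto
    also have "\<dots> = (\<integral>X. (\<Sum>t<T. X (arm (fst (traj y X t)), Suc t)) \<partial>table)"
      using r(1) by (intro integral_outcomes borel_measurable_sum) auto
    also have "\<dots> = (\<Sum>t<T. \<integral>X. X (arm (fst (traj y X t)), Suc t) \<partial>table)"
      using r(1) by (intro Bochner_Integration.integral_sum) auto
    finally show ?thesis using r(2) by simp
  qed
  define Z where "Z = (\<Sum>t<T. \<integral>X. arm_mean D (arm (fst (traj y X t))) \<partial>table)"
  have "pseudo_regret K T D I = (MAX i\<in>{1..K}. real T * arm_mean D i - Z)"
    unfolding pseudo_regret_def played Z_def[symmetric] using fixed
    by (intro arg_cong[of _ _ Max] image_cong) auto
  also have "\<dots> = real T * best_mean K D - Z"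
  proof -
    have "mono (\<lambda>x. real T * x - Z)" by (auto intro!: monoI mult_left_mono)
    then have "real T * best_mean K D - Z = Max ((\<lambda>x. real T * x - Z) ` arm_mean D ` {1..K})"
      unfolding best_mean_def using K_pos by (intro mono_Max_commute) auto
    then show ?thesis by (simp add: image_image)
  qed
  also have "\<dots> = (\<Sum>t<T. \<integral>X. gap K D (arm (fst (traj y X t))) \<partial>table)"
  proof -
    have "(\<integral>X. gap K D (arm (fst (traj y X t))) \<partial>table)
        = best_mean K D - (\<integral>X. arm_mean D (arm (fst (traj y X t))) \<partial>table)" if "t < T" for t
    proof -
      have meas: "(\<lambda>X. arm_mean D (arm (fst (traj y X t)))) \<in> borel_measurable table"
        using that by (intro measurable_compose[OF traj_measurable]) auto
      have "\<bar>arm_mean D (arm (fst (traj y X t)))\<bar> \<le> (\<Sum>a\<in>{1..K}. \<bar>arm_mean D a\<bar>)" for X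
        using traj_arm[of X t] by (intro member_le_sum) auto
      from integrable_table_bounded[OF meas this] show ?thesis
        unfolding gap_def using tab.prob_space by simp
    qed
    then show ?thesis by (simp add: Z_def sum_subtractf)
  qed
  also have "\<dots> = (\<Sum>t<T. \<Sum>i\<in>suboptimal_arms K D.
      gap K D i * (\<integral>X. of_bool (arm (fst (traj y X t)) = i) \<partial>table))"
  proof (rule sum.cong[OF refl])
    fix t assume t: "t \<in> {..<T}"
    have fin: "finite (suboptimal_arms K D)" by (simp add: suboptimal_arms_def)
    have "gap K D a = (\<Sum>i\<in>suboptimal_arms K D. gap K D i * of_bool (a = i))" if "a \<in> {1..K}" for a
    proof -
      have "arm_mean D a \<le> best_mean K D"
        unfolding best_mean_def using that by (intro Max_ge) auto
      then have "gap K D a = 0" if "a \<notin> suboptimal_arms K D"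
        using \<open>a \<in> {1..K}\<close> that by (auto simp: suboptimal_arms_def gap_def)
      then show ?thesis
        using fin by (cases "a \<in> suboptimal_arms K D") (auto simp: of_bool_def if_distrib sum.delta' cong: if_cong)
    qed
    then have "(\<integral>X. gap K D (arm (fst (traj y X t))) \<partial>table)
        = (\<integral>X. (\<Sum>i\<in>suboptimal_arms K D. gap K D i * of_bool (arm (fst (traj y X t)) = i)) \<partial>table)"
      using traj_arm by (intro Bochner_Integration.integral_cong) auto
    also have "\<dots> = (\<Sum>i\<in>suboptimal_arms K D.
        \<integral>X. gap K D i * of_bool (arm (fst (traj y X t)) = i) \<partial>table)"
    proof (rule Bochner_Integration.integral_sum)
      fix i
      have "(\<lambda>X. of_bool (arm (fst (traj y X t)) = i) :: real) \<in> borel_measurable table"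
        using t by (intro measurable_compose[OF traj_measurable]) auto
      then have "integrable table (\<lambda>X. of_bool (arm (fst (traj y X t)) = i) :: real)"
        by (rule integrable_table_bounded[where B = 1]) auto
      then show "integrable table (\<lambda>X. gap K D i * of_bool (arm (fst (traj y X t)) = i))" by simp
    qed
    finally show "(\<integral>X. gap K D (arm (fst (traj y X t))) \<partial>table)
        = (\<Sum>i\<in>suboptimal_arms K D. gap K D i * (\<integral>X. of_bool (arm (fst (traj y X t)) = i) \<partial>table))"
      by simp
  qed
  also have "\<dots> = (\<Sum>i\<in>suboptimal_arms K D. gap K D i * N i)"
    unfolding cost sum_distrib_left by (rule sum.swap)
  finally show ?thesis by (simp add: N_def)
qed

end

section \<open>Implementation on the word RAM\<close>

text \<open>The number of machine steps is left open, since only pulls count as time.\<close>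

definition leads :: "nat \<Rightarrow> program \<Rightarrow> outcome \<Rightarrow> config \<Rightarrow> (config \<Rightarrow> bool) \<Rightarrow> bool" where
  "leads b P \<omega> s Q \<longleftrightarrow> (\<exists>n. Q ((step b P \<omega> ^^ n) s))"

lemma leadsI: "Q ((step b P \<omega> ^^ n) s) \<Longrightarrow> leads b P \<omega> s Q"
  by (auto simp: leads_def)

lemma leads_trans:
  "leads b P \<omega> s Q \<Longrightarrow> (\<And>s'. Q s' \<Longrightarrow> leads b P \<omega> s' R) \<Longrightarrow> leads b P \<omega> s R"
  unfolding leads_def by (metis comp_apply funpow_add)

lemma take_bit_sub:
  fixes x y :: nat
  assumes "y \<le> x" "x < 2 ^ b" shows "take_bit b (x + 2 ^ b - y) = x - y"
proof -
  have "x + 2 ^ b - y = (x - y) + 2 ^ b" using assms by simp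
  then show ?thesis using assms by (simp only: take_bit_eq_mod mod_add_self2 mod_less)
qed

text \<open>The registers are: 0 and 1, the constants 0 and 1; 2, the leader; 3, its estimate; 4, \<^const>\<open>top\<close>;
  5, the round; 6, the tested arm (0 in a leader stage); 7, 8, 9, 10, the scale, multiplier,
  tolerance and length of the stage; 11, the arm to pull; 12 and 13, the sum and number of rewards
  in the stage; 14, the last reward or the average; 15, scratch.\<close>

definition prog :: "nat \<Rightarrow> nat \<Rightarrow> nat \<Rightarrow> program" where
  "prog K k0 l =
    [Const 1 1,
     Const 2 1,
     Const 6 0,
     Op Add 11 2 0,
     Op Add 7 5 0,
     Const 8 (128 * 16 ^ k0),
     Op Add 10 7 7,
     Op Shl 10 8 10,
     Const 12 0,
     Const 13 0,
     Pull 14 11,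
     Const 15 (48 * l),
     Op Shr 14 14 15,
     Op Add 12 12 14,
     Op Add 13 13 1,
     Jump_less 13 10 10,
     Op Div 14 12 10,
     Jump_less 0 6 20,
     Op Add 3 14 0,
     Jump_less 0 1 50,
     Op Add 15 14 9,
     Jump_less 15 3 32,
     Jump_less 7 4 36,
     Const 15 (128 * 16 ^ k0),
     Jump_less 8 15 43,
     Jump_less 7 5 38,
     Op Add 15 3 9,
     Jump_less 15 14 29,
     Jump_less 0 1 50,
     Op Add 2 6 0,
     Op Add 3 14 0,
     Jump_less 0 1 50,
     Jump_less 4 7 34,
     Jump_less 0 1 50,
     Op Add 4 7 0,
     Jump_less 0 1 50,
     Const 15 128,
     Op Sub 8 8 15,
     Op Add 7 7 1,
     Const 9 (2 ^ (16 * l)),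
     Op Shr 9 9 7,
     Op Shr 9 9 1,
     Jump_less 0 1 6,
     Const 15 16,
     Op Mul 8 8 15,
     Const 15 (2 ^ (16 * l)),
     Op Shr 15 15 7,
     Op Add 9 9 15,
     Op Shr 9 9 1,
     Jump_less 0 1 6,
     Const 15 K,
     Jump_less 6 15 54,
     Op Add 5 5 1,
     Jump_less 0 1 2,
     Op Add 6 6 1,
     Op Add 11 6 0,
     Const 7 0,
     Op Add 8 4 1,
     Const 15 128,
     Op Mul 8 8 15,
     Const 9 (2 ^ (16 * l - 1)),
     Jump_less 0 1 6]"

lemma length_prog: "length (prog K k0 l) = 62"
  by (simp add: prog_def)

lemma prog_nth:
  "prog K k0 l ! 0 = Const 1 1" "prog K k0 l ! 1 = Const 2 1" "prog K k0 l ! 2 = Const 6 0"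
  "prog K k0 l ! 3 = Op Add 11 2 0" "prog K k0 l ! 4 = Op Add 7 5 0"
  "prog K k0 l ! 5 = Const 8 (128 * 16 ^ k0)" "prog K k0 l ! 6 = Op Add 10 7 7"
  "prog K k0 l ! 7 = Op Shl 10 8 10" "prog K k0 l ! 8 = Const 12 0" "prog K k0 l ! 9 = Const 13 0"
  "prog K k0 l ! 10 = Pull 14 11" "prog K k0 l ! 11 = Const 15 (48 * l)"
  "prog K k0 l ! 12 = Op Shr 14 14 15" "prog K k0 l ! 13 = Op Add 12 12 14"
  "prog K k0 l ! 14 = Op Add 13 13 1" "prog K k0 l ! 15 = Jump_less 13 10 10"
  "prog K k0 l ! 16 = Op Div 14 12 10" "prog K k0 l ! 17 = Jump_less 0 6 20"
  "prog K k0 l ! 18 = Op Add 3 14 0" "prog K k0 l ! 19 = Jump_less 0 1 50"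
  "prog K k0 l ! 20 = Op Add 15 14 9" "prog K k0 l ! 21 = Jump_less 15 3 32"
  "prog K k0 l ! 22 = Jump_less 7 4 36" "prog K k0 l ! 23 = Const 15 (128 * 16 ^ k0)"
  "prog K k0 l ! 24 = Jump_less 8 15 43" "prog K k0 l ! 25 = Jump_less 7 5 38"
  "prog K k0 l ! 26 = Op Add 15 3 9" "prog K k0 l ! 27 = Jump_less 15 14 29"
  "prog K k0 l ! 28 = Jump_less 0 1 50" "prog K k0 l ! 29 = Op Add 2 6 0"
  "prog K k0 l ! 30 = Op Add 3 14 0" "prog K k0 l ! 31 = Jump_less 0 1 50"
  "prog K k0 l ! 32 = Jump_less 4 7 34" "prog K k0 l ! 33 = Jump_less 0 1 50"
  "prog K k0 l ! 34 = Op Add 4 7 0" "prog K k0 l ! 35 = Jump_less 0 1 50"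
  "prog K k0 l ! 36 = Const 15 128" "prog K k0 l ! 37 = Op Sub 8 8 15"
  "prog K k0 l ! 38 = Op Add 7 7 1" "prog K k0 l ! 39 = Const 9 (2 ^ (16 * l))"
  "prog K k0 l ! 40 = Op Shr 9 9 7" "prog K k0 l ! 41 = Op Shr 9 9 1"
  "prog K k0 l ! 42 = Jump_less 0 1 6" "prog K k0 l ! 43 = Const 15 16"
  "prog K k0 l ! 44 = Op Mul 8 8 15" "prog K k0 l ! 45 = Const 15 (2 ^ (16 * l))"
  "prog K k0 l ! 46 = Op Shr 15 15 7" "prog K k0 l ! 47 = Op Add 9 9 15"
  "prog K k0 l ! 48 = Op Shr 9 9 1" "prog K k0 l ! 49 = Jump_less 0 1 6"
  "prog K k0 l ! 50 = Const 15 K" "prog K k0 l ! 51 = Jump_less 6 15 54"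
  "prog K k0 l ! 52 = Op Add 5 5 1" "prog K k0 l ! 53 = Jump_less 0 1 2"
  "prog K k0 l ! 54 = Op Add 6 6 1" "prog K k0 l ! 55 = Op Add 11 6 0"
  "prog K k0 l ! 56 = Const 7 0" "prog K k0 l ! 57 = Op Add 8 4 1"
  "prog K k0 l ! 58 = Const 15 128" "prog K k0 l ! 59 = Op Mul 8 8 15"
  "prog K k0 l ! 60 = Const 9 (2 ^ (16 * l - 1))" "prog K k0 l ! 61 = Jump_less 0 1 6"
  by (simp_all add: prog_def)

text \<open>Bit budget in multiples of \<open>l\<close>: 16 for a rounded reward, 11 for a
  multiplier, 13 = 11 + 2 for a stage length, 29 = 13 + 16 for a sum of rewards. Words of
  \<open>64 * l\<close> bits therefore never overflow.\<close>

locale machine = scan K k0 "16 * l" for K k0 l :: nat +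
  fixes T :: nat
  assumes K_pos: "0 < K" and T_less: "T < 2 ^ l" and K_less: "K < 2 ^ l" and k0_le: "k0 \<le> l"
    and l_pos: "0 < l"
begin

abbreviation P :: program where "P \<equiv> prog K k0 l"
abbreviation b :: nat where "b \<equiv> 64 * l"

definition word :: "real \<Rightarrow> nat" where
  "word x = drop_bit (48 * l) (reward_word b x)"

text \<open>No register holds the phase. The program recovers it from the tested arm (0 for
  \<open>Lead\<close>) and by comparing the scale with J and the multiplier with its full value;
  \<open>Mid k0\<close> needs no distinction from \<open>High\<close>.\<close>

definition stage_mem :: "(nat \<Rightarrow> nat) \<Rightarrow> stage \<Rightarrow> bool" where
  "stage_mem m q \<longleftrightarrow> m 0 = 0 \<and> m 1 = 1 \<and> m 2 = leader q \<and> m 3 = mval q \<and> m 4 = top q \<and>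
     m 5 = rnd q \<and> m 6 = cur q \<and> m 7 = scale q \<and> m 8 = lam q \<and>
     (phase_of q \<noteq> Lead \<longrightarrow> m 9 = thr q) \<and> m 11 = arm q"

lemma small: "x < 2 ^ (40 * l) \<Longrightarrow> take_bit b x = x" for x :: nat
proof -
  assume "x < 2 ^ (40 * l)"
  also have "(2::nat) ^ (40 * l) \<le> 2 ^ b" by (intro power_increasing) auto
  finally show ?thesis by (simp add: take_bit_nat_eq_self)
qed

lemma power_le: "i \<le> j \<Longrightarrow> (2::nat) ^ (i * l) \<le> 2 ^ (j * l)"
  by (intro power_increasing) auto

lemma numeral_le: "(2::nat) ^ n \<le> 2 ^ (n * l)"
  using l_pos by (intro power_increasing) auto

lemma word_less: "word x < 2 ^ (16 * l)"
proof -
  have "reward_word b x < 2 ^ b" by (simp add: reward_word_def)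
  also have "(2::nat) ^ b = 2 ^ (16 * l) * 2 ^ (48 * l)" by (simp add: power_add[symmetric])
  finally show ?thesis by (simp add: word_def drop_bit_eq_div div_less_iff_less_mult)
qed

lemma rnd_le: assumes "on_time q t" "t \<le> T" shows "rnd q \<le> l"
proof (cases "rnd q")
  case (Suc s)
  have "(4::nat) ^ s \<le> 4 ^ rnd q" using Suc by simp
  then have "4 ^ s \<le> t" using assms(1) Suc by (auto simp: on_time_def split: if_splits)
  then have "(4::nat) ^ s < 2 ^ l" using assms(2) T_less by linarith
  then have "(2::nat) ^ (2 * s) < 2 ^ l" by (simp add: power_mult)
  then have "2 * s < l" by simp
  then show ?thesis using Suc by simp
qed simp

lemma thr_le: "thr q \<le> 2 ^ (16 * l)"
  unfolding thr_def
  by (auto split: phase.split intro: order_trans[OF diff_le_self] simp: div_le_dividend)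

lemma lam_le: assumes "wf q" "rnd q \<le> l" shows "lam q \<le> 2 ^ (11 * l)"
proof -
  have pow: "128 * (16::nat) ^ k \<le> 2 ^ (11 * l)" if "k \<le> k0" for k
  proof -
    have "(16::nat) ^ k = 2 ^ (4 * k)" by (simp add: power_mult)
    also have "\<dots> \<le> 2 ^ (4 * l)" using that k0_le by (intro power_increasing) auto
    finally have "128 * (16::nat) ^ k \<le> 2 ^ (7 * l) * 2 ^ (4 * l)"
      using numeral_le[of 7] by (intro mult_mono) auto
    then show ?thesis by (simp add: power_add[symmetric])
  qed
  have "128 * (1 + top q - g) \<le> 2 ^ (11 * l)" for g
  proof -
    have "1 + top q - g \<le> Suc l" using assms by (auto simp: wf_def)
    also have "Suc l \<le> 2 ^ l" by (rule Suc_leI) (rule less_exp)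
    finally have "128 * (1 + top q - g) \<le> 2 ^ (7 * l) * 2 ^ l"
      using numeral_le[of 7] by (intro mult_mono) auto
    also have "\<dots> \<le> 2 ^ (11 * l)" by (simp add: power_add[symmetric])
    finally show ?thesis .
  qed
  then show ?thesis using pow assms by (auto simp: lam_def wf_def split: phase.splits)
qed

lemma len_le: assumes "wf q" "rnd q \<le> l" shows "len q \<le> 2 ^ (13 * l)"
proof -
  have "scale q \<le> l" using wf_scale_le[OF assms(1)] assms(2) by simp
  then have "(4::nat) ^ scale q \<le> 4 ^ l" by (intro power_increasing) auto
  then have "len q \<le> 4 ^ l * 2 ^ (11 * l)"
    unfolding len_def using lam_le[OF assms] by (intro mult_mono) auto
  also have "\<dots> = 2 ^ (2 * l) * 2 ^ (11 * l)" by (simp add: power_mult)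
  finally show ?thesis by (simp add: power_add[symmetric])
qed

lemma small_le: "x \<le> 2 ^ (39 * l) \<Longrightarrow> take_bit b x = x" for x :: nat
  using l_pos by (intro small) (auto elim: order_le_less_trans intro!: power_strict_increasing)

lemma small_mult: "x \<le> 2 ^ (i * l) \<Longrightarrow> i \<le> 39 \<Longrightarrow> take_bit b x = x" for x :: nat
  by (rule small_le) (rule order_trans[OF _ power_le])

lemma index_le: "x \<le> l \<Longrightarrow> x \<le> 2 ^ l" for x :: nat
  using less_exp[of l] by linarith

lemma funpow_unroll:
  "(f ^^ 2) x = f (f x)" "(f ^^ 3) x = f (f (f x))" "(f ^^ 4) x = f (f (f (f x)))"
  "(f ^^ 5) x = f (f (f (f (f x))))" "(f ^^ 6) x = f (f (f (f (f (f x)))))"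
  "(f ^^ 7) x = f (f (f (f (f (f (f x))))))" "(f ^^ 8) x = f (f (f (f (f (f (f (f x)))))))"
  "(f ^^ 9) x = f (f (f (f (f (f (f (f (f x))))))))"
  "(f ^^ 10) x = f (f (f (f (f (f (f (f (f (f x)))))))))"
  by (simp_all add: numeral_eq_Suc)

lemmas run_simps = funpow_unroll step_def length_prog prog_nth prog_nth(2)[unfolded One_nat_def]
  set_reg_def numeral_2_eq_2[symmetric]

lemma multiplier_le: "128 * (16::nat) ^ k0 \<le> 2 ^ (11 * l)"
proof -
  have "(16::nat) ^ k0 = 2 ^ (4 * k0)" by (simp add: power_mult)
  also have "\<dots> \<le> 2 ^ (4 * l)" using k0_le by (intro power_increasing) auto
  finally have "128 * (16::nat) ^ k0 \<le> 2 ^ (7 * l) * 2 ^ (4 * l)"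
    using numeral_le[of 7] by (intro mult_mono) auto
  then show ?thesis by (simp add: power_add[symmetric])
qed

section \<open>Correctness of the program segments\<close>

lemma stage_entry:
  assumes "pc s = 6" "stage_mem (mem s) q" "wf q" "rnd q \<le> l"
  shows "leads b P \<omega> s (\<lambda>s'. pc s' = 10 \<and> pulls s' = pulls s \<and> stage_mem (mem s') q \<and>
     mem s' 10 = len q \<and> mem s' 12 = 0 \<and> mem s' 13 = 0)"
proof (rule leadsI[where n = 4])
  have "scale q \<le> l" using wf_scale_le assms by fastforce
  moreover have "l < 2 ^ l" by (rule less_exp)
  ultimately have "2 * scale q < 2 ^ l + 2 ^ l" by linarith
  also have "\<dots> = 2 ^ 1 * 2 ^ l" by simp
  also have "\<dots> \<le> 2 ^ (1 * l) * 2 ^ l" by (intro mult_right_mono numeral_le) auto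
  also have "\<dots> \<le> 2 ^ (40 * l)" by (simp add: power_add[symmetric])
  finally have 1: "take_bit b (scale q + scale q) = scale q + scale q" by (intro small) simp
  have "len q \<le> 2 ^ (13 * l)" using len_le assms by simp
  also have "\<dots> < 2 ^ (40 * l)" using l_pos by (intro power_strict_increasing) auto
  finally have 2: "take_bit b (push_bit (scale q + scale q) (lam q)) = len q"
    by (subst small) (auto simp: push_bit_eq_mult len_def power_add power_mult_distrib[symmetric] mult_ac)
  show "pc ((step b P \<omega> ^^ 4) s) = 10 \<and> pulls ((step b P \<omega> ^^ 4) s) = pulls s \<and>
    stage_mem (mem ((step b P \<omega> ^^ 4) s)) q \<and> mem ((step b P \<omega> ^^ 4) s) 10 = len q \<and>
    mem ((step b P \<omega> ^^ 4) s) 12 = 0 \<and> mem ((step b P \<omega> ^^ 4) s) 13 = 0"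
    using assms 1 2 by (simp add: run_simps stage_mem_def)
qed

lemma next_arm_entry:
  assumes pc: "pc s = 50" and m: "mem s 0 = 0" "mem s 1 = 1" "mem s 2 = a" "mem s 3 = v"
      "mem s 4 = J" "mem s 5 = r" "mem s 6 = c"
    and c: "c \<le> K" and J: "J \<le> l" and r: "r \<le> l" and a: "a \<le> K"
  shows "leads b P \<omega> s (\<lambda>s'. pc s' = 6 \<and> pulls s' = pulls s \<and> stage_mem (mem s') (next_arm a v J r c))"
proof -
  have K: "take_bit b K = K"
    using K_less by (intro small_mult[of _ 1]) simp_all
  have Sr: "take_bit b (Suc r) = Suc r" and SJ: "take_bit b (Suc J) = Suc J"
    and SJ': "take_bit b (128 + J * 128) = 128 + J * 128"
  proof -
    have "Suc x \<le> 2 ^ (1 * l) * 2 ^ (1 * l)" if "x \<le> l" for x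
    proof -
      have "Suc x \<le> 2 ^ l + 2 ^ l" using index_le[OF that] one_le_power[of "2::nat" l] by linarith
      also have "\<dots> = 2 ^ 1 * 2 ^ l" by simp
      also have "\<dots> \<le> 2 ^ (1 * l) * 2 ^ l" by (intro mult_right_mono numeral_le) auto
      finally show ?thesis by simp
    qed
    then have *: "Suc x \<le> 2 ^ (2 * l)" if "x \<le> l" for x
      using that by (simp add: power_add[symmetric] mult_2)
    show "take_bit b (Suc r) = Suc r" "take_bit b (Suc J) = Suc J"
      using *[OF r] *[OF J] by (intro small_mult[of _ 2]; simp)+
    have "128 * Suc J \<le> 2 ^ (7 * l) * 2 ^ (2 * l)"
      using *[OF J] numeral_le[of 7] by (intro mult_mono) auto
    then have "128 + J * 128 \<le> 2 ^ (9 * l)" by (simp add: power_add[symmetric])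
    then show "take_bit b (128 + J * 128) = 128 + J * 128"
      by (intro small_mult[of _ 9]) simp_all
  qed
  have c': "take_bit b (Suc c) = Suc c" if "c < K"
    using that K_less by (intro small_mult[of _ 1]) simp_all
  have k128: "take_bit b 128 = (128::nat)"
    using numeral_le[of 7] by (intro small_mult[of _ 7]) simp_all
  have a': "take_bit b a = a"
    using a K_less by (intro small_mult[of _ 1]) simp_all
  have r': "take_bit b r = r" using index_le[OF r] by (intro small_mult[of _ 1]) simp_all
  have half: "take_bit b (2 ^ (16 * l - 1)) = (2::nat) ^ (16 * l - 1)"
    by (intro small_le power_increasing) auto
  have half': "(2::nat) ^ (16 * l) div 2 = 2 ^ (16 * l - 1)"
    "(2::nat) ^ (16 * l) - 2 ^ (16 * l - 1) = 2 ^ (16 * l - 1)"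
  proof -
    obtain n where "16 * l = Suc n" using l_pos by (cases "16 * l") auto
    then show "(2::nat) ^ (16 * l) div 2 = 2 ^ (16 * l - 1)"
      "(2::nat) ^ (16 * l) - 2 ^ (16 * l - 1) = 2 ^ (16 * l - 1)"
      by (simp_all only: power_Suc diff_Suc_1)
  qed
  have L: "take_bit b (128 * 16 ^ k0) = (128 * 16 ^ k0 :: nat)"
    using multiplier_le by (intro small_mult[of _ 11]) simp_all
  show ?thesis
  proof (cases "c < K")
    case True
    note facts = True pc m K SJ SJ' c'[OF True] k128 half half'
    show ?thesis
    \<comment> \<open>\<open>Low 0\<close> and, for J = 0, \<open>Mid 0\<close> have the same scale
      0, multiplier 128 * (J + 1) and tolerance 1/2, so the program does not branch here.\<close>
    proof (cases "J = 0")
      case True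
      then show ?thesis using facts
        by (intro leadsI[where n = 10])
          (simp add: run_simps stage_mem_def next_arm_def test_phase_def scale_def lam_def thr_def arm_def)
    next
      case False
      then show ?thesis using facts
        by (intro leadsI[where n = 10])
          (simp add: run_simps stage_mem_def next_arm_def test_phase_def scale_def lam_def thr_def arm_def)
    qed
  next
    case False
    then have "c = K" using c by simp
    show ?thesis
      by (rule leadsI[where n = 8])
         (use \<open>c = K\<close> pc m K Sr a' L in
          \<open>simp add: run_simps stage_mem_def next_arm_def scale_def lam_def arm_def\<close>)
  qed
qed

lemma init_entry:
  "leads b P \<omega> init (\<lambda>s'. pc s' = 6 \<and> pulls s' = 0 \<and> stage_mem (mem s') (Stage 1 0 0 0 0 Lead))"
proof -
  have 1: "take_bit b 1 = (1::nat)" by (intro small_le) simp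
  have L: "take_bit b (128 * 16 ^ k0) = (128 * 16 ^ k0 :: nat)"
    using multiplier_le by (intro small_mult[of _ 11]) simp_all
  show ?thesis
    by (rule leadsI[where n = 6])
       (use 1 L in \<open>simp add: init_def run_simps stage_mem_def scale_def lam_def arm_def\<close>)
qed

definition in_stage :: "config \<Rightarrow> stage \<Rightarrow> nat \<Rightarrow> nat \<Rightarrow> bool" where
  "in_stage s q n u \<longleftrightarrow> pc s = 10 \<and> stage_mem (mem s) q \<and> mem s 10 = len q \<and> mem s 12 = u \<and> mem s 13 = n"

lemma pull_run:
  assumes s: "in_stage s q n u" and q: "wf q" "rnd q \<le> l" and n: "n < len q" "u + n \<le> n * 2 ^ (16 * l)"
  shows "leads b P \<omega> s (\<lambda>s'. pc s' = (if Suc n < len q then 10 else 16) \<and>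
     pulls s' = Suc (pulls s) \<and> stage_mem (mem s') q \<and> mem s' 10 = len q \<and>
     mem s' 12 = u + word (fst \<omega> (arm q, Suc (pulls s))) \<and> mem s' 13 = Suc n)"
proof -
  define x where "x = fst \<omega> (arm q, Suc (pulls s))"
  have len: "Suc n \<le> 2 ^ (13 * l)" using len_le[OF q] n by linarith
  have u: "u + word x \<le> 2 ^ (29 * l)"
  proof -
    have "u + word x \<le> Suc n * 2 ^ (16 * l)" using n(2) word_less[of x] by simp
    also have "\<dots> \<le> 2 ^ (13 * l) * 2 ^ (16 * l)" using len by (intro mult_right_mono) auto
    finally show ?thesis by (simp add: power_add[symmetric])
  qed
  have shift: "48 * l \<le> 2 ^ (7 * l)"
  proof -
    have "48 * l \<le> 2 ^ (6 * l) * 2 ^ l"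
      using numeral_le[of 6] index_le[of l] by (intro mult_mono) auto
    then show ?thesis by (simp add: power_add[symmetric])
  qed
  have tb: "take_bit b (48 * l) = 48 * l" "take_bit b (u + word x) = u + word x"
    "take_bit b (Suc n) = Suc n" "take_bit b (word x) = word x"
    using shift u len word_less[of x] less_imp_le[OF word_less[of x]]
    by (intro small_mult[of _ 7] small_mult[of _ 29] small_mult[of _ 13] small_mult[of _ 16]; simp)+
  have w: "drop_bit (48 * l) (reward_word b x) = word x" by (simp add: word_def)
  have m11: "mem s 11 = arm q" using s by (simp add: in_stage_def stage_mem_def)
  show ?thesis
    by (rule leadsI[where n = 6])
       (use s tb w m11 in \<open>simp add: run_simps stage_mem_def in_stage_def x_def[symmetric]\<close>)
qed

definition at_test :: "config \<Rightarrow> stage \<Rightarrow> nat \<Rightarrow> nat \<Rightarrow> bool" where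
  "at_test s q v t \<longleftrightarrow> stage_mem (mem s) q \<and> mem s 14 = v \<and> pulls s = t"

definition entered :: "stage \<Rightarrow> nat \<Rightarrow> config \<Rightarrow> bool" where
  "entered q t s \<longleftrightarrow> pc s = 6 \<and> pulls s = t \<and> stage_mem (mem s) q"

lemma to_next_arm:
  assumes "pc s = 50" "pulls s = t" "mem s 0 = 0" "mem s 1 = 1" "mem s 2 = a" "mem s 3 = v"
    "mem s 4 = J" "mem s 5 = r" "mem s 6 = c" "a \<le> K" "J \<le> l" "r \<le> l" "c \<le> K"
  shows "leads b P \<omega> s (entered (next_arm a v J r c) t)"
  using next_arm_entry[where s = s and a = a and v = v and J = J and r = r and c = c and \<omega> = \<omega>] assms
  by (simp add: entered_def[abs_def])

lemma average_run:
  assumes "pc s = 16" "stage_mem (mem s) q" "mem s 10 = len q" "mem s 12 = u"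
    and v: "u div len q < 2 ^ (16 * l)" and q: "wf q" "rnd q \<le> l"
  shows "phase_of q \<noteq> Lead \<Longrightarrow> leads b P \<omega> s (\<lambda>s'. pc s' = 20 \<and> at_test s' q (u div len q) (pulls s))"
    "phase_of q = Lead \<Longrightarrow> leads b P \<omega> s (entered (adv q (u div len q)) (pulls s))"
proof -
  have tb: "take_bit b (u div len q) = u div len q"
    using v by (intro small_mult[of _ 16]) simp_all
  show "leads b P \<omega> s (\<lambda>s'. pc s' = 20 \<and> at_test s' q (u div len q) (pulls s))" if "phase_of q \<noteq> Lead"
  proof -
    have "0 < cur q" using that q by (simp add: wf_def)
    then show ?thesis
      by (intro leadsI[where n = 2])
         (use assms(1-4) tb in \<open>simp add: run_simps stage_mem_def at_test_def\<close>)
  qed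
  assume L: "phase_of q = Lead"
  then have c: "cur q = 0" using q by (simp add: wf_def)
  have "leads b P \<omega> s (\<lambda>s'. pc s' = 50 \<and> pulls s' = pulls s \<and> mem s' 0 = 0 \<and> mem s' 1 = 1 \<and>
      mem s' 2 = leader q \<and> mem s' 3 = u div len q \<and> mem s' 4 = top q \<and> mem s' 5 = rnd q \<and> mem s' 6 = 0)"
    by (rule leadsI[where n = 4])
       (use assms(1-4) tb c in \<open>simp add: run_simps stage_mem_def at_test_def\<close>)
  then show "leads b P \<omega> s (entered (adv q (u div len q)) (pulls s))"
  proof (rule leads_trans, elim conjE)
    fix s' :: config assume s': "pc s' = 50" "pulls s' = pulls s" "mem s' 0 = 0" "mem s' 1 = 1"
      "mem s' 2 = leader q" "mem s' 3 = u div len q" "mem s' 4 = top q" "mem s' 5 = rnd q" "mem s' 6 = 0"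
    have "leader q \<le> K" "top q \<le> l" using q by (auto simp: wf_def)
    then show "leads b P \<omega> s' (entered (adv q (u div len q)) (pulls s))"
      using L s' q unfolding adv_def by (auto intro!: to_next_arm)
  qed
qed

lemma thr_small: assumes "v < 2 ^ (16 * l)" shows "take_bit b (v + thr q) = v + thr q"
proof -
  have "v + thr q \<le> 2 ^ 1 * 2 ^ (16 * l)" using assms thr_le[of q] by simp
  also have "\<dots> \<le> 2 ^ (1 * l) * 2 ^ (16 * l)" by (intro mult_right_mono numeral_le) auto
  finally show ?thesis by (intro small_mult[of _ 17]) (simp_all add: power_add[symmetric])
qed

lemma test_run:
  assumes s: "pc s = 20" "at_test s q v t" and v: "v < 2 ^ (16 * l)" and q: "wf q" "rnd q \<le> l" "phase_of q \<noteq> Lead"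
  shows "leads b P \<omega> s (\<lambda>s'. (if v + thr q < mval q then pc s' = 32 else pc s' = 22) \<and> at_test s' q v t)"
  by (rule leadsI[where n = 2])
     (use s q thr_small[OF v, of q] in \<open>simp add: run_simps stage_mem_def at_test_def\<close>)

lemma reject_run:
  assumes s: "pc s = 32" "at_test s q v t" and q: "wf q" "rnd q \<le> l" "phase_of q \<noteq> Lead"
  shows "leads b P \<omega> s (entered (next_arm (leader q) (mval q) (max (top q) (scale q)) (rnd q) (cur q)) t)"
proof -
  have sc: "scale q \<le> l" "top q \<le> l" "cur q \<le> K" "leader q \<le> K"
    using q wf_scale_le[OF q(1)] by (auto simp: wf_def)
  have tb: "take_bit b (scale q) = scale q" using index_le[OF sc(1)] by (intro small_mult[of _ 1]) simp_all
  have "leads b P \<omega> s (\<lambda>s'. pc s' = 50 \<and> pulls s' = t \<and> mem s' 0 = 0 \<and> mem s' 1 = 1 \<and>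
      mem s' 2 = leader q \<and> mem s' 3 = mval q \<and> mem s' 4 = max (top q) (scale q) \<and>
      mem s' 5 = rnd q \<and> mem s' 6 = cur q)"
  proof (cases "top q < scale q")
    case True
    then show ?thesis
      by (intro leadsI[where n = 3])
         (use s q tb in \<open>simp add: run_simps stage_mem_def at_test_def\<close>)
  next
    case False
    then show ?thesis
      by (intro leadsI[where n = 2])
         (use s q tb in \<open>simp add: run_simps stage_mem_def at_test_def\<close>)
  qed
  then show ?thesis
    by (rule leads_trans) (use sc q in \<open>auto intro!: to_next_arm\<close>)
qed

lemma tb_consts:
  "take_bit b (2 ^ (16 * l)) = (2 ^ (16 * l) :: nat)"
  "take_bit b (128 * 16 ^ k0) = (128 * 16 ^ k0 :: nat)"
  "take_bit b 128 = (128 :: nat)" "take_bit b 16 = (16 :: nat)"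
  "take_bit b (drop_bit x (2 ^ (16 * l))) = (2 ^ (16 * l) div 2 ^ x :: nat)"
  "take_bit b (drop_bit (Suc 0) (2 ^ (16 * l) div 2 ^ x)) = (2 ^ (16 * l) div 2 ^ Suc x :: nat)"
proof -
  show "take_bit b (2 ^ (16 * l)) = (2 ^ (16 * l) :: nat)" by (intro small_mult[of _ 16]) simp_all
  show "take_bit b (128 * 16 ^ k0) = (128 * 16 ^ k0 :: nat)"
    using multiplier_le by (intro small_mult[of _ 11]) simp_all
  show "take_bit b 128 = (128 :: nat)" using numeral_le[of 7] by (intro small_mult[of _ 7]) simp_all
  show "take_bit b 16 = (16 :: nat)" using numeral_le[of 4] by (intro small_mult[of _ 4]) simp_all
  have le: "2 ^ (16 * l) div 2 ^ x \<le> (2 ^ (16 * l) :: nat)" for x by (rule div_le_dividend)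
  show "take_bit b (drop_bit x (2 ^ (16 * l))) = (2 ^ (16 * l) div 2 ^ x :: nat)"
    using le[of x] by (subst small_mult[of _ 16]) (simp_all add: drop_bit_eq_div)
  have "drop_bit (Suc 0) (2 ^ (16 * l) div 2 ^ x) = (2 ^ (16 * l) div 2 ^ Suc x :: nat)"
    by (simp add: drop_bit_eq_div div_mult2_eq[symmetric] mult.commute)
  then show "take_bit b (drop_bit (Suc 0) (2 ^ (16 * l) div 2 ^ x)) = (2 ^ (16 * l) div 2 ^ Suc x :: nat)"
    using le[of "Suc x"] by (simp add: small_mult[of _ 16] del: power_Suc)
qed

lemma tb_add:
  fixes x y :: nat
  assumes "x \<le> 2 ^ (16 * l)" "y \<le> 2 ^ (16 * l)" shows "take_bit b (x + y) = x + y"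
proof -
  have "x + y \<le> 2 ^ 1 * 2 ^ (16 * l)" using assms by simp
  also have "\<dots> \<le> 2 ^ (1 * l) * 2 ^ (16 * l)" by (intro mult_right_mono numeral_le) auto
  finally show ?thesis by (intro small_mult[of _ 17]) (simp_all add: power_add[symmetric])
qed

lemma half_split:
  assumes "j < 16 * l"
  shows "2 ^ (16 * l) div 2 ^ j - 2 ^ (16 * l) div 2 ^ Suc j = (2 ^ (16 * l) div 2 ^ Suc j :: nat)"
proof -
  have "(2::nat) ^ (16 * l) div 2 ^ j = 2 ^ (16 * l - j)"
    "(2::nat) ^ (16 * l) div 2 ^ Suc j = 2 ^ (16 * l - Suc j)"
    using assms by (simp_all only: power_diff_power_eq) simp_all
  moreover have "16 * l - j = Suc (16 * l - Suc j)" using assms by simp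
  ultimately show ?thesis by simp
qed

text \<open>Both successors are produced by the same code: subtracting 128 from the multiplier of
  the last \<open>Low\<close> phase leaves 128, and the tolerance of \<open>Mid 0\<close> is the one
  of a \<open>Low\<close> phase at scale J, by \<open>half_split\<close>.\<close>

lemma low_run:
  assumes s: "pc s = 22" "at_test s q v t" and q: "wf q" "rnd q \<le> l" "phase_of q = Low g"
  shows "leads b P \<omega> s (entered (pass q v) t)"
proof -
  have g: "g < top q" "top q \<le> l" "scale q = g" using q by (auto simp: wf_def scale_def)
  have lam: "lam q = 128 * (1 + top q - g)" using q by (simp add: lam_def)
  have "take_bit b (lam q + 2 ^ b - 128) = lam q - 128"
  proof (rule take_bit_sub)
    show "128 \<le> lam q" using lam g by simp
    have "lam q \<le> 2 ^ (11 * l)" by (rule lam_le[OF q(1,2)])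
    also have "(2::nat) ^ (11 * l) < 2 ^ b" using l_pos by (intro power_strict_increasing) auto
    finally show "lam q < 2 ^ b" .
  qed
  moreover have "take_bit b (Suc g) = Suc g"
    using index_le[of "Suc g"] g by (intro small_mult[of _ 1]) simp_all
  moreover have "lam (pass q v) = lam q - 128 \<and> scale (pass q v) = Suc g \<and>
    thr (pass q v) = 2 ^ (16 * l) div 2 ^ Suc (Suc g)"
  proof (cases "Suc g < top q")
    case True
    then show ?thesis using q(3) by (simp add: pass_def lam_def scale_def thr_def del: power_Suc)
  next
    case False
    then have top: "top q = Suc g" using g by simp
    have "Suc g < 16 * l" using g l_pos by linarith
    from half_split[OF this] show ?thesis
      using q(3) top by (simp add: pass_def lam_def scale_def thr_def del: power_Suc)
  qed
  moreover have "leader (pass q v) = leader q" "mval (pass q v) = mval q" "top (pass q v) = top q"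
     "rnd (pass q v) = rnd q" "cur (pass q v) = cur q" "phase_of (pass q v) \<noteq> Lead" "arm (pass q v) = cur q"
    using q by (auto simp: pass_def arm_def)
  moreover have "arm q = cur q" using q by (simp add: arm_def)
  ultimately show ?thesis
    by (intro leadsI[where n = 8])
       (use s g(1,3) tb_consts in \<open>simp add: run_simps stage_mem_def at_test_def entered_def del: power_Suc\<close>)
qed

text \<open>Averaging the tolerance with 2^-J halves its distance from 2^-J, which is the passage
  from \<open>k\<close> to k + 1.\<close>

lemma mid_run:
  assumes s: "pc s = 22" "at_test s q v t" and q: "wf q" "rnd q \<le> l" "phase_of q = Mid k" and k: "k < k0"
  shows "leads b P \<omega> s (entered (pass q v) t)"
proof -
  have g: "top q \<le> l" "scale q = top q" using q by (auto simp: wf_def scale_def)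
  have lam: "lam q = 128 * 16 ^ k" "lam q < 128 * 16 ^ k0" using q k by (simp_all add: lam_def)
  have p: "pass q v = set_phase q (Mid (Suc k))" using q k by (simp add: pass_def)
  have lam': "lam (pass q v) = lam q * 16" unfolding p by (simp add: lam_def q(3))
  have "wf (pass q v)" using q k p by (simp add: wf_def)
  then have "lam (pass q v) \<le> 2 ^ (11 * l)" using q p by (intro lam_le) simp_all
  then have tl: "take_bit b (lam q * 16) = lam q * 16"
    unfolding lam' by (intro small_mult[of _ 11]) simp_all
  define j where "j = top q + k + 1"
  have j: "Suc j \<le> 16 * l" using g k k0_le l_pos by (simp add: j_def)
  define M where "M = (2::nat) ^ (16 * l)"
  have t1: "thr q = M div 2 ^ top q - M div 2 ^ j"
    using q by (simp add: thr_def M_def j_def)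
  have t2: "thr (pass q v) = M div 2 ^ top q - M div 2 ^ Suc j"
    unfolding p by (simp add: thr_def M_def j_def)
  have le: "M div 2 ^ j \<le> M div 2 ^ top q"
    by (intro div_le_mono2 power_increasing) (auto simp: j_def)
  have dbl: "M div 2 ^ j = 2 * (M div 2 ^ Suc j)" using half_split[of j] j by (simp add: M_def)
  have tt: "take_bit b (thr q + M div 2 ^ top q) = thr q + M div 2 ^ top q"
    using thr_le[of q] div_le_dividend[of M "2 ^ top q"] by (intro tb_add) (simp_all add: M_def)
  have "(thr q + M div 2 ^ top q) div 2 = thr (pass q v)"
    unfolding t1 t2 using le dbl by simp
  moreover have "take_bit b (thr (pass q v)) = thr (pass q v)"
    using thr_le by (rule small_mult) simp
  ultimately have d: "take_bit b (drop_bit (Suc 0) (thr q + M div 2 ^ top q)) = thr (pass q v)"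
    by (simp add: drop_bit_eq_div)
  have sel: "leader (pass q v) = leader q" "mval (pass q v) = mval q" "top (pass q v) = top q"
     "rnd (pass q v) = rnd q" "cur (pass q v) = cur q" "phase_of (pass q v) \<noteq> Lead"
     "arm (pass q v) = cur q" "scale (pass q v) = top q" "arm q = cur q" "phase_of q \<noteq> Lead"
    unfolding p by (simp_all add: arm_def scale_def q(3))
  show ?thesis
    by (intro leadsI[where n = 10])
       (use s g lam(2) lam' tl tt d sel tb_consts in
         \<open>simp add: run_simps stage_mem_def at_test_def entered_def M_def[symmetric] del: power_Suc\<close>)
qed

text \<open>Stated for any full-multiplier stage at scale J or finer, so that it covers the passage
  out of \<open>Mid k0\<close> as well as the one out of \<open>High g\<close>.\<close>

lemma high_run:
  assumes s: "pc s = 22" "at_test s q v t" and q: "wf q" "rnd q \<le> l"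
    and full: "lam q = 128 * 16 ^ k0" "top q \<le> scale q" "phase_of q \<noteq> Lead" and less: "scale q < rnd q"
    and p: "pass q v = set_phase q (High (Suc (scale q)))"
  shows "leads b P \<omega> s (entered (pass q v) t)"
proof -
  have tb: "take_bit b (Suc (scale q)) = Suc (scale q)"
    using index_le[of "Suc (scale q)"] less q by (intro small_mult[of _ 1]) simp_all
  have sel: "leader (pass q v) = leader q" "mval (pass q v) = mval q" "top (pass q v) = top q"
     "rnd (pass q v) = rnd q" "cur (pass q v) = cur q" "phase_of (pass q v) \<noteq> Lead"
     "arm (pass q v) = cur q" "scale (pass q v) = Suc (scale q)" "arm q = cur q"
     "lam (pass q v) = lam q" "thr (pass q v) = 2 ^ (16 * l) div 2 ^ Suc (Suc (scale q))"
    unfolding p using full by (simp_all add: arm_def scale_def lam_def thr_def)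
  show ?thesis
    by (intro leadsI[where n = 9])
       (use s full less tb sel tb_consts in
         \<open>simp add: run_simps stage_mem_def at_test_def entered_def del: power_Suc\<close>)
qed

lemma finish_run:
  assumes s: "pc s = 22" "at_test s q v t" and q: "wf q" "rnd q \<le> l" and v: "v < 2 ^ (16 * l)"
    and full: "lam q = 128 * 16 ^ k0" "top q \<le> scale q" "phase_of q \<noteq> Lead" and ge: "\<not> scale q < rnd q"
    and p: "pass q v = finish q v"
  shows "leads b P \<omega> s (entered (pass q v) t)"
proof -
  have K: "top q \<le> l" "cur q \<le> K" "leader q \<le> K" "mval q < 2 ^ (16 * l)" using q by (auto simp: wf_def)
  have tb: "take_bit b (mval q + thr q) = mval q + thr q" using thr_small[OF K(4)] .
  have tv: "take_bit b v = v" using v by (intro small_mult[of _ 16]) simp_all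
  have tc: "take_bit b (cur q) = cur q" using K K_less by (intro small_mult[of _ 1]) simp_all
  define a w where "a = (if mval q + thr q < v then cur q else leader q)"
    and "w = (if mval q + thr q < v then v else mval q)"
  have "leads b P \<omega> s (\<lambda>s'. pc s' = 50 \<and> pulls s' = t \<and> mem s' 0 = 0 \<and> mem s' 1 = 1 \<and>
      mem s' 2 = a \<and> mem s' 3 = w \<and> mem s' 4 = top q \<and> mem s' 5 = rnd q \<and> mem s' 6 = cur q)"
  proof (cases "mval q + thr q < v")
    case True
    then show ?thesis
      by (intro leadsI[where n = 9])
         (use s full ge tb tv tc tb_consts in \<open>simp add: run_simps stage_mem_def at_test_def a_def w_def\<close>)
  next
    case False
    then show ?thesis
      by (intro leadsI[where n = 7])
         (use s full ge tb tv tc tb_consts in \<open>simp add: run_simps stage_mem_def at_test_def a_def w_def\<close>)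
  qed
  moreover have "pass q v = next_arm a w (top q) (rnd q) (cur q)"
    by (simp add: p finish_def a_def w_def)
  moreover have "a \<le> K" using K by (simp add: a_def)
  ultimately show ?thesis
    using K q by (auto elim!: leads_trans intro!: to_next_arm)
qed

lemma pass_run:
  assumes s: "pc s = 22" "at_test s q v t" and q: "wf q" "rnd q \<le> l" "phase_of q \<noteq> Lead"
    and v: "v < 2 ^ (16 * l)"
  shows "leads b P \<omega> s (entered (pass q v) t)"
proof (cases "phase_of q")
  case (Low g)
  then show ?thesis using low_run[OF s q(1,2)] by simp
next
  case (Mid k)
  then have k: "k \<le> k0" "top q \<le> rnd q" using q by (auto simp: wf_def)
  consider "k < k0" | "k = k0" "top q < rnd q" | "k = k0" "\<not> top q < rnd q" using k by linarith
  then show ?thesis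
  proof cases
    case 1
    then show ?thesis using mid_run[OF s q(1,2) Mid] by simp
  next
    case 2
    then show ?thesis using Mid
      by (intro high_run[OF s q(1,2)]) (auto simp: lam_def scale_def pass_def)
  next
    case 3
    then show ?thesis using Mid v
      by (intro finish_run[OF s q(1,2)]) (auto simp: lam_def scale_def pass_def)
  qed
next
  case (High g)
  then have g: "top q < g" using q by (simp add: wf_def)
  show ?thesis
  proof (cases "g < rnd q")
    case True
    then show ?thesis using High g
      by (intro high_run[OF s q(1,2)]) (auto simp: lam_def scale_def pass_def)
  next
    case False
    then show ?thesis using High g v
      by (intro finish_run[OF s q(1,2)]) (auto simp: lam_def scale_def pass_def)
  qed
qed (use q in simp)

lemma stage_run:
  assumes "pc s = 16" "stage_mem (mem s) q" "mem s 10 = len q" "mem s 12 = u"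
    and v: "u div len q < 2 ^ (16 * l)" and q: "wf q" "rnd q \<le> l"
  shows "leads b P \<omega> s (entered (adv q (u div len q)) (pulls s))"
proof (cases "phase_of q = Lead")
  case True
  then show ?thesis using average_run(2)[OF assms] by simp
next
  case False
  define t where "t = pulls s"
  have "leads b P \<omega> s (\<lambda>s'. pc s' = 20 \<and> at_test s' q (u div len q) t)"
    using average_run(1)[OF assms False] by (simp add: t_def)
  then have "leads b P \<omega> s (entered (adv q (u div len q)) t)"
  proof (rule leads_trans, elim conjE)
    fix s' :: config assume s': "pc s' = 20" "at_test s' q (u div len q) t"
    from test_run[OF s' v q False]
    show "leads b P \<omega> s' (entered (adv q (u div len q)) t)"
    proof (rule leads_trans, elim conjE)
      fix s'' :: config
      assume s'': "if u div len q + thr q < mval q then pc s'' = 32 else pc s'' = 22"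
        "at_test s'' q (u div len q) t"
      show "leads b P \<omega> s'' (entered (adv q (u div len q)) t)"
        using reject_run[OF _ s''(2) q False] pass_run[OF _ s''(2) q False v] s''(1) False
        by (auto simp: adv_def split: if_splits)
    qed
  qed
  then show ?thesis by (simp add: t_def)
qed

text \<open>The simulation is anchored just before a pull, where register 11 shows the arm about to
  be played.\<close>

lemma run_traj:
  assumes "t \<le> T"
  shows "leads b P \<omega> init (\<lambda>s. pulls s = t \<and>
    (case traj word (fst \<omega>) t of (q, n, u) \<Rightarrow> in_stage s q n u))"
  using assms
proof (induction t)
  case 0
  have "leads b P \<omega> init (\<lambda>s'. pc s' = 6 \<and> pulls s' = 0 \<and> stage_mem (mem s') (Stage 1 0 0 0 0 Lead))"
    by (rule init_entry)
  then show ?case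
  proof (rule leads_trans, elim conjE)
    fix s :: config assume s: "pc s = 6" "pulls s = 0" "stage_mem (mem s) (Stage 1 0 0 0 0 Lead)"
    have "wf (Stage 1 0 0 0 0 Lead)" using K_pos by (simp add: wf_def)
    from stage_entry[OF s(1,3) this, of \<omega>] s(2)
    show "leads b P \<omega> s (\<lambda>s. pulls s = 0 \<and>
        (case traj word (fst \<omega>) 0 of (q, n, u) \<Rightarrow> in_stage s q n u))"
      by (simp add: start_def in_stage_def conj_ac)
  qed
next
  case (Suc t)
  obtain q n u where tr: "traj word (fst \<omega>) t = (q, n, u)" by (cases "traj word (fst \<omega>) t")
  define y where "y = word (fst \<omega> (arm q, Suc t))"
  have tr': "traj word (fst \<omega>) (Suc t) = nxt (q, n, u) y" by (simp add: tr y_def)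
  have inv: "wf q" "on_time q t" "n < len q" "u + n \<le> n * 2 ^ (16 * l)"
    using traj_wf[where y = word, OF K_pos word_less tr] by auto
  have rnd: "rnd q \<le> l" using rnd_le[OF inv(2)] Suc.prems by simp
  have "leads b P \<omega> init (\<lambda>s. pulls s = t \<and> in_stage s q n u)"
    using Suc.IH Suc.prems tr by simp
  then show ?case
  proof (rule leads_trans, elim conjE)
    fix s assume s: "pulls s = t" "in_stage s q n u"
    from pull_run[OF s(2) inv(1) rnd inv(3,4)]
    show "leads b P \<omega> s (\<lambda>s. pulls s = Suc t \<and>
        (case traj word (fst \<omega>) (Suc t) of (q, n, u) \<Rightarrow> in_stage s q n u))"
    proof (rule leads_trans, elim conjE)
      fix s' :: config
      assume s': "pc s' = (if Suc n < len q then 10 else 16)" "pulls s' = Suc (pulls s)"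
        "stage_mem (mem s') q" "mem s' 10 = len q"
        "mem s' 12 = u + word (fst \<omega> (arm q, Suc (pulls s)))" "mem s' 13 = Suc n"
      have y: "mem s' 12 = u + y" using s' s by (simp add: y_def)
      show "leads b P \<omega> s' (\<lambda>s. pulls s = Suc t \<and>
          (case traj word (fst \<omega>) (Suc t) of (q, n, u) \<Rightarrow> in_stage s q n u))"
      proof (cases "Suc n < len q")
        case True
        then show ?thesis
          using s' y s unfolding tr' by (intro leadsI[where n = 0]) (simp add: nxt_def in_stage_def)
      next
        case False
        then have adv: "nxt (q, n, u) y = (adv q ((u + y) div len q), 0, 0)" by (simp add: nxt_def)
        have inv': "wf (adv q ((u + y) div len q))" "on_time (adv q ((u + y) div len q)) (Suc t)"
          using traj_wf[where y = word, OF K_pos word_less tr'[unfolded adv]] by auto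
        have rnd': "rnd (adv q ((u + y) div len q)) \<le> l" using rnd_le[OF inv'(2)] Suc.prems by simp
        have len: "len q = Suc n" using False inv by simp
        have "u + y < Suc n * 2 ^ (16 * l)"
          using inv(4) word_less[of "fst \<omega> (arm q, Suc t)"] by (simp add: y_def)
        then have v: "(u + y) div len q < 2 ^ (16 * l)"
          unfolding len by (subst div_less_iff_less_mult) (auto simp: mult.commute)
        have pc: "pc s' = 16" using s' False by simp
        from stage_run[OF pc s'(3,4) y v inv(1) rnd]
        show ?thesis
        proof (rule leads_trans)
          fix s'' assume "entered (adv q ((u + y) div len q)) (pulls s') s''"
          then have s'': "pc s'' = 6" "pulls s'' = Suc t" "stage_mem (mem s'') (adv q ((u + y) div len q))"
            using s' s by (auto simp: entered_def)
          from stage_entry[OF s''(1,3) inv'(1) rnd', of \<omega>] s''(2)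
          show "leads b P \<omega> s'' (\<lambda>s. pulls s = Suc t \<and>
              (case traj word (fst \<omega>) (Suc t) of (q, n, u) \<Rightarrow> in_stage s q n u))"
            unfolding tr' adv by (simp add: in_stage_def conj_ac)
        qed
      qed
    qed
  qed
qed

lemma pulls_mono: "m \<le> n \<Longrightarrow> pulls (run b' P' \<omega> m) \<le> pulls (run b' P' \<omega> n)"
proof (rule lift_Suc_mono_le[of "\<lambda>n. pulls (run b' P' \<omega> n)"])
  fix n
  show "pulls (run b' P' \<omega> n) \<le> pulls (run b' P' \<omega> (Suc n))"
    by (cases "P' ! pc (run b' P' \<omega> n)") (auto simp: run_def step_def set_reg_def)
qed

text \<open>The pull counter never decreases and every pull raises it, so two pulls with the same
  number happen at the same machine step.\<close>

lemma plays_unique: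
  assumes "plays b' P' \<omega> t i" "plays b' P' \<omega> t j" shows "i = j"
proof -
  have inc: "Suc (pulls (run b' P' \<omega> n)) = t \<Longrightarrow> pulls (run b' P' \<omega> (Suc n)) = t"
    if "pc (run b' P' \<omega> n) < length P'" "P' ! pc (run b' P' \<omega> n) = Pull r x" for n r x
    using that by (simp add: run_def step_def set_reg_def)
  obtain m r x where m: "pc (run b' P' \<omega> m) < length P'" "P' ! pc (run b' P' \<omega> m) = Pull r x"
    "Suc (pulls (run b' P' \<omega> m)) = t" "mem (run b' P' \<omega> m) x = i"
    using assms(1) by (auto simp: plays_def Let_def)
  obtain n r' x' where n: "pc (run b' P' \<omega> n) < length P'" "P' ! pc (run b' P' \<omega> n) = Pull r' x'"
    "Suc (pulls (run b' P' \<omega> n)) = t" "mem (run b' P' \<omega> n) x' = j"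
    using assms(2) by (auto simp: plays_def Let_def)
  have "\<not> m < n" using pulls_mono[of "Suc m" n b' P' \<omega>] inc[OF m(1,2,3)] n(3) by auto
  moreover have "\<not> n < m" using pulls_mono[of "Suc n" m b' P' \<omega>] inc[OF n(1,2,3)] m(3) by auto
  ultimately have "m = n" by simp
  then show ?thesis using m n by auto
qed

lemma plays_traj:
  assumes "t < T" shows "plays b P \<omega> (Suc t) (arm (fst (traj word (fst \<omega>) t)))"
proof -
  obtain q n u where tr: "traj word (fst \<omega>) t = (q, n, u)" by (cases "traj word (fst \<omega>) t")
  have "leads b P \<omega> init (\<lambda>s. pulls s = t \<and> in_stage s q n u)"
    using run_traj[of t \<omega>] assms tr by simp
  then obtain m where m: "pulls (run b P \<omega> m) = t" "in_stage (run b P \<omega> m) q n u"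
    by (auto simp: leads_def run_def)
  then have "pc (run b P \<omega> m) = 10" "mem (run b P \<omega> m) 11 = arm q"
    by (auto simp: in_stage_def stage_mem_def)
  then show ?thesis
    unfolding plays_def Let_def using m(1)
    by (intro exI[of _ m] exI[of _ 14] exI[of _ 11]) (simp add: length_prog prog_nth tr)
qed

lemma chosen_arm_traj:
  assumes "t \<in> {1..T}" shows "chosen_arm b P \<omega> t = arm (fst (traj word (fst \<omega>) (t - 1)))"
  unfolding chosen_arm_def
proof (rule the_equality)
  show *: "plays b P \<omega> t (arm (fst (traj word (fst \<omega>) (t - 1))))"
    using plays_traj[of "t - 1" \<omega>] assms by (cases t) auto
  show "i = arm (fst (traj word (fst \<omega>) (t - 1)))" if "plays b P \<omega> t i" for i
    using plays_unique[OF that *] .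
qed

end

section \<open>Choice of the parameters\<close>

text \<open>Dropping the low bits loses less than one unit of 2^-(16 l); the floor and the factor
  2^b - 1 in place of 2^b are covered by two more.\<close>

lemma word_approx:
  assumes x: "x \<in> {0..1}" and l: "0 < l"
  shows "\<bar>real (drop_bit (48 * l) (reward_word (64 * l) x)) / 2 ^ (16 * l) - x\<bar> \<le> 3 / 2 ^ (16 * l)"
proof -
  define B S M :: real where "B = 2 ^ (64 * l)" "S = 2 ^ (48 * l)" "M = 2 ^ (16 * l)"
  define r where "r = nat \<lfloor>x * (2 ^ (64 * l) - 1)\<rfloor>"
  have pos: "1 \<le> B" "1 \<le> S" "0 < M" "B = S * M"
    by (simp_all add: B_S_M_def power_add[symmetric])
  have rr: "real r \<le> x * (B - 1)" "x * (B - 1) < real r + 1"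
    using x pos unfolding r_def B_S_M_def by (auto simp: of_nat_nat)
  have "real r \<le> 1 * (B - 1)" using rr(1) x pos by (intro order_trans[OF rr(1)] mult_right_mono) auto
  then have "real r < B" unfolding mult_1 by linarith
  then have "real r < real (2 ^ (64 * l))" by (simp add: B_S_M_def)
  then have "r < 2 ^ (64 * l)" by (simp only: of_nat_less_iff)
  then have rw: "reward_word (64 * l) x = r"
    by (simp add: reward_word_def r_def[symmetric] take_bit_nat_eq_self)
  define d where "d = r div 2 ^ (48 * l)"
  have "real (d * 2 ^ (48 * l)) \<le> real r" unfolding d_def of_nat_le_iff by simp
  then have d1: "real d * S \<le> real r" by (simp add: B_S_M_def)
  have "r < Suc d * 2 ^ (48 * l)" using dividend_less_div_times[of "2 ^ (48 * l)" r] by (simp add: d_def)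
  then have "real r < real (Suc d * 2 ^ (48 * l))" by (simp only: of_nat_less_iff)
  then have d2: "real r < (real d + 1) * S" by (simp add: B_S_M_def algebra_simps)
  have "x * (B - 1) \<le> x * B" using x by (intro mult_left_mono) auto
  then have "real d * S \<le> x * B" using d1 rr(1) by linarith
  then have "real d * S \<le> (x * M) * S" by (simp add: pos(4) mult_ac)
  then have up: "real d \<le> x * M" by (rule mult_right_le_imp_le) (use pos(2) in linarith)
  have "x * M * S = x * (B - 1) + x" by (simp add: pos(4) algebra_simps)
  then have "x * M * S < (real d + 1) * S + 1 + x" using d2 rr(2) by linarith
  also have "\<dots> \<le> (real d + 1) * S + 2 * S" using x pos(2) by simp
  finally have "x * M * S < (real d + 3) * S" by (simp add: algebra_simps)
  then have lo: "x * M < real d + 3" by (rule mult_right_less_imp_less) (use pos(2) in linarith)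
  have "real d / M - x = (real d - x * M) / M" using pos by (simp add: field_simps)
  also have "\<bar>\<dots>\<bar> \<le> 3 / M" using up lo pos by (simp add: abs_divide divide_right_mono)
  finally show ?thesis by (simp add: rw drop_bit_eq_div d_def B_S_M_def)
qed

lemma reward_word_measurable: "reward_word n \<in> borel \<rightarrow>\<^sub>M count_space UNIV"
proof -
  have "(\<lambda>x::real. \<lfloor>x * (2 ^ n - 1)\<rfloor>) \<in> borel \<rightarrow>\<^sub>M count_space UNIV" by measurable
  from measurable_compose[OF this, of "\<lambda>z. take_bit n (nat z)" "count_space UNIV"]
  show ?thesis by (simp add: reward_word_def[abs_def])
qed

definition scale_of :: "real \<Rightarrow> nat" where
  "scale_of g = (LEAST n. 8 * (1 / 2) ^ n \<le> g)"

lemma scale_of: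
  assumes "0 < g" "g \<le> 1"
  shows "8 * (1 / 2) ^ scale_of g \<le> g" "g < 16 * (1 / 2) ^ scale_of g"
proof -
  obtain n where "(1 / 2 :: real) ^ n < g / 8"
    using real_arch_pow_inv[of "g / 8" "1 / 2"] assms by auto
  then have "8 * (1 / 2) ^ n \<le> g" by simp
  then show *: "8 * (1 / 2) ^ scale_of g \<le> g" unfolding scale_of_def by (rule LeastI)
  then have "scale_of g \<noteq> 0" using assms by (auto intro: ccontr)
  then obtain k where k: "scale_of g = Suc k" by (cases "scale_of g") auto
  then have "\<not> 8 * (1 / 2) ^ k \<le> g" using not_less_Least[of k "\<lambda>n. 8 * (1 / 2) ^ n \<le> g"]
    by (simp add: scale_of_def)
  then show "g < 16 * (1 / 2) ^ scale_of g" using k by simp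
qed

lemma scale_of_mono: "0 < g \<Longrightarrow> g \<le> h \<Longrightarrow> h \<le> 1 \<Longrightarrow> scale_of h \<le> scale_of g"
  unfolding scale_of_def[of h] using scale_of(1)[of g] by (intro Least_le) auto

lemma log1_ge: "1 \<le> log1 x" "ln x \<le> log1 x"
  by (simp_all add: log1_def)

text \<open>Scales pin down the gaps up to a factor 2, so 2^k <= 2 * g / m for their difference k.
  The bound ln 2 >= 1/2 converts this to natural logarithms.\<close>

lemma scale_of_bounds:
  assumes m: "0 < m" "m \<le> g" "g \<le> 1"
  shows "4 ^ scale_of g \<le> 256 / g\<^sup>2" "real (scale_of m) - real (scale_of g) \<le> 1 + 2 * log1 (g / m)"
proof -
  have g: "0 < g" "g \<le> 1" using m by auto
  have "g * 2 ^ scale_of g \<le> 16" using scale_of(2)[OF g] by (simp add: power_one_over field_simps)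
  then have "(g * 2 ^ scale_of g)\<^sup>2 \<le> 16\<^sup>2" using g by (intro power_mono) auto
  moreover have "(2 ^ scale_of g)\<^sup>2 = (4::real) ^ scale_of g"
    by (simp add: power2_eq_square power_mult_distrib[symmetric])
  ultimately show "4 ^ scale_of g \<le> 256 / g\<^sup>2" using g by (simp add: power_mult_distrib field_simps)
  define k where "k = scale_of m - scale_of g"
  have le: "scale_of g \<le> scale_of m" using scale_of_mono[OF m] .
  then have sm: "scale_of m = scale_of g + k" by (simp add: k_def)
  have "m < 16 * (1 / 2) ^ scale_of g * (1 / 2) ^ k"
    using scale_of(2)[of m] m sm by (simp add: power_add)
  also have "\<dots> \<le> 2 * g * (1 / 2) ^ k"
    using scale_of(1)[OF g] by (intro mult_right_mono) auto
  finally have "2 ^ k \<le> 2 * (g / m)" using m by (simp add: power_one_over field_simps)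
  then have "ln ((2::real) ^ k) \<le> ln (2 * (g / m))" using m by (subst ln_le_cancel_iff) auto
  then have "real k * ln 2 \<le> ln 2 + ln (g / m)" using m g ln_mult_pos[of 2 "g / m"] by (simp add: ln_realpow)
  moreover have ln2: "1 / 2 \<le> ln (2::real)" using ln2_ge_two_thirds by simp
  ultimately have "(real k - 1) * ln 2 \<le> log1 (g / m)"
    using log1_ge(2)[of "g / m"] by (simp add: algebra_simps)
  then have "real k - 1 \<le> 2 * log1 (g / m)"
  proof (cases "1 \<le> real k")
    case True
    have "(real k - 1) * (1 / 2) \<le> (real k - 1) * ln 2" using True ln2 by (intro mult_left_mono) auto
    then show ?thesis using \<open>(real k - 1) * ln 2 \<le> log1 (g / m)\<close> by simp
  next
    case False
    then show ?thesis using log1_ge(1)[of "g / m"] by linarith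
  qed
  then show "real (scale_of m) - real (scale_of g) \<le> 1 + 2 * log1 (g / m)" using sm by simp
qed

definition max_round :: "nat \<Rightarrow> nat" where
  "max_round T = Max {s. 4 ^ s \<le> 4 * T}"

text \<open>With the multiplier \<^term>\<open>128 * 16 ^ boost T\<close>, a stage fails with probability at most of order
  \<open>1 / T ^ 4\<close>, which allows for a union bound over the stages.\<close>

definition boost :: "nat \<Rightarrow> nat" where
  "boost T = (LEAST k. 1 + ln (real T) \<le> 16 ^ k)"

lemma finite_rounds: "finite {s. 4 ^ s \<le> (4::nat) * T}"
proof (rule finite_subset)
  show "{s. 4 ^ s \<le> 4 * T} \<subseteq> {..4 * T}"
  proof
    fix s assume "s \<in> {s. 4 ^ s \<le> 4 * T}"
    then have "4 ^ s \<le> 4 * T" by simp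
    moreover have "s < 2 ^ s" by (rule less_exp)
    moreover have "(2::nat) ^ s \<le> 4 ^ s" by (intro power_mono) auto
    ultimately have "s \<le> 4 * T" by linarith
    then show "s \<in> {..4 * T}" by simp
  qed
qed simp

lemma max_round:
  assumes "0 < T"
  shows "4 ^ s \<le> 4 * T \<Longrightarrow> s \<le> max_round T" "4 ^ max_round T \<le> 4 * T"
    "real (max_round T) \<le> 1 + log1 (real T)"
proof -
  show "4 ^ s \<le> 4 * T \<Longrightarrow> s \<le> max_round T"
    unfolding max_round_def by (intro Max_ge finite_rounds) simp
  have "(4::nat) ^ 1 \<le> 4 * T" using assms by simp
  then have "{s. 4 ^ s \<le> 4 * T} \<noteq> {}" by blast
  from Max_in[OF finite_rounds this] show 1: "4 ^ max_round T \<le> 4 * T"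
    by (simp add: max_round_def)
  then have "real (4 ^ max_round T) \<le> real (4 * T)" by (simp only: of_nat_le_iff)
  then have "(4::real) ^ max_round T \<le> 4 * real T" by simp
  then have "ln ((4::real) ^ max_round T) \<le> ln (4 * real T)" using assms by (subst ln_le_cancel_iff) auto
  then have *: "(real (max_round T) - 1) * ln 4 \<le> ln (real T)"
    using assms by (simp add: ln_realpow ln_mult algebra_simps)
  show "real (max_round T) \<le> 1 + log1 (real T)"
  proof (cases "1 \<le> real (max_round T)")
    case True
    have "1 \<le> ln (4::real)" using ln2_ge_two_thirds ln_realpow[of 2 2] by simp
    then have "(real (max_round T) - 1) * 1 \<le> (real (max_round T) - 1) * ln 4"
      using True by (intro mult_left_mono) auto
    also have "\<dots> \<le> log1 (real T)" using * log1_ge(2)[of "real T"] by (rule order_trans)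
    finally show ?thesis by simp
  next
    case False
    then show ?thesis using log1_ge(1)[of "real T"] by linarith
  qed
qed

lemma boost:
  assumes T: "0 < T"
  shows "1 + ln (real T) \<le> 16 ^ boost T" "16 ^ boost T \<le> 32 * log1 (real T)"
    "T \<le> 2 ^ n \<Longrightarrow> boost T \<le> n"
    "2 * (real T)\<^sup>2 * exp (- 4 * 16 ^ boost T) \<le> 1"
proof -
  have ln0: "0 \<le> ln (real T)" using T by simp
  have le: "boost T \<le> n" if "T \<le> 2 ^ n" for n
    unfolding boost_def
  proof (rule Least_le)
    have "1 + ln (real T) \<le> real T" using ln_le_minus_one[of "real T"] T by simp
    also have "\<dots> \<le> real (2 ^ n)" using that by (simp only: of_nat_le_iff)
    also have "\<dots> \<le> 16 ^ n" by (simp add: power_mono)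
    finally show "1 + ln (real T) \<le> 16 ^ n" .
  qed
  then show "T \<le> 2 ^ n \<Longrightarrow> boost T \<le> n" .
  obtain n where "T \<le> 2 ^ n" using less_exp[of T] less_imp_le by blast
  have "1 + ln (real T) \<le> 16 ^ T"
  proof -
    have "1 + ln (real T) \<le> real T" using ln_le_minus_one[of "real T"] T by simp
    also have "\<dots> \<le> real (2 ^ T)" using less_exp[of T] by (simp only: of_nat_le_iff)
    also have "\<dots> \<le> 16 ^ T" by (simp add: power_mono)
    finally show ?thesis .
  qed
  then show 1: "1 + ln (real T) \<le> 16 ^ boost T" unfolding boost_def by (rule LeastI)
  have "16 ^ boost T \<le> 16 * (1 + ln (real T))"
  proof (cases "boost T")
    case 0
    then show ?thesis using ln0 by simp
  next
    case (Suc k)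
    then have "\<not> 1 + ln (real T) \<le> 16 ^ k"
      using not_less_Least[of k "\<lambda>k. 1 + ln (real T) \<le> 16 ^ k"] by (simp add: boost_def)
    then show ?thesis using Suc by simp
  qed
  then show "16 ^ boost T \<le> 32 * log1 (real T)"
    unfolding distrib_left using log1_ge[of "real T"] by linarith
  have "exp (- 4 * 16 ^ boost T) \<le> exp (- 1 - 2 * ln (real T))"
    using 1 ln0 by (subst exp_le_cancel_iff) linarith
  also have "\<dots> = exp (- 1) / (real T)\<^sup>2"
    using T exp_double[of "ln (real T)"] by (simp add: exp_diff)
  also have "\<dots> \<le> (1 / 2) / (real T)\<^sup>2"
    using exp_ge_add_one_self[of 1] by (intro divide_right_mono) (auto simp: exp_minus field_simps)
  finally show "2 * (real T)\<^sup>2 * exp (- 4 * 16 ^ boost T) \<le> 1"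
    using T by (simp add: field_simps)
qed

lemma registers_prog: "(\<Union> (registers ` set (prog K k0 l))) \<subseteq> {..15}"
  by (auto simp: prog_def)

lemma space_used_prog: "space_used (prog K k0 l) \<le> 78"
  using card_mono[OF _ registers_prog[of K k0 l]] by (simp add: space_used_def length_prog)

section \<open>Assembling the regret bound\<close>

locale bandit_machine =
  bandit K T D + machine K k0 l T + bandit_scan K T D k0 "16 * l" word \<eta>
  for K T D k0 l \<eta> +
  assumes boost_def': "k0 = boost T" and eta_def: "\<eta> = 3 / 2 ^ (16 * l)"
begin

lemma mean_bounds: assumes "a \<in> {1..K}" shows "0 \<le> arm_mean D a" "arm_mean D a \<le> 1"
proof -
  interpret prob_space "DD a" by (rule prob_DD)
  have "integrable (DD a) clamp"
    by (rule integrable_const_bound[of _ 1]) (auto simp: clamp_def[abs_def] cong: measurable_cong_sets)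
  then have "(\<integral>x. clamp x \<partial>DD a) \<le> (\<integral>x. 1 \<partial>DD a)"
    by (rule integral_mono) (auto simp: clamp_def)
  moreover have "0 \<le> (\<integral>x. clamp x \<partial>DD a)"
    by (rule Bochner_Integration.integral_nonneg) (simp add: clamp_def)
  ultimately show "0 \<le> arm_mean D a" "arm_mean D a \<le> 1"
    using integral_clamp[OF assms] prob_space by simp_all
qed

lemma expected_pulls:
  assumes i: "i \<in> suboptimal_arms K D"
  shows "gap K D i * S.V (\<lambda>a. of_bool (a = i)) T start
    \<le> (256 * 600576) * (1 / gap K D i * log1 (gap K D i / min_gap K D) * log1 (real T))"
proof -
  have "best_mean K D \<in> arm_mean D ` {1..K}"
    unfolding best_mean_def using K_pos by (intro Max_in) auto
  then obtain b where b: "b \<in> {1..K}" "arm_mean D b = best_mean K D" by auto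
  have best: "arm_mean D a \<le> arm_mean D b" if "a \<in> {1..K}" for a
    unfolding b(2) best_mean_def using that by (intro Max_ge) auto
  define g m where "g = gap K D i" and "m = min_gap K D"
  have fin: "finite (suboptimal_arms K D)" by (simp add: suboptimal_arms_def)
  have iK: "i \<in> {1..K}" "0 < g" using i by (auto simp: suboptimal_arms_def g_def)
  have gb: "g = arm_mean D b - arm_mean D i" by (simp add: g_def gap_def b)
  have g1: "g \<le> 1" using mean_bounds[OF b(1)] mean_bounds[OF iK(1)] gb by simp
  have min: "m \<le> gap K D a" if "a \<in> suboptimal_arms K D" for a
    unfolding m_def min_gap_def using fin that by (intro Min_le) auto
  have "m \<in> gap K D ` suboptimal_arms K D"
    unfolding m_def min_gap_def using fin i by (intro Min_in) auto
  then have m: "0 < m" "m \<le> g" using min[OF i] by (auto simp: suboptimal_arms_def g_def)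
  define R where "R = max_round T"
  have R: "R \<le> l"
  proof -
    have "(4::nat) ^ R < 4 * 2 ^ l" using max_round(2)[OF T_pos] T_less by (simp add: R_def)
    then have "(2::nat) ^ (2 * R) < 2 ^ (2 + l)" by (simp add: power_mult power_add)
    then have "2 * R < 2 + l" by (simp only: power_strict_increasing_iff)
    then show ?thesis using l_pos by simp
  qed
  have eta: "128 * \<eta> \<le> w R"
  proof -
    have "128 * \<eta> \<le> 512 * w (16 * l)" by (simp add: eta_def power_one_over divide_right_mono)
    also have "512 * w (16 * l) \<le> 512 * w (R + 9)"
      using R l_pos by (intro mult_left_mono w_antimono) auto
    also have "\<dots> = w R" by (simp add: power_add power_one_over)
    finally show ?thesis .
  qed
  interpret scan_regret K k0 "16 * l" E nu i T R "scale_of g" "scale_of m" b "arm_mean D" \<eta>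
  proof unfold_locales
    show "4 ^ s \<le> 4 * T \<Longrightarrow> s \<le> R" for s using max_round(1)[OF T_pos] by (simp add: R_def)
    show "R + k0 + 7 \<le> 16 * l" using R k0_le l_pos by linarith
    show "\<bar>nu a - arm_mean D a\<bar> \<le> \<eta>" if "a \<in> {1..K}" for a using nu_approx[OF that] .
    show "128 * \<eta> \<le> w R" by (rule eta)
    show "2 * (real T)\<^sup>2 * exp (- 4 * 16 ^ k0) \<le> 1" unfolding boost_def' by (rule boost(4)[OF T_pos])
    show "i \<in> {1..K}" "b \<in> {1..K}" by fact+
    show "arm_mean D a \<le> arm_mean D b" if "a \<in> {1..K}" for a using best[OF that] .
    show "8 * w (scale_of m) \<le> arm_mean D b - arm_mean D a"
      if "a \<in> {1..K}" "arm_mean D a < arm_mean D b" for a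
    proof -
      have "a \<in> suboptimal_arms K D" using that b by (simp add: suboptimal_arms_def gap_def)
      from min[OF this] show ?thesis using scale_of(1)[of m] m g1 b by (simp add: gap_def)
    qed
    show "8 * w (scale_of g) \<le> arm_mean D b - arm_mean D i"
      "arm_mean D b - arm_mean D i < 16 * w (scale_of g)"
      using scale_of[OF iK(2) g1] gb by simp_all
    show "scale_of g \<le> scale_of m" using scale_of_mono[OF m g1] .
  qed
  define a b' where "a = log1 (real T)" and "b' = log1 (g / m)"
  have ab: "1 \<le> a" "1 \<le> b'" using log1_ge by (simp_all add: a_def b'_def)
  have ab': "a \<le> a * b'" "1 \<le> a * b'" using ab mult_mono[of 1 a 1 b'] mult_left_mono[of 1 b' a] by simp_all
  have "128 * 16 ^ k0 \<le> 128 * (32 * a)" using boost(2)[OF T_pos] by (simp add: boost_def' a_def)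
  \<comment> \<open>144 * 128 * 32 = 589824, and below 512 * 3 * 7 = 10752; their sum is 600576. The
    factor 256 comes from 4^G <= 256 / g^2.\<close>
  then have t1: "144 * (128 * 16 ^ k0) \<le> 589824 * (a * b')" using ab' by linarith
  have "real R + 1 \<le> 3 * a" using max_round(3)[OF T_pos] ab by (simp add: R_def a_def)
  moreover have "4 + real (scale_of m) - real (scale_of g) \<le> 7 * b'"
    using scale_of_bounds(2)[OF m g1] ab by (simp add: b'_def)
  moreover have "0 \<le> 4 + real (scale_of m) - real (scale_of g)"
    using scale_of_mono[OF m g1] by simp
  ultimately have "(real R + 1) * (4 + real (scale_of m) - real (scale_of g)) \<le> (3 * a) * (7 * b')"
    using ab by (intro mult_mono) auto
  also have "\<dots> = 21 * (a * b')" by simp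
  finally have t2: "512 * (real R + 1) * (4 + real (scale_of m) - real (scale_of g)) \<le> 10752 * (a * b')"
    unfolding mult.assoc by linarith
  have "S.V (\<lambda>a. of_bool (a = i)) T start \<le> 4 ^ scale_of g * (600576 * (a * b'))"
    using V_start_le t1 t2 by (intro order_trans[OF V_start_le] mult_left_mono) auto
  also have "\<dots> \<le> 256 / g\<^sup>2 * (600576 * (a * b'))"
    using scale_of_bounds(1)[OF m g1] ab' by (intro mult_right_mono) auto
  finally have "g * S.V (\<lambda>a. of_bool (a = i)) T start \<le> g * (256 / g\<^sup>2 * (600576 * (a * b')))"
    using iK by (intro mult_left_mono) auto
  also have "\<dots> = (256 * 600576) * (1 / g * b' * a)"
    using iK by (simp add: power2_eq_square field_simps)
  finally show ?thesis by (simp add: g_def m_def a_def b'_def)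
qed

lemma regret: "pseudo_regret K T D (chosen_arm b P) \<le> (256 * 600576) * regret_bound K T D"
proof -
  have "pseudo_regret K T D (chosen_arm b P)
      = (\<Sum>i\<in>suboptimal_arms K D. gap K D i * S.V (\<lambda>a. of_bool (a = i)) T start)"
    by (rule pseudo_regret_eq) (rule chosen_arm_traj)
  also have "\<dots> \<le> (256 * 600576) * regret_bound K T D"
    unfolding regret_bound_def sum_distrib_left by (intro sum_mono expected_pulls)
  finally show ?thesis .
qed

lemma valid: "valid_player K T D b P"
proof -
  have "\<exists>i\<in>{1..K}. plays b P \<omega> t i" if "t \<in> {1..T}" for \<omega> t
    using plays_traj[of "t - 1" \<omega>] traj_arm[of "fst \<omega>" "t - 1"] that by (cases t) auto
  then show ?thesis by (simp add: valid_player_def)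
qed

end

theorem theorem3:
  shows "\<exists>(c :: nat) (S :: nat) (C :: real).
    \<forall>(K :: nat) (T :: nat). K > 0 \<and> T > 0 \<longrightarrow>
      (\<exists>P :: program. space_used P \<le> S \<and>
        (\<forall>D :: nat \<Rightarrow> real measure. bandit_instance K D \<longrightarrow>
          (let b = word_length c K T in
            valid_player K T D b P \<and>
            pseudo_regret K T D (chosen_arm b P) \<le> C * regret_bound K T D)))"
proof (intro exI allI impI)
  fix K T :: nat
  assume KT: "K > 0 \<and> T > 0"
  define l where "l = nat \<lceil>log 2 (real (K * T) + 1)\<rceil>"
  have "0 < K * T" using KT by simp
  then have n1: "0 < real (K * T)" by (simp only: of_nat_0_less_iff)
  then have l1: "0 < log 2 (real (K * T) + 1)" by (subst zero_less_log_cancel_iff) linarith+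
  then have l_pos: "0 < l" by (simp add: l_def)
  have "log 2 (real (K * T) + 1) \<le> real l" using l1 by (simp add: l_def)
  then have "real (K * T) + 1 \<le> 2 powr real l" using n1 by (subst (asm) log_le_iff) linarith+
  then have "real (K * T + 1) \<le> real (2 ^ l)" by (simp add: powr_realpow)
  then have KTl: "K * T < 2 ^ l" by (simp only: of_nat_le_iff)
  have "K \<le> K * T" "T \<le> K * T" using KT by auto
  then have less: "K < 2 ^ l" "T < 2 ^ l" using KTl by linarith+
  \<comment> \<open>62 instructions and 16 registers give 78. \<open>K\<close> and \<open>T\<close>
    enter the program only through word constants, so its length is fixed. The word length factor 64
    matches the bit budget of the machine.\<close>
  show "space_used (prog K (boost T) l) \<le> 78 \<and>
      (\<forall>D :: nat \<Rightarrow> real measure. bandit_instance K D \<longrightarrow>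
        (let b = word_length 64 K T in
          valid_player K T D b (prog K (boost T) l) \<and>
          pseudo_regret K T D (chosen_arm b (prog K (boost T) l)) \<le> (256 * 600576) * regret_bound K T D))"
  proof (intro conjI allI impI)
    show "space_used (prog K (boost T) l) \<le> 78" by (rule space_used_prog)
    fix D :: "nat \<Rightarrow> real measure" assume D: "bandit_instance K D"
    interpret m: machine K "boost T" l T
      using KT less l_pos boost(3)[of T l] by unfold_locales auto
    interpret bandit_machine K T D "boost T" l "3 / 2 ^ (16 * l)"
    proof unfold_locales
      show "m.word \<in> borel \<rightarrow>\<^sub>M count_space UNIV"
        unfolding m.word_def[abs_def] 
        by (rule measurable_compose[OF reward_word_measurable]) simp
      show "m.word x < 2 ^ (16 * l)" for x by (rule m.word_less)
      show "\<bar>real (m.word x) / 2 ^ (16 * l) - x\<bar> \<le> 3 / 2 ^ (16 * l)" if "x \<in> {0..1}" for x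
        unfolding m.word_def using word_approx[OF that l_pos] .
    qed (use D KT in auto)
    have "word_length 64 K T = 64 * l" by (simp add: word_length_def l_def)
    then show "let b = word_length 64 K T in valid_player K T D b (prog K (boost T) l) \<and>
        pseudo_regret K T D (chosen_arm b (prog K (boost T) l)) \<le> (256 * 600576) * regret_bound K T D"
      using valid regret by (simp add: Let_def)
  qed
qed

end
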